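(* Let $(S_n)$ be the multidimensional elephant random walk with stops on $\mathbb{Z}^d$ with parameters $p,q\in[0,1]$, $r\in(0,1)$, $p+(2d-1)q+r=1$, in the critical regime $p=p_{d,r}$, where $p_{d,r}=\left(\frac{2d+1}{4d}\right)(1-r)$. Let $\sigma_n^2=\sum_{k=1}^n\|X_k\|^2$. Then, as $n\to\infty$, one has the convergence in distribution $$\frac{S_n}{\sqrt{\sigma_n^2\log\sigma_n^2}}\longrightarrow\mathcal{N}\Big(0,\frac1d I_d\Big).$$ Moreover, as $n\to\infty$, one has the convergence in distribution $$\frac{S_n}{\sqrt{n^{1-r}\log n}}\longrightarrow\sqrt{(1-r)\Sigma'}\,Z,$$ where $Z$ has the Gaussian distribution $\mathcal{N}\big(0,\frac1d I_d\big)$, $\Sigma'$ has the Mittag-Leffler distribution $\mathcal{ML}(1-r)$, and $\Sigma'$ is independent of $Z$.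
   Context: Multidimensional elephant random walk with stops (MERWS). Let $d\ge1$ be an integer and $p,q\in[0,1]$, $r\in(0,1)$ with $p+(2d-1)q+r=1$. Let $I_d$ be the $d\times d$ identity matrix and $J_d$ the $d\times d$ cyclic permutation matrix with $(J_d)_{i,i+1}=1$ for $1\le i\le d-1$, $(J_d)_{d,1}=1$, and all other entries $0$. Let $(e_1,\dots,e_d)$ be the standard basis of $\mathbb{R}^d$. Set $S_0=0$, let $X_1$ be uniformly distributed on the $2d$ vectors $\pm e_1,\dots,\pm e_d$, and $S_1=X_1$. For all $n\ge1$, $X_{n+1}=A_{n+1}X_{U_{n+1}}$ and $S_{n+1}=S_n+X_{n+1}$, where $U_{n+1}$ is uniformly distributed on $\{1,\dots,n\}$ and $A_{n+1}$ is a random matrix equal to $I_d$ with probability $p$, to $-I_d$ with probability $q$, to each of $J_d^i$ and $-J_d^i$ ($1\le i\le d-1$) with probability $q$, and to the zero matrix with probability $r$; $A_{n+1}$ and $U_{n+1}$ are independent of each other and of $\mathcal{F}_n=\sigma(X_1,\dots,X_n)$. $\|\cdot\|$ is the Euclidean norm. $\sigma_n^2$ is the trace of the Gram matrix $\sum_{k=1}^nX_kX_k^T$. Mittag-Leffler distribution: for $\alpha\in(0,1)$, a positive random variable $X$ has the $\mathcal{ML}(\alpha)$ distribution if $\mathbb{E}[\exp(tX)]=\sum_{n=0}^\infty \frac{t^n}{\Gamma(1+n\alpha)}$ for all $t\in\mathbb{R}$. *)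

theory Defs
  imports "HOL-Probability.Probability"
begin

(* The coordinates 1,...,d are the elements of the finite type 'd, with d = CARD('d);
   c is a bijection from {1..d} onto 'd, so that e_i is axis (c i) 1. *)

definition cyclic_perm_matrix :: "(nat \<Rightarrow> 'd) \<Rightarrow> real^'d^'d" where
  "cyclic_perm_matrix c =
     (\<chi> a b. if (\<exists>i\<in>{1..<CARD('d)}. a = c i \<and> b = c (i + 1)) \<or> (a = c (CARD('d)) \<and> b = c 1)
            then 1 else 0)"

(* The operation ^ on real^'d^'d acts componentwise, hence this power for the matrix product. *)
definition mat_power :: "real^'d^'d \<Rightarrow> nat \<Rightarrow> real^'d^'d" where
  "mat_power B k = (((**) B) ^^ k) (mat 1)"

definition past_events :: "'a measure \<Rightarrow> (nat \<Rightarrow> 'a \<Rightarrow> 'b::topological_space) \<Rightarrow> nat \<Rightarrow> 'a set set" where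
  "past_events M X n =
     sigma_sets (space M) (\<Union>k\<in>{1..n}. {X k -` B \<inter> space M | B. B \<in> sets borel})"

(* The library's indep_var requires both variables to have the same type. *)
definition indep_rv ::
    "'a measure \<Rightarrow> 'b measure \<Rightarrow> ('a \<Rightarrow> 'b) \<Rightarrow> 'c measure \<Rightarrow> ('a \<Rightarrow> 'c) \<Rightarrow> bool" where
  "indep_rv M S Y T Z \<longleftrightarrow>
     Y \<in> measurable M S \<and> Z \<in> measurable M T \<and>
     prob_space.indep_set M (sets (vimage_algebra (space M) Y S)) (sets (vimage_algebra (space M) Z T))"

(* X k is meaningful for k \<ge> 1, A k and U k for k \<ge> 2. Independence of A (n+1) and U (n+1),
   together with independence of the pair from the past, is mutual independence of
   A (n+1), U (n+1) and the past. *)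
locale merws = prob_space M
  for M :: "'a measure" +
  fixes c :: "nat \<Rightarrow> 'd::finite"
    and p q r :: real
    and X :: "nat \<Rightarrow> 'a \<Rightarrow> real^'d"
    and A :: "nat \<Rightarrow> 'a \<Rightarrow> real^'d^'d"
    and U :: "nat \<Rightarrow> 'a \<Rightarrow> nat"
  assumes labelling: "bij_betw c {1..CARD('d)} UNIV"
    and p_range: "p \<in> {0..1}"
    and q_range: "q \<in> {0..1}"
    and r_range: "r \<in> {0<..<1}"
    and total: "p + (2 * real CARD('d) - 1) * q + r = 1"
    and X_measurable: "\<And>n. n \<ge> 1 \<Longrightarrow> random_variable borel (X n)"
    and A_measurable: "\<And>n. n \<ge> 1 \<Longrightarrow> random_variable borel (A (n + 1))"
    and U_measurable: "\<And>n. n \<ge> 1 \<Longrightarrow> random_variable (count_space UNIV) (U (n + 1))"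
    and X_first:
      "\<And>i. i \<in> {1..CARD('d)} \<Longrightarrow> prob {\<omega>\<in>space M. X 1 \<omega> = axis (c i) 1} = 1 / (2 * real CARD('d))"
      "\<And>i. i \<in> {1..CARD('d)} \<Longrightarrow> prob {\<omega>\<in>space M. X 1 \<omega> = - axis (c i) 1} = 1 / (2 * real CARD('d))"
    and X_step: "\<And>n. n \<ge> 1 \<Longrightarrow> AE \<omega> in M. X (n + 1) \<omega> = A (n + 1) \<omega> *v X (U (n + 1) \<omega>) \<omega>"
    and U_uniform: "\<And>n k. n \<ge> 1 \<Longrightarrow> k \<in> {1..n} \<Longrightarrow> prob {\<omega>\<in>space M. U (n + 1) \<omega> = k} = 1 / real n"
    and A_distribution:
      "\<And>n. n \<ge> 1 \<Longrightarrow> prob {\<omega>\<in>space M. A (n + 1) \<omega> = mat 1} = p"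
      "\<And>n. n \<ge> 1 \<Longrightarrow> prob {\<omega>\<in>space M. A (n + 1) \<omega> = - mat 1} = q"
      "\<And>n i. n \<ge> 1 \<Longrightarrow> i \<in> {1..CARD('d) - 1} \<Longrightarrow>
         prob {\<omega>\<in>space M. A (n + 1) \<omega> = mat_power (cyclic_perm_matrix c) i} = q"
      "\<And>n i. n \<ge> 1 \<Longrightarrow> i \<in> {1..CARD('d) - 1} \<Longrightarrow>
         prob {\<omega>\<in>space M. A (n + 1) \<omega> = - mat_power (cyclic_perm_matrix c) i} = q"
      "\<And>n. n \<ge> 1 \<Longrightarrow> prob {\<omega>\<in>space M. A (n + 1) \<omega> = 0} = r"
    and A_indep_U: "\<And>n. n \<ge> 1 \<Longrightarrow> indep_rv M borel (A (n + 1)) (count_space UNIV) (U (n + 1))"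
    and AU_indep_past:
      "\<And>n. n \<ge> 1 \<Longrightarrow>
         indep_set
           (sets (vimage_algebra (space M) (\<lambda>\<omega>. (A (n + 1) \<omega>, U (n + 1) \<omega>))
             (borel \<Otimes>\<^sub>M count_space UNIV)))
           (past_events M X n)"

primrec walk :: "(nat \<Rightarrow> 'a \<Rightarrow> 'b::comm_monoid_add) \<Rightarrow> nat \<Rightarrow> 'a \<Rightarrow> 'b" where
  "walk X 0 \<omega> = 0"
| "walk X (Suc n) \<omega> = walk X n \<omega> + X (Suc n) \<omega>"

definition sigma_sq :: "(nat \<Rightarrow> 'a \<Rightarrow> 'b::real_normed_vector) \<Rightarrow> nat \<Rightarrow> 'a \<Rightarrow> real" where
  "sigma_sq X n \<omega> = (\<Sum>k=1..n. (norm (X k \<omega>))\<^sup>2)"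

definition critical_p :: "nat \<Rightarrow> real \<Rightarrow> real" where
  "critical_p d r = ((2 * real d + 1) / (4 * real d)) * (1 - r)"

(* The library's weak_conv_m is restricted to measures on the real line. *)
definition weakly_converges :: "(nat \<Rightarrow> 'b::topological_space measure) \<Rightarrow> 'b measure \<Rightarrow> bool" where
  "weakly_converges \<mu> \<nu> \<longleftrightarrow>
     (\<forall>f :: 'b \<Rightarrow> real. continuous_on UNIV f \<longrightarrow> bounded (range f) \<longrightarrow>
        (\<lambda>n. integral\<^sup>L (\<mu> n) f) \<longlonglongrightarrow> integral\<^sup>L \<nu> f)"

(* Intended for a symmetric positive definite covariance matrix C. *)
definition gaussian_measure :: "real^'d \<Rightarrow> real^'d^'d \<Rightarrow> (real^'d) measure" where
  "gaussian_measure m C =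
     density lborel (\<lambda>x. ennreal (exp (- ((x - m) \<bullet> (matrix_inv C *v (x - m))) / 2) /
                                   sqrt ((2 * pi) ^ CARD('d) * det C)))"

definition mittag_leffler_distributed :: "'a measure \<Rightarrow> real \<Rightarrow> ('a \<Rightarrow> real) \<Rightarrow> bool" where
  "mittag_leffler_distributed M \<alpha> Y \<longleftrightarrow>
     Y \<in> borel_measurable M \<and> (AE \<omega> in M. Y \<omega> > 0) \<and>
     (\<forall>t::real. integrable M (\<lambda>\<omega>. exp (t * Y \<omega>)) \<and>
        (\<lambda>n. t ^ n / Gamma (1 + real n * \<alpha>)) sums (\<integral>\<omega>. exp (t * Y \<omega>) \<partial>M))"

end

theory Submission
  imports Defs
begin

text \<open>
  The stops act only as an independent random time change, and this reduces the theorem to a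
  central limit theorem with deterministic norming. Put \<open>\<theta> = 1 - r\<close>. At the critical value of \<open>p\<close>
  one has \<open>p - q = \<theta> / 2\<close> and \<open>q = \<theta> / (4 d)\<close>, and the \<open>2 d\<close> matrices \<open>\<plusminus>J\<^sup>i\<close> carry any unit
  direction to each of the \<open>2 d\<close> directions \<open>\<plusminus>e\<^sub>i\<close> exactly once. If \<open>N\<close> of the first \<open>n\<close> steps were
  nonzero, then the next step is therefore nonzero with probability \<open>\<theta> N / n\<close>, and a nonzero step is,
  with probability one half each, a copy of a uniformly chosen earlier nonzero step or a fresh
  uniform direction. The decision whether to move ignores everything about the past but \<open>N\<close>, and
  the choice of the move ignores \<open>n\<close>. So the multiset \<open>K\<^sub>n\<close> of the nonzero steps up to time \<open>n\<close>, whose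
  sum is \<open>S\<^sub>n\<close> and whose size is \<open>\<sigma>\<^sub>n\<^sup>2\<close>, is distributed like the steps of a walk \<open>W\<close> without stops,
  observed at an independent random time \<open>N\<^sub>n\<close> (lemma \<open>law_of_moved\<close>).

  The walk \<open>W\<close> is treated by characteristic functions. With \<open>\<rho>\<^sub>m = (1 + 1/2) (1 + 1/4) \<dots> (1 + 1/(2m - 2))\<close>
  the process \<open>W\<^sub>m / \<rho>\<^sub>m\<close> is a martingale. As the directions become equidistributed, the conditional
  covariance of its \<open>k\<close>-th increment is close to \<open>\<rho>\<^sub>k\<^sup>-\<^sup>2 / d\<close> times the identity, and
  \<open>\<rho>\<^sub>m\<^sup>2 \<Sum>\<^sub>k \<rho>\<^sub>k\<^sup>-\<^sup>2 = m ln m + O(m)\<close>, which is where the logarithm comes from. Multiplying the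
  conditional characteristic functions of the increments gives lemma \<open>merw_char_bound\<close>:
  the characteristic function of \<open>W\<^sub>m\<close> at \<open>u\<close> is \<open>exp (- |u|\<^sup>2 m ln m / (2 d))\<close>, up to an error
  \<open>O(|u|\<^sup>2 m + |u|\<^sup>3 m powr (3/2))\<close>. Because the bound is uniform in \<open>m\<close> and \<open>u\<close>, it may be averaged
  over the random time.

  For the time itself, the rising factorial moments of \<open>N\<^sub>n\<close> are explicit products, so all moments of
  \<open>N\<^sub>n / n powr \<theta>\<close> converge to those of the Mittag-Leffler law, and Helly's theorem supplies a limit
  law (lemma \<open>moves_mittag_leffler_limit\<close>). A bound on the moment of order \<open>-1/2\<close> shows that \<open>N\<^sub>n\<close>
  tends to infinity and that the limit has no mass at \<open>0\<close>.

  The first claim follows by independence, since \<open>S\<^sub>n\<close> and \<open>\<sigma>\<^sub>n\<^sup>2\<close> have the joint law of \<open>W\<^sub>m\<close> and \<open>m\<close> at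
  \<open>m = N\<^sub>n\<close>. For the second one, write \<open>x = N\<^sub>n / n powr \<theta>\<close>. Then
  \<open>N\<^sub>n ln N\<^sub>n / (n powr \<theta> * ln n) = \<theta> x + x ln x / ln n\<close>, so the characteristic function of the
  normalised walk is asymptotically the mean of \<open>exp (- \<theta> |u|\<^sup>2 x / (2 d))\<close>, whose limit is the
  characteristic function of \<open>sqrt (\<theta> \<Sigma>') Z\<close>. A continuity theorem in Euclidean
  space (theorem \<open>weakly_converges_if_char_tendsto\<close>) turns this into weak convergence.
\<close>

section \<open>Characteristic functions determine weak convergence\<close>

text \<open>
  Real trigonometric polynomials with arbitrary real frequencies. They form an algebra that
  separates points, and their integrals are determined by characteristic functions.
\<close>

inductive trig_poly :: "('b::real_inner \<Rightarrow> real) \<Rightarrow> bool" where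
  trig_cos: "trig_poly (\<lambda>x. cos (u \<bullet> x))"
| trig_sin: "trig_poly (\<lambda>x. sin (u \<bullet> x))"
| trig_add: "trig_poly f \<Longrightarrow> trig_poly g \<Longrightarrow> trig_poly (\<lambda>x. f x + g x)"
| trig_scale: "trig_poly f \<Longrightarrow> trig_poly (\<lambda>x. a * f x)"

lemma trig_poly_const: "trig_poly (\<lambda>x. a)"
  using trig_scale[OF trig_cos[of 0], of a] by simp

text \<open>
  The product formulas turn a product of two waves into a sum of two waves.
\<close>

lemma trig_poly_mult_basic:
  assumes "trig_poly g"
  shows "trig_poly (\<lambda>x. cos (u \<bullet> x) * g x) \<and> trig_poly (\<lambda>x. sin (u \<bullet> x) * g x)"
  using assms
proof induction
  case (trig_cos v)
  have "(\<lambda>x. cos (u \<bullet> x) * cos (v \<bullet> x)) = (\<lambda>x. 1/2 * (cos ((u - v) \<bullet> x) + cos ((u + v) \<bullet> x)))"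
    by (auto simp: cos_times_cos inner_diff_left inner_add_left)
  moreover have "(\<lambda>x. sin (u \<bullet> x) * cos (v \<bullet> x)) = (\<lambda>x. 1/2 * (sin ((u + v) \<bullet> x) + sin ((u - v) \<bullet> x)))"
    by (auto simp: sin_times_cos inner_diff_left inner_add_left)
  ultimately show ?case
    by (simp only:) (intro conjI trig_poly.intros)
next
  case (trig_sin v)
  have "(\<lambda>x. cos (u \<bullet> x) * sin (v \<bullet> x)) = (\<lambda>x. 1/2 * (sin ((u + v) \<bullet> x) + (-1) * sin ((u - v) \<bullet> x)))"
    by (auto simp: cos_times_sin inner_diff_left inner_add_left)
  moreover have "(\<lambda>x. sin (u \<bullet> x) * sin (v \<bullet> x)) = (\<lambda>x. 1/2 * (cos ((u - v) \<bullet> x) + (-1) * cos ((u + v) \<bullet> x)))"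
    by (auto simp: sin_times_sin inner_diff_left inner_add_left)
  ultimately show ?case
    by (simp only:) (intro conjI trig_poly.intros)
next
  case (trig_add f g)
  then show ?case by (auto simp: distrib_left intro: trig_poly.trig_add)
next
  case (trig_scale f a)
  then show ?case by (auto simp: mult.left_commute intro: trig_poly.trig_scale)
qed

lemma trig_poly_mult:
  assumes "trig_poly f" "trig_poly g"
  shows "trig_poly (\<lambda>x. f x * g x)"
  using assms(1)
proof induction
  case (trig_add f1 f2)
  then show ?case by (auto simp: distrib_right intro: trig_poly.trig_add)
next
  case (trig_scale f a)
  then show ?case by (auto simp: mult.assoc intro: trig_poly.trig_scale)
qed (use trig_poly_mult_basic[OF assms(2)] in auto)

lemma trig_poly_polynomial:
  assumes "real_polynomial_function (q :: real \<Rightarrow> real)" "trig_poly f"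
  shows "trig_poly (\<lambda>x. q (f x))"
  using assms(1)
proof induction
  case (linear q)
  then have "q (f x) = q 1 * f x" for x
    using real_bounded_linear by (metis mult.commute mult_1)
  then show ?case using trig_scale[OF assms(2), of "q 1"] by simp
next
  case (add f g)
  then show ?case by (auto intro: trig_poly.trig_add)
next
  case (mult f g)
  then show ?case by (auto intro: trig_poly_mult)
qed (auto intro: trig_poly_const)

lemma trig_poly_bounded: "trig_poly f \<Longrightarrow> \<exists>B. \<forall>x. \<bar>f x\<bar> \<le> B"
proof (induction rule: trig_poly.induct)
  case (trig_add f g)
  then obtain B C where "\<forall>x. \<bar>f x\<bar> \<le> B" "\<forall>x. \<bar>g x\<bar> \<le> C" by auto
  then have "\<bar>f x + g x\<bar> \<le> B + C" for x
    by (meson abs_triangle_ineq add_mono order_trans)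
  then show ?case by auto
next
  case (trig_scale f a)
  then obtain B where "\<forall>x. \<bar>f x\<bar> \<le> B" by auto
  then have "\<bar>a * f x\<bar> \<le> \<bar>a\<bar> * B" for x by (simp add: abs_mult mult_left_mono)
  then show ?case by auto
qed (auto intro: exI[of _ 1])

lemma trig_poly_continuous: "trig_poly f \<Longrightarrow> continuous_on S f"
  by (induction rule: trig_poly.induct) (auto intro!: continuous_intros)

lemma integrable_bounded_continuous_borel:
  fixes f :: "'b::topological_space \<Rightarrow> real"
  assumes "prob_space \<mu>" "sets \<mu> = sets borel" "continuous_on UNIV f" "\<And>x. \<bar>f x\<bar> \<le> B"
  shows "integrable \<mu> f"
proof -
  interpret prob_space \<mu> by fact
  have "f \<in> borel_measurable \<mu>"
    using borel_measurable_continuous_onI[OF assms(3)] measurable_cong_sets[OF assms(2) refl] by blast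
  then show ?thesis
    by (intro integrable_const_bound[of f B]) (use assms in auto)
qed

lemma trig_poly_integrals_tendsto:
  fixes \<mu> :: "nat \<Rightarrow> 'b::euclidean_space measure"
  assumes \<mu>: "\<And>n. prob_space (\<mu> n)" "\<And>n. sets (\<mu> n) = sets borel"
    and \<nu>: "prob_space \<nu>" "sets \<nu> = sets borel"
    and cf: "\<And>u. (\<lambda>n. (\<integral>x. iexp (u \<bullet> x) \<partial>\<mu> n)) \<longlonglongrightarrow> (\<integral>x. iexp (u \<bullet> x) \<partial>\<nu>)"
    and "trig_poly f"
  shows "(\<lambda>n. \<integral>x. f x \<partial>\<mu> n) \<longlonglongrightarrow> (\<integral>x. f x \<partial>\<nu>)"
proof -
  have int: "integrable (\<mu> n) f" "integrable \<nu> f" if "trig_poly f" for f n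
    using trig_poly_bounded[OF that] trig_poly_continuous[OF that] \<mu> \<nu>
    by (auto intro: integrable_bounded_continuous_borel)
  have ci: "integrable m (\<lambda>x. iexp (u \<bullet> x))" if "prob_space m" "sets m = sets borel" for m :: "'b measure" and u
  proof -
    interpret prob_space m by fact
    have "(\<lambda>x. iexp (u \<bullet> x)) \<in> borel_measurable m"
      using that(2) by measurable
    then show ?thesis by (intro integrable_const_bound[of _ 1]) auto
  qed
  have Re: "(\<integral>x. cos (u \<bullet> x) \<partial>m) = Re (\<integral>x. iexp (u \<bullet> x) \<partial>m)" 
    and Im: "(\<integral>x. sin (u \<bullet> x) \<partial>m) = Im (\<integral>x. iexp (u \<bullet> x) \<partial>m)"
    if "prob_space m" "sets m = sets borel" for m :: "'b measure" and u
    using ci[OF that, of u] by (auto simp: integral_Re[symmetric] integral_Im[symmetric] Re_exp Im_exp simp del: integral_Re integral_Im)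
  show ?thesis
    using assms(6)
  proof induction
    case (trig_cos u)
    show ?case using tendsto_Re[OF cf[of u]] by (simp add: Re \<mu> \<nu>)
  next
    case (trig_sin u)
    show ?case using tendsto_Im[OF cf[of u]] by (simp add: Im \<mu> \<nu>)
  next
    case (trig_add f g)
    then show ?case by (simp add: int tendsto_add)
  next
    case (trig_scale f a)
    then show ?case by (simp add: tendsto_mult_left)
  qed
qed

text \<open>
  Every one-dimensional projection converges weakly, by Levy's theorem on the real line. This
  is used only to control the mass far away from the origin.
\<close>

lemma coordinate_weak_conv:
  fixes \<mu> :: "nat \<Rightarrow> 'b::euclidean_space measure"
  assumes \<mu>: "\<And>n. prob_space (\<mu> n)" "\<And>n. sets (\<mu> n) = sets borel"
    and \<nu>: "prob_space \<nu>" "sets \<nu> = sets borel"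
    and cf: "\<And>u. (\<lambda>n. (\<integral>x. iexp (u \<bullet> x) \<partial>\<mu> n)) \<longlonglongrightarrow> (\<integral>x. iexp (u \<bullet> x) \<partial>\<nu>)"
    and h: "continuous_on UNIV h" "\<And>t::real. \<bar>h t\<bar> \<le> B"
  shows "(\<lambda>n. \<integral>x. h (b \<bullet> x) \<partial>\<mu> n) \<longlonglongrightarrow> (\<integral>x. (h (b \<bullet> x) :: real) \<partial>\<nu>)"
proof -
  have meas[measurable]: "(\<lambda>x. b \<bullet> x) \<in> borel_measurable m" if "sets m = sets borel" for m :: "'b measure"
    using that by measurable
  have rd: "real_distribution (distr m borel (\<lambda>x. b \<bullet> x))" if "prob_space m" "sets m = sets borel" for m :: "'b measure"
    using that meas[OF that(2)] by (intro prob_space.real_distribution_distr) auto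
  have ch: "char (distr m borel (\<lambda>x. b \<bullet> x)) t = (\<integral>x. iexp ((t *\<^sub>R b) \<bullet> x) \<partial>m)" if "sets m = sets borel" for m :: "'b measure" and t
    unfolding char_def by (subst integral_distr) (use meas[OF that] in auto)
  have wc: "weak_conv_m (\<lambda>n. distr (\<mu> n) borel (\<lambda>x. b \<bullet> x)) (distr \<nu> borel (\<lambda>x. b \<bullet> x))"
  proof (rule levy_continuity)
    show "(\<lambda>n. char (distr (\<mu> n) borel ((\<bullet>) b)) t) \<longlonglongrightarrow> char (distr \<nu> borel ((\<bullet>) b)) t" for t
      unfolding ch[OF \<mu>(2)] ch[OF \<nu>(2)] by (rule cf)
  qed (use rd \<mu> \<nu> in auto)
  have "(\<lambda>n. \<integral>t. h t \<partial>distr (\<mu> n) borel (\<lambda>x. b \<bullet> x)) \<longlonglongrightarrow> (\<integral>t. h t \<partial>distr \<nu> borel (\<lambda>x. b \<bullet> x))"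
    by (rule weak_conv_imp_integral_bdd_continuous_conv[OF rd[OF \<mu>] rd[OF \<nu>] wc, of _ B])
       (use h in \<open>auto simp: continuous_on_eq_continuous_at\<close>)
  moreover have "h \<in> borel_measurable borel" using borel_measurable_continuous_onI[OF h(1)] .
  ultimately show ?thesis using meas \<mu>(2) \<nu>(2) by (simp add: integral_distr)
qed

text \<open>
  Stone--Weierstrass approximates a function uniformly on a ball by a trigonometric
  polynomial, which may however be huge outside of the ball. To keep it bounded, compose it with a
  polynomial that approximates the truncation at height \<open>B + 1\<close>: the result is again a
  trigonometric polynomial, and it is close to the truncated one everywhere, because a
  trigonometric polynomial has bounded range.
\<close>

lemma clamp_trig_poly:
  fixes f :: "'b::euclidean_space \<Rightarrow> real"
  assumes "continuous_on UNIV f" "\<And>x. \<bar>f x\<bar> \<le> B" "e > 0" 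
  obtains g where "trig_poly g" "\<And>x. \<bar>g x\<bar> \<le> B + 1 + e" "\<And>x. norm x \<le> R \<Longrightarrow> \<bar>f x - g x\<bar> \<le> 2 * e"
proof -
  have B: "B \<ge> 0" using assms(2)[of 0] by linarith
  interpret function_ring_on "Collect (trig_poly :: ('b \<Rightarrow> real) \<Rightarrow> bool)" "cball 0 R"
  proof
    fix x y :: 'b assume "x \<noteq> y"
    \<comment> \<open>A frequency whose phases at \<open>x\<close> and \<open>y\<close> differ by exactly \<open>1\<close>.\<close>
  define u where "u = (1 / (norm (x - y))\<^sup>2) *\<^sub>R (x - y)"
    have "u \<bullet> x - u \<bullet> y = u \<bullet> (x - y)" by (simp add: inner_diff_right)
    also have "\<dots> = 1" using \<open>x \<noteq> y\<close> by (simp add: u_def power2_norm_eq_inner)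
    finally have "u \<bullet> x - u \<bullet> y = 1" .
    then have *: "u \<bullet> x = u \<bullet> y + 1" by simp
    have "sin (u \<bullet> x) \<noteq> sin (u \<bullet> y) \<or> cos (u \<bullet> x) \<noteq> cos (u \<bullet> y)"
    proof (rule ccontr)
      assume "\<not> ?thesis"
      then have "cos (u \<bullet> x - u \<bullet> y) = 1"
        by (simp add: cos_diff sin_cos_squared_add3)
      then have "cos (1::real) = 1" using * by simp
      moreover have "cos (1::real) < cos 0" by (rule cos_monotone_0_pi) (use pi_gt3 in auto)
      ultimately show False by simp
    qed
    then show "\<exists>f\<in>Collect trig_poly. f x \<noteq> f y"
      using trig_cos[of u] trig_sin[of u] by auto
  qed (auto intro: trig_poly_continuous trig_add trig_poly_mult trig_poly_const)
  define e' where "e' = min e 1"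
  have e': "e' > 0" "e' \<le> e" "e' \<le> 1" using assms(3) by (auto simp: e'_def)
  obtain P where P: "trig_poly P" "\<And>x. norm x \<le> R \<Longrightarrow> \<bar>f x - P x\<bar> < e'"
    using Stone_Weierstrass_basic[OF continuous_on_subset[OF assms(1)] e'(1)] by auto
  obtain C where C: "\<And>x. \<bar>P x\<bar> \<le> C" using trig_poly_bounded[OF P(1)] by auto
  \<comment> \<open>The truncation at height \<open>B + 1\<close>; it does not affect \<open>P\<close> on the ball.\<close>
  define cl where "cl t = max (- (B + 1)) (min (B + 1) t)" for t :: real
  have "continuous_on {-C..C} cl" unfolding cl_def by (intro continuous_intros)
  then obtain q where q: "real_polynomial_function q" "\<And>t. t \<in> {-C..C} \<Longrightarrow> \<bar>cl t - q t\<bar> < e"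
    using Stone_Weierstrass_real_polynomial_function[of "{-C..C}" cl e] assms(3) by auto
  have q': "\<bar>cl (P x) - q (P x)\<bar> < e" for x using q(2)[of "P x"] C[of x] by (simp add: abs_le_iff)
  show ?thesis
  proof
    show "trig_poly (\<lambda>x. q (P x))" by (rule trig_poly_polynomial[OF q(1) P(1)])
    show "\<bar>q (P x)\<bar> \<le> B + 1 + e" for x
      using q'[of x] B unfolding cl_def by linarith
    show "\<bar>f x - q (P x)\<bar> \<le> 2 * e" if "norm x \<le> R" for x
    proof -
      have "cl (P x) = P x" using P(2)[OF that] assms(2)[of x] e' unfolding cl_def by linarith
      then show ?thesis using q'[of x] P(2)[OF that] e' by linarith
    qed
  qed
qed

text \<open>
  Levy's continuity theorem in several dimensions. A bounded continuous function differs
  little from a uniformly bounded trigonometric polynomial on a large ball; outside of the ball the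
  difference is dominated by a sum \<open>H\<close> of ramp functions of the coordinates, whose integrals
  converge by the one-dimensional theorem and are small in the limit.
\<close>

theorem weakly_converges_if_char_tendsto:
  fixes \<mu> :: "nat \<Rightarrow> 'b::euclidean_space measure"
  assumes \<mu>: "\<And>n. prob_space (\<mu> n)" "\<And>n. sets (\<mu> n) = sets borel"
    and \<nu>: "prob_space \<nu>" "sets \<nu> = sets borel"
    and cf: "\<And>u. (\<lambda>n. (\<integral>x. iexp (u \<bullet> x) \<partial>\<mu> n)) \<longlonglongrightarrow> (\<integral>x. iexp (u \<bullet> x) \<partial>\<nu>)"
  shows "weakly_converges \<mu> \<nu>"
  unfolding weakly_converges_def
proof (intro allI impI)
  fix f :: "'b \<Rightarrow> real"
  assume f: "continuous_on UNIV f" "bounded (range f)"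
  then obtain B where B: "\<And>x. \<bar>f x\<bar> \<le> B" unfolding bounded_iff by auto
  have B0: "B \<ge> 0" using B[of 0] by linarith
  define h where "h R t = min 1 (max 0 (\<bar>t\<bar> - R))" for R t :: real
  define H where "H R x = (\<Sum>b\<in>Basis. h R (b \<bullet> x))" for R and x :: 'b
  have h: "continuous_on UNIV (h R)" "\<bar>h R t\<bar> \<le> 1" "h R t \<ge> 0" for R t
    unfolding h_def by (auto intro!: continuous_intros)
  have ih: "integrable m (\<lambda>x. h R (b \<bullet> x))" if "prob_space m" "sets m = sets borel" for m :: "'b measure" and b R
    by (rule integrable_bounded_continuous_borel[OF that, of _ 1])
      (use h in \<open>auto intro!: continuous_intros continuous_on_compose2[OF h(1)]\<close>)
  have iH: "integrable m (H R)" if "prob_space m" "sets m = sets borel" for m :: "'b measure" and R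
    unfolding H_def using ih[OF that] by auto
  have Hconv: "(\<lambda>n. \<integral>x. H R x \<partial>\<mu> n) \<longlonglongrightarrow> (\<integral>x. H R x \<partial>\<nu>)" for R
    unfolding H_def 
    by (subst (1 2) Bochner_Integration.integral_sum)
       (use ih \<mu> \<nu> in \<open>auto intro!: tendsto_sum coordinate_weak_conv[OF \<mu> \<nu> cf h(1) h(2)]\<close>)
  have Hlim: "(\<lambda>k. \<integral>x. H (real k) x \<partial>\<nu>) \<longlonglongrightarrow> (\<integral>x. 0 \<partial>\<nu>)"
  proof (rule integral_dominated_convergence[where w = "\<lambda>x. real DIM('b)"])
    interpret prob_space \<nu> by fact
    show "integrable \<nu> (\<lambda>x. real DIM('b))" by simp
    show "H (real k) \<in> borel_measurable \<nu>" for k using iH[OF \<nu>] by (rule borel_measurable_integrable)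
    have "norm (H (real k) x) \<le> real DIM('b)" for k x
    proof -
      have "norm (H (real k) x) \<le> (\<Sum>b\<in>(Basis :: 'b set). 1)"
        unfolding H_def by (rule sum_norm_le) (use h in auto)
      then show ?thesis by simp
    qed
    then show "AE x in \<nu>. norm (H (real k) x) \<le> real DIM('b)" for k by simp
    have "(\<lambda>k. H (real k) x) \<longlonglongrightarrow> 0" for x
    proof (rule tendsto_eventually)
      obtain k0 :: nat where k0: "norm x \<le> real k0" using real_arch_simple by auto
      have "H (real k) x = 0" if "k \<ge> k0" for k
        unfolding H_def
      proof (rule sum.neutral, intro ballI)
        fix b :: 'b assume "b \<in> Basis"
        then have "\<bar>b \<bullet> x\<bar> \<le> norm x" by (metis Basis_le_norm inner_commute)
        also have "\<dots> \<le> real k" using k0 that by linarith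
        finally show "h (real k) (b \<bullet> x) = 0" unfolding h_def by simp
      qed
      then show "\<forall>\<^sub>F k in sequentially. H (real k) x = 0" unfolding eventually_sequentially by auto
    qed
    then show "AE x in \<nu>. (\<lambda>k. H (real k) x) \<longlonglongrightarrow> 0" by simp
  qed simp
  have outside: "H R x \<ge> 1" if "norm x > real DIM('b) * (R + 1)" "R \<ge> 0" for R x
  proof -
    have "\<exists>b\<in>Basis. \<bar>b \<bullet> x\<bar> > R + 1"
    proof (rule ccontr)
      assume "\<not> ?thesis"
      then have *: "\<bar>x \<bullet> b\<bar> \<le> R + 1" if "b \<in> Basis" for b using that by (auto simp: inner_commute not_less)
      have "norm x \<le> (\<Sum>b\<in>Basis. \<bar>x \<bullet> b\<bar>)" by (rule norm_le_l1)
      also have "\<dots> \<le> (\<Sum>b\<in>(Basis :: 'b set). R + 1)" by (intro sum_mono *)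
      finally show False using that by simp
    qed
    then obtain b where b: "b \<in> Basis" "\<bar>b \<bullet> x\<bar> > R + 1" by auto
    have "1 = h R (b \<bullet> x)" using b unfolding h_def by simp
    also have "\<dots> \<le> H R x" unfolding H_def by (intro member_le_sum) (use b h in auto)
    finally show ?thesis .
  qed
  show "(\<lambda>n. integral\<^sup>L (\<mu> n) f) \<longlonglongrightarrow> integral\<^sup>L \<nu> f"
  proof (rule LIMSEQ_I)
    fix e0 :: real assume "e0 > 0"
    define C where "C = 2 * B + 3"
    have C: "C > 0" using B0 by (simp add: C_def)
    define e where "e = min 1 (e0 / 16)"
    have e: "e > 0" "e \<le> 1" "e \<le> e0 / 16" using \<open>e0 > 0\<close> by (auto simp: e_def)
    define d where "d = e0 / (16 * C)"
    have d: "d > 0" using \<open>e0 > 0\<close> C by (simp add: d_def)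
    from LIMSEQ_D[OF Hlim d] obtain k where k: "\<bar>\<integral>x. H (real k) x \<partial>\<nu>\<bar> < d" by auto
    obtain g where g: "trig_poly g" "\<And>x. \<bar>g x\<bar> \<le> B + 1 + e"
      "\<And>x. norm x \<le> real DIM('b) * (real k + 1) \<Longrightarrow> \<bar>f x - g x\<bar> \<le> 2 * e"
      using clamp_trig_poly[OF f(1) B e(1), of "real DIM('b) * (real k + 1)"] by blast
    have diff: "\<bar>f x - g x\<bar> \<le> 2 * e + C * H (real k) x" for x
    proof (cases "norm x \<le> real DIM('b) * (real k + 1)")
      case True
      have "H (real k) x \<ge> 0" unfolding H_def by (intro sum_nonneg h)
      then show ?thesis using g(3)[OF True] C by (smt (verit) mult_nonneg_nonneg)
    next
      case False
      then have "H (real k) x \<ge> 1" by (intro outside) auto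
      then have "C \<le> C * H (real k) x" using C by simp
      then show ?thesis using g(2)[of x] B[of x] e unfolding C_def by linarith
    qed
    have est: "\<bar>(\<integral>x. f x \<partial>m) - (\<integral>x. g x \<partial>m)\<bar> \<le> 2 * e + C * (\<integral>x. H (real k) x \<partial>m)"
      if m: "prob_space m" "sets m = sets borel" for m :: "'b measure"
    proof -
      interpret prob_space m by fact
      have f': "integrable m f" by (rule integrable_bounded_continuous_borel[OF m f(1) B])
      have g': "integrable m g"
        by (rule integrable_bounded_continuous_borel[OF m trig_poly_continuous[OF g(1)] g(2)])
      have "\<bar>(\<integral>x. f x \<partial>m) - (\<integral>x. g x \<partial>m)\<bar> = \<bar>\<integral>x. f x - g x \<partial>m\<bar>" using f' g' by simp
      also have "\<dots> \<le> (\<integral>x. \<bar>f x - g x\<bar> \<partial>m)" by (rule integral_abs_bound)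
      also have "\<dots> \<le> (\<integral>x. 2 * e + C * H (real k) x \<partial>m)"
        by (rule integral_mono) (use f' g' iH[OF m] diff in auto)
      also have "\<dots> = 2 * e + C * (\<integral>x. H (real k) x \<partial>m)"
        using iH[OF m] by (simp add: prob_space)
      finally show ?thesis .
    qed
    have Cd: "C * d = e0 / 16" using C by (simp add: d_def)
    from LIMSEQ_D[OF Hconv d] obtain n1 where n1: "\<And>n. n \<ge> n1 \<Longrightarrow> \<bar>(\<integral>x. H (real k) x \<partial>\<mu> n) - (\<integral>x. H (real k) x \<partial>\<nu>)\<bar> < d"
      by force
    from LIMSEQ_D[OF trig_poly_integrals_tendsto[OF \<mu> \<nu> cf g(1)], of "e0/16"] \<open>e0 > 0\<close>
    obtain n2 where n2: "\<And>n. n \<ge> n2 \<Longrightarrow> \<bar>(\<integral>x. g x \<partial>\<mu> n) - (\<integral>x. g x \<partial>\<nu>)\<bar> < e0/16" by auto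
    have "norm (integral\<^sup>L (\<mu> n) f - integral\<^sup>L \<nu> f) < e0" if "n \<ge> max n1 n2" for n
    proof -
      have "(\<integral>x. H (real k) x \<partial>\<mu> n) \<le> 2 * d" "(\<integral>x. H (real k) x \<partial>\<nu>) \<le> d" using k n1[of n] that by auto
      then have "C * (\<integral>x. H (real k) x \<partial>\<mu> n) \<le> C * (2 * d)" "C * (\<integral>x. H (real k) x \<partial>\<nu>) \<le> C * d"
        using C by (auto intro: mult_left_mono)
      then show ?thesis
        using est[OF \<mu>, of n] est[OF \<nu>] n2[of n] that e Cd \<open>e0 > 0\<close> by auto
    qed
    then show "\<exists>no. \<forall>n\<ge>no. norm (integral\<^sup>L (\<mu> n) f - integral\<^sup>L \<nu> f) < e0" by blast
  qed
qed

section \<open>Isotropic Gaussian measures\<close>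

lemma prob_space_product_density:
  fixes \<phi> :: "real \<Rightarrow> real"
  assumes "prob_space (density lborel (\<lambda>t. ennreal (\<phi> t)))" "\<phi> \<in> borel_measurable borel" "\<And>t. \<phi> t \<ge> 0"
  shows "prob_space (density lborel (\<lambda>x :: 'b::euclidean_space. ennreal (\<Prod>b\<in>Basis. \<phi> (x \<bullet> b))))"
proof
  have one: "(\<integral>\<^sup>+t. ennreal (\<phi> t) \<partial>lborel) = 1"
  proof -
    interpret prob_space "density lborel (\<lambda>t. ennreal (\<phi> t))" by fact
    show ?thesis using emeasure_space_1 assms(2) by (simp add: emeasure_density)
  qed
  have "(\<integral>\<^sup>+x. ennreal (\<Prod>b\<in>Basis. \<phi> (x \<bullet> b)) \<partial>(lborel :: 'b measure)) = (\<integral>\<^sup>+x. (\<Prod>b\<in>Basis. ennreal (\<phi> (x \<bullet> b))) \<partial>(lborel :: 'b measure))"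
    by (intro nn_integral_cong) (use assms in \<open>simp add: prod_ennreal\<close>)
  also have "\<dots> = (\<Prod>b\<in>(Basis :: 'b set). (\<integral>\<^sup>+t. ennreal (\<phi> t) \<partial>lborel))"
    by (rule nn_integral_lborel_prod) (use assms(2) in auto)
  also have "\<dots> = 1" by (simp add: one)
  finally show "emeasure (density lborel (\<lambda>x :: 'b. ennreal (\<Prod>b\<in>Basis. \<phi> (x \<bullet> b)))) (space (density lborel (\<lambda>x :: 'b. ennreal (\<Prod>b\<in>Basis. \<phi> (x \<bullet> b))))) = 1"
    using assms(2) by (simp add: emeasure_density)
qed

lemma integral_lborel_prod:
  fixes f :: "'b::euclidean_space \<Rightarrow> real \<Rightarrow> complex"
  assumes "\<And>b. b \<in> Basis \<Longrightarrow> integrable lborel (f b)"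
  shows "(\<integral>x. (\<Prod>b\<in>Basis. f b (x \<bullet> b)) \<partial>lborel) = (\<Prod>b\<in>Basis. \<integral>t. f b t \<partial>lborel)"
proof -
  interpret product_sigma_finite "\<lambda>b :: 'b. lborel :: real measure" by standard
  have m: "(\<lambda>x. \<Prod>b\<in>Basis. f b (x \<bullet> b)) \<in> borel_measurable borel"
    using borel_measurable_integrable[OF assms] by measurable
  have "(\<integral>x. (\<Prod>b\<in>Basis. f b (x \<bullet> b)) \<partial>lborel) = 
      (\<integral>g. (\<Prod>b\<in>Basis. f b ((\<Sum>i\<in>Basis. g i *\<^sub>R i) \<bullet> b)) \<partial>(\<Pi>\<^sub>M b\<in>Basis. lborel))"
    by (subst lborel_eq, subst integral_distr) (use m in auto)
  also have "\<dots> = (\<integral>g. (\<Prod>b\<in>Basis. f b (g b)) \<partial>(\<Pi>\<^sub>M b\<in>Basis. lborel))"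
    by (intro Bochner_Integration.integral_cong refl prod.cong) (simp add: inner_sum_left_Basis)
  also have "\<dots> = (\<Prod>b\<in>Basis. \<integral>t. f b t \<partial>lborel)"
    by (rule product_integral_prod) (use assms in auto)
  finally show ?thesis .
qed

lemma char_normal_distribution:
  assumes "\<sigma> > 0"
  shows "(\<integral>t. normal_density 0 \<sigma> t *\<^sub>R iexp (s * t) \<partial>lborel) = exp (- ((\<sigma> * s)\<^sup>2) / 2)"
proof -
  have "complex_of_real (exp (- ((\<sigma> * s)\<^sup>2) / 2)) = char std_normal_distribution (\<sigma> * s)"
    by (simp add: char_std_normal_distribution)
  also have "\<dots> = (\<integral>t. std_normal_density t *\<^sub>R iexp ((\<sigma> * s) * t) \<partial>lborel)"
    unfolding char_def by (subst integral_density) (auto simp: normal_density_nonneg)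
  also have "\<dots> = (\<integral>t. normal_density 0 \<sigma> t *\<^sub>R iexp (s * t) \<partial>lborel)"
    by (subst (2) lborel_integral_real_affine[of \<sigma> _ 0])
       (use assms in \<open>auto simp: normal_density_def power_mult_distrib field_simps real_sqrt_mult
          simp flip: integral_scaleR_right intro!: Bochner_Integration.integral_cong\<close>)
  finally show ?thesis by simp
qed

lemma matrix_inv_scalar:
  assumes "a \<noteq> (0::real)"
  shows "matrix_inv (a *\<^sub>R mat 1 :: real^'d^'d) = (1 / a) *\<^sub>R mat 1"
proof -
  have *: "(a *\<^sub>R mat 1 :: real^'d^'d) ** B = a *\<^sub>R B" "B ** (a *\<^sub>R mat 1 :: real^'d^'d) = a *\<^sub>R B" for B a
    by (auto simp: scalar_matrix_assoc[symmetric] matrix_scalar_ac scalar_mult_eq_scaleR[symmetric])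
  have "\<exists>A'. (a *\<^sub>R mat 1 :: real^'d^'d) ** A' = mat 1 \<and> A' ** (a *\<^sub>R mat 1) = mat 1"
    using assms by (intro exI[of _ "(1 / a) *\<^sub>R mat 1"]) (simp add: *)
  then have "(a *\<^sub>R mat 1 :: real^'d^'d) ** matrix_inv (a *\<^sub>R mat 1) = mat 1"
    unfolding matrix_inv_def by (rule someI2_ex) auto
  then have "a *\<^sub>R matrix_inv (a *\<^sub>R mat 1 :: real^'d^'d) = mat 1" by (simp add: *)
  then have "(1 / a) *\<^sub>R (a *\<^sub>R matrix_inv (a *\<^sub>R mat 1 :: real^'d^'d)) = (1 / a) *\<^sub>R mat 1" by simp
  then show ?thesis using assms by simp
qed

lemma det_scalar: "det (a *\<^sub>R mat 1 :: real^'d^'d) = a ^ CARD('d)"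
proof -
  have "(a *\<^sub>R mat 1 :: real^'d^'d) = (\<chi> i. a *s (mat 1 $ i))"
    by (simp add: vec_eq_iff)
  then show ?thesis by (simp only: det_rows_mul) (simp add: vec_lambda_eta)
qed

text \<open>
  For a scalar covariance matrix the density factorises over the coordinates, so that
  everything reduces to the one-dimensional normal density.
\<close>

lemma gaussian_measure_scalar:
  assumes "v > 0"
  shows "gaussian_measure 0 (v *\<^sub>R mat 1 :: real^'d^'d) = 
    density lborel (\<lambda>x. ennreal (\<Prod>b\<in>Basis. normal_density 0 (sqrt v) (x \<bullet> b)))"
proof -
  have "(\<Prod>b\<in>Basis. normal_density 0 (sqrt v) (x \<bullet> b)) = 
      exp (- (x \<bullet> (matrix_inv (v *\<^sub>R mat 1) *v x)) / 2) / sqrt ((2 * pi) ^ CARD('d) * det (v *\<^sub>R mat 1 :: real^'d^'d))" for x :: "real^'d"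
  proof -
    have sq: "x \<bullet> x = (\<Sum>b\<in>Basis. (x \<bullet> b)\<^sup>2)" by (simp add: euclidean_inner[of x x] power2_eq_square)
    have "x \<bullet> (matrix_inv (v *\<^sub>R mat 1) *v x) = (x \<bullet> x) / v"
      using assms by (simp add: matrix_inv_scalar scaleR_matrix_vector_assoc[symmetric])
    then have "- (x \<bullet> (matrix_inv (v *\<^sub>R mat 1) *v x)) / 2 = (\<Sum>b\<in>Basis. - (x \<bullet> b)\<^sup>2 / (2 * v))"
      by (simp add: sq sum_divide_distrib sum_negf mult.commute)
    then have "exp (- (x \<bullet> (matrix_inv (v *\<^sub>R mat 1) *v x)) / 2) = (\<Prod>b\<in>Basis. exp (- (x \<bullet> b)\<^sup>2 / (2 * v)))"
      by (simp only: exp_sum[OF finite_Basis])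
    moreover have "sqrt ((2 * pi) ^ CARD('d) * det (v *\<^sub>R mat 1 :: real^'d^'d)) = sqrt (2 * pi * v) ^ DIM(real^'d)"
      by (simp only: det_scalar power_mult_distrib[symmetric] real_sqrt_power DIM_cart DIM_real mult_1_right)
    moreover have "normal_density 0 (sqrt v) t = exp (- t\<^sup>2 / (2 * v)) / sqrt (2 * pi * v)" for t
      using assms by (simp add: normal_density_def)
    ultimately show ?thesis by (simp add: prod_dividef)
  qed
  then show ?thesis unfolding gaussian_measure_def by simp
qed

lemma
  assumes "v > 0"
  shows prob_space_gaussian_measure: "prob_space (gaussian_measure 0 (v *\<^sub>R mat 1 :: real^'d^'d))"
    and char_gaussian_measure: "(\<integral>x. iexp (u \<bullet> x) \<partial>gaussian_measure 0 (v *\<^sub>R mat 1 :: real^'d^'d)) = exp (- v * (norm u)\<^sup>2 / 2)"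
proof -
  define \<phi> where "\<phi> = normal_density 0 (sqrt v)"
  have \<phi>: "\<phi> \<in> borel_measurable borel" "\<And>t. \<phi> t \<ge> 0" by (auto simp: \<phi>_def normal_density_nonneg)
  have ps: "prob_space (density lborel (\<lambda>t. ennreal (\<phi> t)))"
    unfolding \<phi>_def using assms by (intro prob_space_normal_density) simp
  show "prob_space (gaussian_measure 0 (v *\<^sub>R mat 1 :: real^'d^'d))"
    unfolding gaussian_measure_scalar[OF assms] \<phi>_def[symmetric]
    by (rule prob_space_product_density[OF ps \<phi>])
  have int: "integrable lborel (\<lambda>t. \<phi> t *\<^sub>R iexp (s * t))" for s
  proof -
    interpret prob_space "density lborel (\<lambda>t. ennreal (\<phi> t))" by fact
    have "integrable (density lborel (\<lambda>t. ennreal (\<phi> t))) (\<lambda>t. iexp (s * t))"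
      by (intro integrable_const_bound[of _ 1]) auto
    then show ?thesis using \<phi> by (subst (asm) integrable_density) auto
  qed
  have "(\<integral>x. iexp (u \<bullet> x) \<partial>gaussian_measure 0 (v *\<^sub>R mat 1 :: real^'d^'d)) = 
      (\<integral>x. (\<Prod>b\<in>Basis. \<phi> (x \<bullet> b)) *\<^sub>R iexp (u \<bullet> x) \<partial>lborel)"
    unfolding gaussian_measure_scalar[OF assms] \<phi>_def[symmetric]
    by (subst integral_density) (use \<phi> in \<open>auto intro: prod_nonneg\<close>)
  also have "\<dots> = (\<integral>x. (\<Prod>b\<in>Basis. \<phi> (x \<bullet> b) *\<^sub>R iexp ((u \<bullet> b) * (x \<bullet> b))) \<partial>lborel)"
  proof (intro Bochner_Integration.integral_cong refl)
    fix x :: "real^'d"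
    have "iexp (u \<bullet> x) = (\<Prod>b\<in>Basis. iexp ((u \<bullet> b) * (x \<bullet> b)))"
      by (subst euclidean_inner) (simp add: exp_sum sum_distrib_left)
    then show "(\<Prod>b\<in>Basis. \<phi> (x \<bullet> b)) *\<^sub>R iexp (u \<bullet> x) = (\<Prod>b\<in>Basis. \<phi> (x \<bullet> b) *\<^sub>R iexp ((u \<bullet> b) * (x \<bullet> b)))"
      by (simp add: scaleR_conv_of_real prod.distrib)
  qed
  also have "\<dots> = (\<Prod>b\<in>Basis. \<integral>t. \<phi> t *\<^sub>R iexp ((u \<bullet> b) * t) \<partial>lborel)"
    by (rule integral_lborel_prod[of "\<lambda>b t. \<phi> t *\<^sub>R iexp ((u \<bullet> b) * t)"]) (rule int)
  also have "\<dots> = (\<Prod>b\<in>Basis. complex_of_real (exp (- ((sqrt v * (u \<bullet> b))\<^sup>2) / 2)))"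
    unfolding \<phi>_def using assms by (intro prod.cong refl char_normal_distribution) simp
  also have "\<dots> = complex_of_real (exp (\<Sum>b\<in>Basis. - ((sqrt v * (u \<bullet> b))\<^sup>2) / 2))"
    by (simp add: exp_sum)
  also have "(\<Sum>b\<in>Basis. - ((sqrt v * (u \<bullet> b))\<^sup>2) / 2) = - v * (norm u)\<^sup>2 / 2"
  proof -
    have "(norm u)\<^sup>2 = (\<Sum>b\<in>Basis. (u \<bullet> b)\<^sup>2)"
      unfolding power2_norm_eq_inner by (subst euclidean_inner) (simp add: power2_eq_square)
    then show ?thesis
      using assms by (simp add: power_mult_distrib sum_negf sum_divide_distrib sum_distrib_left)
  qed
  finally show "(\<integral>x. iexp (u \<bullet> x) \<partial>gaussian_measure 0 (v *\<^sub>R mat 1 :: real^'d^'d)) = exp (- v * (norm u)\<^sup>2 / 2)" .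
qed

lemma sets_gaussian_measure [simp]: "sets (gaussian_measure m C) = sets borel"
  by (simp add: gaussian_measure_def)

section \<open>The critical elephant walk without stops\<close>

definition directions :: "'b::euclidean_space set" where
  "directions = Basis \<union> uminus ` Basis"

text \<open>
  The reinforced step at the critical value: with probability one half a fresh uniform
  direction, otherwise a uniform choice among the earlier steps, which are kept as a multiset because
  their order is irrelevant for all that follows.
\<close>

definition merw_step :: "'b::euclidean_space multiset \<Rightarrow> 'b pmf" where
  "merw_step K = (if K = {#} then pmf_of_set directions
     else bernoulli_pmf (1 / 2) \<bind> (\<lambda>fresh. if fresh then pmf_of_set directions else pmf_of_multiset K))"

primrec merw_pmf :: "nat \<Rightarrow> 'b::euclidean_space multiset pmf" where
  "merw_pmf 0 = return_pmf {#}"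
| "merw_pmf (Suc m) = merw_pmf m \<bind> (\<lambda>K. map_pmf (\<lambda>v. add_mset v K) (merw_step K))"

abbreviation step_mean :: "'b::euclidean_space multiset \<Rightarrow> ('b \<Rightarrow> 'c::{banach, second_countable_topology}) \<Rightarrow> 'c" where
  "step_mean K \<equiv> measure_pmf.expectation (merw_step K)"

abbreviation merw_mean :: "nat \<Rightarrow> ('b::euclidean_space multiset \<Rightarrow> 'c::{banach, second_countable_topology}) \<Rightarrow> 'c" where
  "merw_mean m \<equiv> measure_pmf.expectation (merw_pmf m)"

lemma finite_directions [simp]: "finite directions"
  by (simp add: directions_def)

lemma directions_nonempty [simp]: "directions \<noteq> {}"
  by (simp add: directions_def)

lemma Basis_inter_uminus_Basis: "(Basis :: 'b::euclidean_space set) \<inter> uminus ` Basis = {}"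
proof -
  have False if b: "b \<in> Basis" "c \<in> Basis" "b = - c" for b c :: 'b
  proof -
    have "b \<bullet> b = 1" using b(1) by simp
    moreover have "b \<bullet> b = - (c \<bullet> b)" using b(3) by (metis inner_minus_left)
    moreover have "c \<bullet> b \<ge> 0" using b(1,2) by (simp add: inner_Basis)
    ultimately show False by linarith
  qed
  then show ?thesis by auto
qed

lemma sum_directions: "(\<Sum>v\<in>directions. f v) = (\<Sum>b\<in>Basis. f b + f (- b))"
  unfolding directions_def
  by (subst sum.union_disjoint) (auto simp: Basis_inter_uminus_Basis sum.reindex sum.distrib)

lemma card_directions: "card (directions :: 'b::euclidean_space set) = 2 * DIM('b)"
proof -
  have "real (card (directions :: 'b set)) = (\<Sum>v\<in>(directions :: 'b set). 1)" by simp
  also have "\<dots> = 2 * real DIM('b)" by (subst sum_directions) simp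
  finally show ?thesis by linarith
qed

lemma norm_directions: "v \<in> directions \<Longrightarrow> norm v = 1"
  by (auto simp: directions_def)

lemma sum_directions_inner: "(\<Sum>v\<in>directions. w \<bullet> v) = 0"
  by (simp add: sum_directions)

lemma sum_directions_inner_sq: "(\<Sum>v\<in>directions. (w \<bullet> v)\<^sup>2) = 2 * (norm w)\<^sup>2"
proof -
  have "(\<Sum>v\<in>directions. (w \<bullet> v)\<^sup>2) = 2 * (\<Sum>b\<in>Basis. (w \<bullet> b) * (w \<bullet> b))"
    by (simp add: sum_directions sum_distrib_left power2_eq_square)
  then show ?thesis by (simp add: euclidean_inner[symmetric] power2_norm_eq_inner)
qed

lemma inner_sum_mset: "w \<bullet> sum_mset K = (\<Sum>v\<in>#K. w \<bullet> v)"
  by (induction K) (auto simp: inner_add_right)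

lemma sum_mset_eq_sum_count:
  fixes f :: "'a \<Rightarrow> 'c::real_vector"
  assumes "finite S" "set_mset K \<subseteq> S"
  shows "(\<Sum>v\<in>#K. f v) = (\<Sum>v\<in>S. real (count K v) *\<^sub>R f v)"
  using assms(2)
proof (induction K)
  case (add x K)
  have "(\<Sum>v\<in>S. real (count (add_mset x K) v) *\<^sub>R f v) = (\<Sum>v\<in>S. real (count K v) *\<^sub>R f v + (if v = x then f v else 0))"
    by (intro sum.cong) (auto simp: scaleR_left_distrib)
  then show ?case using add assms(1) by (simp add: sum.distrib sum.delta')
qed simp

lemma sum_mset_minus_const: "(\<Sum>v\<in>#K. f v - c) = (\<Sum>v\<in>#K. f v) - real (size K) * (c :: real)"
  by (induction K) (auto simp: algebra_simps)

lemma finite_set_pmf_merw_step [simp]: "finite (set_pmf (merw_step K))"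
  by (simp add: merw_step_def)

lemma set_pmf_merw_step: "set_mset K \<subseteq> directions \<Longrightarrow> set_pmf (merw_step K) \<subseteq> directions"
  by (auto simp: merw_step_def split: if_splits)

lemma finite_set_pmf_merw [simp]: "finite (set_pmf (merw_pmf m))"
  by (induction m) auto

lemma set_pmf_merw: "K \<in> set_pmf (merw_pmf m) \<Longrightarrow> size K = m \<and> set_mset K \<subseteq> directions"
proof (induction m arbitrary: K)
  case (Suc m)
  then obtain K' v where K': "K' \<in> set_pmf (merw_pmf m)" "v \<in> set_pmf (merw_step K')" "K = add_mset v K'"
    by auto
  then show ?case using Suc.IH[OF K'(1)] set_pmf_merw_step[of K'] by auto
qed simp

lemma expectation_bind_finite:
  fixes h :: "'a \<Rightarrow> 'c::{banach, second_countable_topology}"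
  assumes "finite (set_pmf p)" "\<And>x. x \<in> set_pmf p \<Longrightarrow> finite (set_pmf (f x))"
  shows "measure_pmf.expectation (p \<bind> f) h = measure_pmf.expectation p (\<lambda>x. measure_pmf.expectation (f x) h)"
  by (subst pmf_expectation_bind[of "set_pmf p"], use assms in simp_all)
     (subst integral_measure_pmf[of "set_pmf p"], use assms in auto)

lemma expectation_merw_Suc:
  fixes h :: "'b::euclidean_space multiset \<Rightarrow> 'c::{banach, second_countable_topology}"
  shows "merw_mean (Suc m) h =
    merw_mean m (\<lambda>K. step_mean K (\<lambda>v. h (add_mset v K)))"
  by (simp add: expectation_bind_finite)

lemma expectation_merw_step_nonempty:
  fixes f :: "'b::euclidean_space \<Rightarrow> 'c::{banach, second_countable_topology}"
  assumes "K \<noteq> {#}"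
  shows "step_mean K f =
    (1 / 2) *\<^sub>R ((\<Sum>v\<in>directions. f v) /\<^sub>R (2 * real DIM('b))) + (1 / 2) *\<^sub>R ((\<Sum>v\<in>#K. f v) /\<^sub>R real (size K))"
proof -
  have 1: "measure_pmf.expectation (pmf_of_set directions) f = (\<Sum>v\<in>directions. f v) /\<^sub>R (2 * real DIM('b))"
    by (subst integral_measure_pmf[of directions])
       (auto simp: card_directions scaleR_sum_right divide_simps intro!: sum.cong)
  have 2: "measure_pmf.expectation (pmf_of_multiset K) f = (\<Sum>v\<in>#K. f v) /\<^sub>R real (size K)"
    by (subst integral_measure_pmf[of "set_mset K"])
       (use assms in \<open>auto simp: sum_mset_eq_sum_count[of "set_mset K"] scaleR_sum_right divide_inverse mult.commute\<close>)
  have "step_mean K f = (1 / 2) *\<^sub>R measure_pmf.expectation (pmf_of_set directions) f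
      + (1 / 2) *\<^sub>R measure_pmf.expectation (pmf_of_multiset K) f"
    unfolding merw_step_def using assms by (simp add: pmf_expectation_bind[of UNIV] UNIV_bool)
  then show ?thesis unfolding 1 2 .
qed

text \<open>
  The conditional mean of a step functional is its mean \<open>c\<close> over all directions plus half the
  empirical deviation from \<open>c\<close>. For the empty multiset the quotient is a division by zero and
  vanishes, so that the formula covers the first step as well.
\<close>

lemma expectation_merw_step:
  fixes f :: "'b::euclidean_space \<Rightarrow> real"
  assumes c: "(\<Sum>v\<in>directions. f v) = 2 * real DIM('b) * c"
  shows "step_mean K f = c + (\<Sum>v\<in>#K. f v - c) / (2 * real (size K))"
proof (cases "K = {#}")
  case True
  have "step_mean K f = (\<Sum>v\<in>directions. f v) / real (card (directions :: 'b set))"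
    by (simp add: merw_step_def True integral_pmf_of_set)
  then show ?thesis using c True by (simp add: card_directions)
next
  case False
  then show ?thesis
    by (simp add: expectation_merw_step_nonempty c sum_mset_minus_const field_simps)
qed

lemma integrable_merw [simp]: "integrable (measure_pmf (merw_pmf m)) (f :: _ \<Rightarrow> 'c::{banach, second_countable_topology})"
  by (rule integrable_measure_pmf_finite) simp

lemma integrable_merw_step [simp]: "integrable (measure_pmf (merw_step K)) (f :: _ \<Rightarrow> 'c::{banach, second_countable_topology})"
  by (rule integrable_measure_pmf_finite) simp

lemma expectation_merw_mono:
  fixes f g :: "'b::euclidean_space multiset \<Rightarrow> real"
  assumes "\<And>K. size K = m \<Longrightarrow> set_mset K \<subseteq> directions \<Longrightarrow> f K \<le> g K"
  shows "merw_mean m f \<le> merw_mean m g"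
  by (rule integral_mono_AE) (use assms set_pmf_merw in \<open>auto simp: AE_measure_pmf_iff\<close>)

text \<open>
  If \<open>h\<close> has mean zero over the directions, then the sum of \<open>h\<close> over the steps grows in
  conditional mean by the factor \<open>1 + 1/(2m)\<close>, hence its square by \<open>1 + 1/m\<close>, up to a bounded
  addition. This is
  the borderline case, which produces the harmonic number. The lemma serves twice: for the size of
  the walk, and for the equidistribution of the directions.
\<close>

lemma merw_second_moment:
  fixes h :: "'b::euclidean_space \<Rightarrow> real"
  assumes "\<And>v. v \<in> directions \<Longrightarrow> \<bar>h v\<bar> \<le> B" "(\<Sum>v\<in>directions. h v) = 0"
  shows "merw_mean m (\<lambda>K. (\<Sum>v\<in>#K. h v)\<^sup>2) \<le> B\<^sup>2 * real m * harm m"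
proof (induction m)
  case (Suc m)
  define F where "F K = (\<Sum>v\<in>#K. h v)" for K
  let ?E = "merw_mean m"
  have step: "step_mean K (\<lambda>v. (F (add_mset v K))\<^sup>2) \<le> (F K)\<^sup>2 * (1 + 1 / real m) + B\<^sup>2"
    if K: "size K = m" "set_mset K \<subseteq> directions" for K
  proof -
    have "step_mean K h = F K / (2 * real m)"
      using expectation_merw_step[of h 0 K] assms(2) K by (simp add: F_def)
    moreover have "step_mean K (\<lambda>v. (h v)\<^sup>2) \<le> B\<^sup>2"
    proof -
      have "step_mean K (\<lambda>v. (h v)\<^sup>2) \<le> step_mean K (\<lambda>v. B\<^sup>2)"
        by (rule integral_mono_AE)
           (use assms(1) set_pmf_merw_step[OF K(2)] in \<open>auto simp: AE_measure_pmf_iff abs_le_square_iff[symmetric] intro: order_trans[OF _ abs_ge_self]\<close>)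
      then show ?thesis by simp
    qed
    moreover have "step_mean K (\<lambda>v. (F (add_mset v K))\<^sup>2) =
      step_mean K (\<lambda>v. (F K)\<^sup>2 + (2 * F K) * h v + (h v)\<^sup>2)"
      by (simp add: F_def power2_eq_square algebra_simps)
    ultimately show ?thesis by (simp add: power2_eq_square algebra_simps)
  qed
  have "merw_mean (Suc m) (\<lambda>K. (F K)\<^sup>2) \<le> ?E (\<lambda>K. (F K)\<^sup>2 * (1 + 1 / real m) + B\<^sup>2)"
    unfolding expectation_merw_Suc by (rule expectation_merw_mono) (rule step)
  also have "\<dots> = (1 + 1 / real m) * ?E (\<lambda>K. (F K)\<^sup>2) + B\<^sup>2" by simp
  also have "\<dots> \<le> (1 + 1 / real m) * (B\<^sup>2 * real m * harm m) + B\<^sup>2"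
    using Suc.IH by (intro add_mono mult_left_mono) (auto simp: F_def)
  also have "\<dots> = B\<^sup>2 * real (Suc m) * harm (Suc m)"
  proof (cases "m = 0")
    case True
    then show ?thesis by (simp add: harm_Suc harm_def)
  next
    case False
    have "(1 + 1 / real m) * (B\<^sup>2 * real m * harm m) + B\<^sup>2 = B\<^sup>2 * ((real m + 1) * harm m + 1)"
      using False by (simp add: divide_simps) (simp add: algebra_simps)
    also have "(real m + 1) * harm m + 1 = real (Suc m) * harm (Suc m)"
      by (simp add: harm_Suc field_simps)
    finally show ?thesis by (simp add: mult.assoc)
  qed
  finally show ?case by (simp add: F_def)
qed simp

lemma harm_le_sqrt: "harm m \<le> 2 * sqrt (real m)"
proof (induction m)
  case (Suc m)
  define a b where "a = sqrt (real m)" and "b = sqrt (real (Suc m))"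
  have ab: "b\<^sup>2 = a\<^sup>2 + 1" "a \<ge> 0" "b > 0" "a \<le> b" by (auto simp: a_def b_def)
  have "(b - a) * (b + a) = 1" using ab by (simp add: power2_eq_square algebra_simps)
  moreover have "(b - a) * (b + a) \<le> (b - a) * (2 * b)" using ab by (intro mult_left_mono) auto
  moreover have "(b - a) * (2 * b) = 2 * (b - a) * b" by simp
  ultimately have "1 \<le> 2 * (b - a) * b" by linarith
  then have "1 / b \<le> 2 * (b - a)" using ab(3) by (simp only: pos_divide_le_eq)
  moreover have "1 \<le> b" by (simp add: b_def)
  then have "b \<le> b\<^sup>2" by (simp add: power2_eq_square)
  then have "1 / b\<^sup>2 \<le> 1 / b" using ab(3) by (intro frac_le) auto
  ultimately have "1 / b\<^sup>2 \<le> 2 * (b - a)" by linarith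
  moreover have "1 / b\<^sup>2 = inverse (real (Suc m))" by (simp add: b_def inverse_eq_divide)
  ultimately show ?case using Suc.IH by (simp add: harm_Suc a_def b_def)
qed (simp add: harm_def)

lemma merw_abs_moment:
  fixes h :: "'b::euclidean_space \<Rightarrow> real"
  assumes "\<And>v. v \<in> directions \<Longrightarrow> \<bar>h v\<bar> \<le> B" "(\<Sum>v\<in>directions. h v) = 0" "B \<ge> 0"
  shows "merw_mean m (\<lambda>K. \<bar>\<Sum>v\<in>#K. h v\<bar>) \<le> 2 * B * real m powr (3/4)"
proof -
  let ?E = "merw_mean m"
  let ?F = "\<lambda>K. \<bar>\<Sum>v\<in>#K. h v\<bar>"
  \<comment> \<open>The nonnegativity of the variance bounds a first moment by a second one.\<close>
  have "0 \<le> measure_pmf.variance (merw_pmf m) ?F" by (rule measure_pmf.variance_positive)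
  also have "\<dots> = ?E (\<lambda>K. (?F K)\<^sup>2) - (?E ?F)\<^sup>2" by (rule measure_pmf.variance_eq) auto
  finally have "(?E ?F)\<^sup>2 \<le> B\<^sup>2 * real m * harm m"
    using merw_second_moment[OF assms(1,2), where m = m] by simp
  also have "\<dots> \<le> B\<^sup>2 * real m * (2 * sqrt (real m))" by (intro mult_left_mono harm_le_sqrt) auto
  also have "\<dots> \<le> (2 * B * real m powr (3/4))\<^sup>2"
  proof -
    have "(real m powr (3/4))\<^sup>2 = real m * sqrt (real m)"
      by (cases "m = 0") (simp_all add: powr_power powr_half_sqrt[symmetric] powr_mult_base)
    then show ?thesis by (simp add: power_mult_distrib mult_right_mono)
  qed
  finally show ?thesis by (rule power2_le_imp_le) (use assms(3) in simp)
qed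

lemma exp_minus_second_order:
  fixes a :: real
  assumes "a \<ge> 0"
  shows "\<bar>exp (- a) - (1 - a)\<bar> \<le> a" "\<bar>exp (- a) - (1 - a)\<bar> \<le> a\<^sup>2"
proof -
  have l: "1 - a \<le> exp (- a)" using exp_ge_add_one_self[of "- a"] by simp
  have u: "exp (- a) \<le> 1" using assms by simp
  have "1 + a + a\<^sup>2 / 2 \<le> exp a" using exp_lower_Taylor_quadratic[OF assms] .
  moreover have "1 - a + a\<^sup>2 \<ge> 0"
  proof -
    have "0 \<le> (1 - a)\<^sup>2 + a" using assms by simp
    also have "\<dots> = 1 - a + a\<^sup>2" by (simp add: power2_eq_square algebra_simps)
    finally show ?thesis .
  qed
  ultimately have "(1 - a + a\<^sup>2) * (1 + a + a\<^sup>2 / 2) \<le> (1 - a + a\<^sup>2) * exp a"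
    by (rule mult_left_mono)
  moreover have "(1 - a + a\<^sup>2) * (1 + a + a\<^sup>2 / 2) = 1 + (a\<^sup>2 + a ^ 3 + a ^ 4) / 2"
    by (simp add: power2_eq_square power3_eq_cube power4_eq_xxxx field_simps)
  then have "1 \<le> (1 - a + a\<^sup>2) * (1 + a + a\<^sup>2 / 2)" using assms by simp
  ultimately have "exp (- a) \<le> 1 - a + a\<^sup>2" by (simp add: exp_minus field_simps)
  then show "\<bar>exp (- a) - (1 - a)\<bar> \<le> a" "\<bar>exp (- a) - (1 - a)\<bar> \<le> a\<^sup>2"
    using l u assms by auto
qed

section \<open>A quantitative central limit theorem\<close>

lemma real_DIM_ge_1: "1 \<le> real DIM('a::euclidean_space)"
proof -
  have "DIM('a) \<ge> 1" using DIM_positive[where 'a = 'a] by linarith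
  then show ?thesis by linarith
qed

text \<open>
  One step of the martingale. After the drift \<open>1/(2k)\<close> times the present position is split off, a
  centred increment \<open>y\<close> remains, and a second order expansion of its characteristic function is
  compared with \<open>exp (- a)\<close>. The first error term measures how far the directions are from
  equidistribution, the second one is the square of the drift.
\<close>

lemma merw_step_char_approx:
  fixes w :: "'b::euclidean_space"
  assumes K: "set_mset K \<subseteq> directions"
  defines "k \<equiv> real (size K)" and "a \<equiv> (norm w)\<^sup>2 / (2 * real DIM('b))"
  shows "cmod (step_mean K (\<lambda>v. iexp (w \<bullet> sum_mset (add_mset v K)))
      - iexp ((1 + 1 / (2 * k)) * (w \<bullet> sum_mset K)) * exp (- a))
    \<le> \<bar>\<Sum>v\<in>#K. (w \<bullet> v)\<^sup>2 - 2 * a\<bar> / (4 * k) + (\<Sum>v\<in>#K. w \<bullet> v)\<^sup>2 / (8 * k\<^sup>2) + 2 * norm w ^ 3"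
proof -
  let ?E = "step_mean K"
  define G1 G2 where "G1 = (\<Sum>v\<in>#K. w \<bullet> v)" and "G2 = (\<Sum>v\<in>#K. (w \<bullet> v)\<^sup>2 - 2 * a)"
  define y where "y v = w \<bullet> v - G1 / (2 * k)" for v
  have G1: "G1 = w \<bullet> sum_mset K" by (simp add: G1_def inner_sum_mset)
  have wv: "\<bar>w \<bullet> v\<bar> \<le> norm w" if "v \<in> directions" for v
    using Cauchy_Schwarz_ineq2[of w v] norm_directions[OF that] by simp
  have G1_le: "\<bar>G1\<bar> \<le> k * norm w"
    using K unfolding G1_def k_def
  proof (induction K)
    case (add x K)
    then show ?case using wv[of x] by (auto simp: distrib_right)
  qed simp
  have y_le: "\<bar>y v\<bar> \<le> 3 / 2 * norm w" if "v \<in> directions" for v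
  proof -
    have "\<bar>G1 / (2 * k)\<bar> \<le> norm w / 2"
    proof (cases "k = 0")
      case False
      then have "k > 0" unfolding k_def by linarith
      then show ?thesis using G1_le by (simp add: field_simps)
    qed simp
    then show ?thesis using wv[OF that] unfolding y_def by linarith
  qed
  have Ew: "?E (\<lambda>v. w \<bullet> v) = G1 / (2 * k)"
    using expectation_merw_step[of "\<lambda>v. w \<bullet> v" 0 K] by (simp add: sum_directions_inner G1_def k_def)
  have Ew2: "?E (\<lambda>v. (w \<bullet> v)\<^sup>2) = 2 * a + G2 / (2 * k)"
    using expectation_merw_step[of "\<lambda>v. (w \<bullet> v)\<^sup>2" "2 * a" K]
    by (simp add: sum_directions_inner_sq a_def G2_def k_def)
  have Ey: "?E y = 0" unfolding y_def by (simp add: Ew)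
  have Ey2: "?E (\<lambda>v. (y v)\<^sup>2) = 2 * a + G2 / (2 * k) - (G1 / (2 * k))\<^sup>2"
  proof -
    have "?E (\<lambda>v. (y v)\<^sup>2) = ?E (\<lambda>v. (w \<bullet> v)\<^sup>2 - (2 * (G1 / (2 * k))) * (w \<bullet> v) + (G1 / (2 * k))\<^sup>2)"
      by (intro arg_cong[where f = ?E] ext) (simp only: y_def power2_diff, simp)
    also have "\<dots> = 2 * a + G2 / (2 * k) - (2 * (G1 / (2 * k))) * (G1 / (2 * k)) + (G1 / (2 * k))\<^sup>2"
      by (simp add: Ew Ew2)
    finally show ?thesis by (simp add: power2_eq_square)
  qed
  have taylor: "cmod (?E (\<lambda>v. iexp (y v)) - complex_of_real (1 - ?E (\<lambda>v. (y v)\<^sup>2) / 2)) \<le> norm w ^ 3"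
  proof -
    have "?E (\<lambda>v. 1 + \<i> * y v - complex_of_real (s v) / 2) = complex_of_real (1 - ?E s / 2)" for s
      using Ey by simp
    note e = this[of "\<lambda>v. (y v)\<^sup>2", symmetric]
    have "?E (\<lambda>v. iexp (y v)) - complex_of_real (1 - ?E (\<lambda>v. (y v)\<^sup>2) / 2) =
        ?E (\<lambda>v. iexp (y v) - (1 + \<i> * y v - complex_of_real ((y v)\<^sup>2) / 2))"
      unfolding e by (rule Bochner_Integration.integral_diff[symmetric]) simp_all
    also have "cmod \<dots> \<le> ?E (\<lambda>v. cmod (iexp (y v) - (1 + \<i> * y v - complex_of_real ((y v)\<^sup>2) / 2)))"
      by (rule integral_norm_bound)
    also have "\<dots> \<le> ?E (\<lambda>v. norm w ^ 3)"
    proof (rule integral_mono_AE)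
      have "cmod (iexp (y v) - (1 + \<i> * y v - complex_of_real ((y v)\<^sup>2) / 2)) \<le> norm w ^ 3" if "v \<in> directions" for v
      proof -
        have "cmod (iexp (y v) - (1 + \<i> * y v - complex_of_real ((y v)\<^sup>2) / 2)) \<le> \<bar>y v\<bar> ^ 3 / 6"
          using iexp_approx1[of "y v" 2]
          by (simp add: numeral_2_eq_2 numeral_3_eq_3 fact_numeral power2_eq_square algebra_simps)
        also have "\<dots> \<le> (3 / 2 * norm w) ^ 3 / 6"
          by (intro divide_right_mono power_mono y_le that) auto
        also have "\<dots> \<le> norm w ^ 3" by (simp add: power_mult_distrib power_divide)
        finally show ?thesis .
      qed
      then show "AE v in measure_pmf (merw_step K). cmod (iexp (y v) - (1 + \<i> * y v - complex_of_real ((y v)\<^sup>2) / 2)) \<le> norm w ^ 3"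
        using set_pmf_merw_step[OF K] by (auto simp: AE_measure_pmf_iff simp del: of_real_power)
    qed simp_all
    finally show ?thesis by simp
  qed
  have a: "0 \<le> a" "a \<le> (norm w)\<^sup>2"
  proof -
    have "1 \<le> 2 * real DIM('b)" using real_DIM_ge_1[where 'a = 'b] by linarith
    then have "(norm w)\<^sup>2 * 1 \<le> (norm w)\<^sup>2 * (2 * real DIM('b))" by (rule mult_left_mono) simp
    then show "a \<le> (norm w)\<^sup>2" by (simp add: a_def field_simps)
  qed (simp add: a_def)
  \<comment> \<open>The remainder is at most \<open>a\<close> and at most \<open>a\<^sup>2\<close>; either way it is at most \<open>|w|\<^sup>3\<close>.\<close>
  have gauss: "\<bar>exp (- a) - (1 - a)\<bar> \<le> norm w ^ 3"
  proof (cases "norm w \<le> 1")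
    case True
    have "a\<^sup>2 \<le> ((norm w)\<^sup>2)\<^sup>2" by (intro power_mono a)
    also have "\<dots> \<le> norm w ^ 3" using True by (simp flip: power_mult) (intro power_decreasing, auto)
    finally show ?thesis using exp_minus_second_order(2)[OF a(1)] by linarith
  next
    case False
    have "a \<le> (norm w)\<^sup>2" by (rule a)
    also have "\<dots> \<le> norm w ^ 3" using False by (intro power_increasing) auto
    finally show ?thesis using exp_minus_second_order(1)[OF a(1)] by linarith
  qed
  have split: "iexp (w \<bullet> sum_mset (add_mset v K)) = iexp ((1 + 1 / (2 * k)) * (w \<bullet> sum_mset K)) * iexp (y v)" for v
  proof -
    have "w \<bullet> sum_mset (add_mset v K) = (1 + 1 / (2 * k)) * (w \<bullet> sum_mset K) + y v"
      by (simp add: y_def G1 inner_add_right distrib_right)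
    then show ?thesis by (simp only: of_real_add distrib_left exp_add)
  qed
  have "?E (\<lambda>v. iexp (w \<bullet> sum_mset (add_mset v K))) - iexp ((1 + 1 / (2 * k)) * (w \<bullet> sum_mset K)) * exp (- a)
    = iexp ((1 + 1 / (2 * k)) * (w \<bullet> sum_mset K)) * (?E (\<lambda>v. iexp (y v)) - complex_of_real (exp (- a)))"
    unfolding split by (simp add: algebra_simps)
  also have "cmod \<dots> = cmod (?E (\<lambda>v. iexp (y v)) - complex_of_real (exp (- a)))"
    by (simp only: norm_mult norm_exp_i_times mult_1_left)
  also have "\<dots> \<le> cmod (?E (\<lambda>v. iexp (y v)) - complex_of_real (1 - ?E (\<lambda>v. (y v)\<^sup>2) / 2))
      + cmod (complex_of_real (1 - ?E (\<lambda>v. (y v)\<^sup>2) / 2) - complex_of_real (exp (- a)))"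
    by (rule norm_diff_triangle_le[OF order_refl order_refl])
  also have "cmod (complex_of_real (1 - ?E (\<lambda>v. (y v)\<^sup>2) / 2) - complex_of_real (exp (- a))) =
      \<bar>1 - ?E (\<lambda>v. (y v)\<^sup>2) / 2 - exp (- a)\<bar>" by (simp only: of_real_diff[symmetric] norm_of_real)
  also have "1 - ?E (\<lambda>v. (y v)\<^sup>2) / 2 - exp (- a) = (1 - a - exp (- a)) - G2 / (4 * k) + G1\<^sup>2 / (8 * k\<^sup>2)"
    unfolding Ey2 by (simp add: power_divide power_mult_distrib diff_divide_distrib add_divide_distrib)
  also have "\<bar>\<dots>\<bar> \<le> norm w ^ 3 + \<bar>G2\<bar> / (4 * k) + G1\<^sup>2 / (8 * k\<^sup>2)"
  proof -
    have "\<bar>G2 / (4 * k)\<bar> = \<bar>G2\<bar> / (4 * k)" "\<bar>G1\<^sup>2 / (8 * k\<^sup>2)\<bar> = G1\<^sup>2 / (8 * k\<^sup>2)" by (auto simp: k_def)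
    then show ?thesis using gauss by linarith
  qed
  finally show ?thesis using taylor unfolding G1_def G2_def by linarith
qed

text \<open>
  The factor by which the walk grows in mean, so that the walk divided by it is a martingale.
  The factor for \<open>j = 0\<close> is \<open>1\<close> because of the division by zero.
\<close>

definition merw_growth :: "nat \<Rightarrow> real" where
  "merw_growth m = (\<Prod>j<m. 1 + 1 / (2 * real j))"

lemma merw_growth_simps: "merw_growth 0 = 1" "merw_growth (Suc m) = merw_growth m * (1 + 1 / (2 * real m))"
  by (auto simp: merw_growth_def)

lemma merw_growth_pos: "merw_growth m > 0"
  by (auto simp: merw_growth_def add_pos_nonneg intro!: prod_pos)

text \<open>
  The square of the growth factor is comparable to \<open>m\<close>. Indeed \<open>(1 + 1/(2m))\<^sup>2 = 1 + 1/m + 1/(4 m\<^sup>2)\<close>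
  exceeds \<open>(m + 1) / m\<close>, but not \<open>(m + 3/4) / (m - 1/4)\<close>; the shift by \<open>1/4\<close> is exactly what
  absorbs the second order term.
\<close>

lemma merw_growth_ratio:
  assumes "1 \<le> k" "k \<le> m"
  shows "real m / real k \<le> (merw_growth m / merw_growth k)\<^sup>2" (is ?L)
    and "(merw_growth m / merw_growth k)\<^sup>2 \<le> (real m - 1/4) / (real k - 1/4)" (is ?U)
proof -
  have "?L \<and> ?U" using assms(2)
  proof (induction rule: dec_induct)
    case base
    then show ?case using assms(1) merw_growth_pos[of k] by simp
  next
    case (step m)
    define R where "R = (merw_growth m / merw_growth k)\<^sup>2"
    have m: "real m \<ge> 1" "real k \<ge> 1" using step assms by auto
    have R: "(merw_growth (Suc m) / merw_growth k)\<^sup>2 = R * (1 + 1 / (2 * real m))\<^sup>2"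
      by (simp add: merw_growth_simps R_def power_mult_distrib power_divide)
    have "real (Suc m) / real k = real m / real k * ((real m + 1) / real m)" using m by simp
    also have "\<dots> \<le> R * (1 + 1 / (2 * real m))\<^sup>2"
    proof (rule mult_mono)
      show "(real m + 1) / real m \<le> (1 + 1 / (2 * real m))\<^sup>2"
        using m by (simp add: power2_eq_square field_simps)
    qed (use step R_def in auto)
    finally have L: "real (Suc m) / real k \<le> (merw_growth (Suc m) / merw_growth k)\<^sup>2" unfolding R .
    have "R * (1 + 1 / (2 * real m))\<^sup>2 \<le> (real m - 1/4) / (real k - 1/4) * ((real (Suc m) - 1/4) / (real m - 1/4))"
    proof (rule mult_mono)
      have "(1 + 1 / (2 * real m))\<^sup>2 * (real m - 1/4) = real m + 3/4 - 1 / (16 * (real m)\<^sup>2)"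
        using m by (simp add: power2_eq_square field_simps)
      also have "\<dots> \<le> real (Suc m) - 1/4" by simp
      finally show "(1 + 1 / (2 * real m))\<^sup>2 \<le> (real (Suc m) - 1/4) / (real m - 1/4)"
        using m by (simp add: pos_le_divide_eq)
    qed (use step R_def m in auto)
    also have "\<dots> = (real (Suc m) - 1/4) / (real k - 1/4)" using m by simp
    finally show ?case using L R by simp
  qed
  then show ?L ?U by auto
qed

text \<open>
  Replacing the increments of the martingale by Gaussian ones, one at a time: the errors add
  up, since all factors that remain have modulus at most one.
\<close>

lemma merw_char_telescope:
  fixes u :: "'b::euclidean_space"
  defines "err \<equiv> \<lambda>k. (norm u / merw_growth (Suc k))\<^sup>2 * real k powr (-1/4) + 2 * (norm u / merw_growth (Suc k)) ^ 3"
  shows "cmod (merw_mean m (\<lambda>K. iexp ((u \<bullet> sum_mset K) / merw_growth m))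
      - exp (- (\<Sum>k<m. (norm u / merw_growth (Suc k))\<^sup>2 / (2 * real DIM('b))))) \<le> (\<Sum>k<m. err k)"
proof (induction m)
  case 0
  show ?case by simp
next
  case (Suc m)
  let ?E = "merw_mean m"
  define w where "w = u /\<^sub>R merw_growth (Suc m)"
  define a where "a = (norm w)\<^sup>2 / (2 * real DIM('b))"
  define T where "T = (\<Sum>k<m. (norm u / merw_growth (Suc k))\<^sup>2 / (2 * real DIM('b)))"
  have nw: "norm w = norm u / merw_growth (Suc m)"
    using merw_growth_pos[of "Suc m"] by (simp add: w_def divide_inverse)
  have a0: "a \<ge> 0" by (simp add: a_def)
  define G1 G2 where "G1 K = (\<Sum>v\<in>#K. w \<bullet> v)" and "G2 K = (\<Sum>v\<in>#K. (w \<bullet> v)\<^sup>2 - 2 * a)" for K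
  have wv: "\<bar>w \<bullet> v\<bar> \<le> norm w" if "v \<in> directions" for v
    using Cauchy_Schwarz_ineq2[of w v] norm_directions[OF that] by simp
  have G1: "?E (\<lambda>K. (G1 K)\<^sup>2) \<le> (norm w)\<^sup>2 * real m * (2 * sqrt (real m))"
    using merw_second_moment[of "\<lambda>v. w \<bullet> v" "norm w" m] wv harm_le_sqrt[of m]
    unfolding G1_def by (smt (verit, best) mult_left_mono of_nat_0_le_iff mult_nonneg_nonneg zero_le_power2 sum_directions_inner)
  have G2: "?E (\<lambda>K. \<bar>G2 K\<bar>) \<le> 2 * (norm w)\<^sup>2 * real m powr (3/4)"
    unfolding G2_def
  proof (rule merw_abs_moment)
    have d: "1 \<le> real DIM('b)" by (rule real_DIM_ge_1)
    fix v :: 'b assume v: "v \<in> directions"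
    have "(w \<bullet> v)\<^sup>2 \<le> (norm w)\<^sup>2" using wv[OF v] by (simp add: abs_le_square_iff[symmetric])
    moreover have "2 * a = (norm w)\<^sup>2 / real DIM('b)" by (simp add: a_def)
    then have "2 * a \<le> (norm w)\<^sup>2 / 1" using d by (simp only:) (intro divide_left_mono, auto)
    ultimately show "\<bar>(w \<bullet> v)\<^sup>2 - 2 * a\<bar> \<le> (norm w)\<^sup>2" using a0 by (simp add: abs_le_iff) (smt (verit) zero_le_power2)
  next
    show "(\<Sum>v\<in>directions. (w \<bullet> v)\<^sup>2 - 2 * a) = 0"
      by (simp add: sum_subtractf sum_directions_inner_sq card_directions a_def)
  qed simp
  have eq1: "(u \<bullet> sum_mset K) / merw_growth (Suc m) = w \<bullet> sum_mset K" for K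
    by (simp add: w_def divide_inverse mult.commute)
  have eq2: "(u \<bullet> sum_mset K) / merw_growth m = (1 + 1 / (2 * real m)) * (w \<bullet> sum_mset K)" for K
  proof -
    define c where "c = 1 + 1 / (2 * real m)"
    have "c > 0" by (simp add: c_def add_pos_nonneg)
    moreover have "w \<bullet> sum_mset K = (u \<bullet> sum_mset K) / (merw_growth m * c)"
      unfolding c_def by (simp only: eq1[symmetric] merw_growth_simps)
    ultimately show ?thesis unfolding c_def[symmetric] by simp
  qed
  let ?\<Psi> = "merw_mean (Suc m) (\<lambda>K. iexp ((u \<bullet> sum_mset K) / merw_growth (Suc m)))"
  let ?\<psi> = "?E (\<lambda>K. iexp ((u \<bullet> sum_mset K) / merw_growth m))"
  have "?\<Psi> - ?\<psi> * exp (- a) = ?E (\<lambda>K. step_mean K (\<lambda>v. iexp (w \<bullet> sum_mset (add_mset v K)))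
      - iexp ((1 + 1 / (2 * real m)) * (w \<bullet> sum_mset K)) * exp (- a))"
    unfolding eq1 eq2 expectation_merw_Suc by simp
  also have "cmod \<dots> \<le> ?E (\<lambda>K. cmod (step_mean K (\<lambda>v. iexp (w \<bullet> sum_mset (add_mset v K)))
      - iexp ((1 + 1 / (2 * real m)) * (w \<bullet> sum_mset K)) * exp (- a)))"
    by (rule integral_norm_bound)
  also have "\<dots> \<le> ?E (\<lambda>K. \<bar>G2 K\<bar> / (4 * real m) + (G1 K)\<^sup>2 / (8 * (real m)\<^sup>2) + 2 * norm w ^ 3)"
    by (rule expectation_merw_mono) (use merw_step_char_approx[where w = w] in \<open>auto simp: G1_def G2_def a_def\<close>)
  also have "\<dots> = ?E (\<lambda>K. \<bar>G2 K\<bar>) / (4 * real m) + ?E (\<lambda>K. (G1 K)\<^sup>2) / (8 * (real m)\<^sup>2) + 2 * norm w ^ 3" by simp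
  also have "\<dots> \<le> (2 * (norm w)\<^sup>2 * real m powr (3/4)) / (4 * real m)
      + ((norm w)\<^sup>2 * real m * (2 * sqrt (real m))) / (8 * (real m)\<^sup>2) + 2 * norm w ^ 3"
    by (intro add_mono divide_right_mono G1 G2) auto
  also have "\<dots> \<le> (norm w)\<^sup>2 * real m powr (-1/4) + 2 * norm w ^ 3"
  proof (cases "m = 0")
    case False
    then have m: "real m \<ge> 1" by simp
    have "real m powr (3/4) / real m = real m powr (-1/4)"
      using m powr_diff[of "real m" "3/4" 1] by simp
    moreover have "real m * sqrt (real m) / (real m)\<^sup>2 = real m powr (-1/2)"
      using m powr_diff[of "real m" "1/2" 1] by (simp add: power2_eq_square powr_half_sqrt)
    moreover have "real m powr (-1/2) \<le> real m powr (-1/4)" using m by (intro powr_mono) auto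
    moreover have "(2 * (norm w)\<^sup>2 * real m powr (3/4)) / (4 * real m) + ((norm w)\<^sup>2 * real m * (2 * sqrt (real m))) / (8 * (real m)\<^sup>2)
        = (norm w)\<^sup>2 * ((real m powr (3/4) / real m) / 2 + (real m * sqrt (real m) / (real m)\<^sup>2) / 4)"
      by (simp add: algebra_simps)
    moreover have "0 \<le> real m powr (-1/4)" by simp
    ultimately have "(2 * (norm w)\<^sup>2 * real m powr (3/4)) / (4 * real m) + ((norm w)\<^sup>2 * real m * (2 * sqrt (real m))) / (8 * (real m)\<^sup>2)
        = (norm w)\<^sup>2 * (real m powr (-1/4) / 2 + real m powr (-1/2) / 4)" by simp
    also have "\<dots> \<le> (norm w)\<^sup>2 * real m powr (-1/4)"
      using \<open>real m powr (-1/2) \<le> real m powr (-1/4)\<close> \<open>0 \<le> real m powr (-1/4)\<close>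
      by (intro mult_left_mono zero_le_power2) linarith
    finally show ?thesis by simp
  qed simp
  also have "\<dots> = err m" by (simp add: err_def nw)
  finally have one: "cmod (?\<Psi> - ?\<psi> * exp (- a)) \<le> err m" .
  have "?\<psi> * exp (- a) - exp (- (T + a)) = (?\<psi> - exp (- T)) * exp (- a)"
    by (simp only: left_diff_distrib of_real_mult[symmetric] exp_add[symmetric] minus_add_distrib)
  then have "cmod (?\<psi> * exp (- a) - exp (- (T + a))) = cmod (?\<psi> - exp (- T)) * exp (- a)"
    by (simp only: norm_mult norm_of_real abs_exp_cancel)
  also have "\<dots> \<le> (\<Sum>k<m. err k) * 1"
    using Suc.IH a0 unfolding T_def by (intro mult_mono) (auto intro: order_trans[OF norm_ge_zero])
  finally have two: "cmod (?\<psi> * exp (- a) - exp (- (T + a))) \<le> (\<Sum>k<m. err k)" by simp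
  have "(\<Sum>k<Suc m. (norm u / merw_growth (Suc k))\<^sup>2 / (2 * real DIM('b))) = T + a"
    by (simp add: T_def a_def nw)
  then show ?case using norm_diff_triangle_le[OF one two] by (simp only: sum.lessThan_Suc add.commute)
qed

lemma exp_minus_lipschitz:
  fixes x y :: real
  assumes "x \<ge> 0" "y \<ge> 0"
  shows "\<bar>exp (- x) - exp (- y)\<bar> \<le> \<bar>x - y\<bar>"
proof -
  have *: "\<bar>exp (- x) - exp (- y)\<bar> \<le> y - x" if "0 \<le> x" "x \<le> y" for x y :: real
  proof -
    have "exp (- y) = exp (- x) * exp (- (y - x))" by (simp flip: exp_add)
    then have "exp (- x) - exp (- y) = exp (- x) * (1 - exp (- (y - x)))" by (simp add: right_diff_distrib)
    also have "1 - exp (- (y - x)) \<le> y - x"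
      using exp_ge_add_one_self[of "- (y - x)"] by linarith
    then have "exp (- x) * (1 - exp (- (y - x))) \<le> 1 * (y - x)"
      using that by (intro mult_mono) auto
    finally show ?thesis using that by simp
  qed
  show ?thesis
    using *[of x y] *[of y x] assms by (cases "x \<le> y") (auto simp: abs_minus_commute)
qed

text \<open>
  The variance accumulated up to time \<open>m\<close>, in units of the last growth factor. Each summand lies
  between \<open>m / k\<close> and \<open>m (1 / k + 1 / k\<^sup>2)\<close>.
\<close>

lemma merw_variance_sum:
  defines "R \<equiv> \<lambda>m k. merw_growth m / merw_growth (Suc k)"
  shows "\<bar>(\<Sum>k<m. (R m k)\<^sup>2) - real m * ln (real m)\<bar> \<le> real m * (1 + (\<Sum>k. real (Suc k) powr (-2)))"
proof (cases "m = 0")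
  case False
  then have m: "m > 0" by simp
  have harm: "harm m = (\<Sum>k<m. 1 / real (Suc k))"
    by (simp add: harm_altdef inverse_eq_divide)
  have sq: "real (Suc k) powr (-2) = 1 / (real (Suc k))\<^sup>2" for k
    by (simp add: powr_minus powr_realpow inverse_eq_divide)
  have summ: "summable (\<lambda>k. real (Suc k) powr (-2))"
    using summable_real_powr_iff[of "-2"] summable_Suc_iff[of "\<lambda>n. real n powr (-2)"] by simp
  have lower: "(\<Sum>k<m. (R m k)\<^sup>2) \<ge> real m * harm m"
    unfolding harm sum_distrib_left
    by (intro sum_mono) (use merw_growth_ratio(1)[of "Suc _" m] in \<open>auto simp: R_def Suc_le_eq\<close>)
  have upper: "(\<Sum>k<m. (R m k)\<^sup>2) \<le> real m * (harm m + (\<Sum>k<m. real (Suc k) powr (-2)))"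
    unfolding harm sum.distrib[symmetric] sum_distrib_left
  proof (intro sum_mono)
    fix k assume "k \<in> {..<m}"
    then have "(R m k)\<^sup>2 \<le> (real m - 1/4) / (real (Suc k) - 1/4)"
      using merw_growth_ratio(2)[of "Suc k" m] by (simp add: R_def Suc_le_eq)
    also have "\<dots> \<le> real m / (real (Suc k) - 1/4)" by (intro divide_right_mono) auto
    also have "\<dots> \<le> real m * (1 / real (Suc k) + 1 / (real (Suc k))\<^sup>2)"
    proof -
      define x where "x = real (Suc k)"
      have x: "x \<ge> 1" by (simp add: x_def)
      have "1 \<le> (1 / x + 1 / x\<^sup>2) * (x - 1/4)"
        using x by (simp add: power2_eq_square field_simps)
      then have "1 / (x - 1/4) \<le> 1 / x + 1 / x\<^sup>2" using x by (simp add: pos_divide_le_eq)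
      then have "real m * (1 / (x - 1/4)) \<le> real m * (1 / x + 1 / x\<^sup>2)" by (rule mult_left_mono) simp
      then show ?thesis unfolding x_def by simp
    qed
    finally show "(R m k)\<^sup>2 \<le> real m * (1 / real (Suc k) + real (Suc k) powr (-2))" unfolding sq .
  qed
  have "(\<Sum>k<m. real (Suc k) powr (-2)) \<le> (\<Sum>k. real (Suc k) powr (-2))"
    by (rule sum_le_suminf[OF summ]) auto
  moreover have "harm m \<le> ln (real m) + 1" using decseqD[OF decseq_harm_diff_ln, of 0 "m - 1"] m by (simp add: harm_expand)
  ultimately have "real m * (harm m + (\<Sum>k<m. real (Suc k) powr (-2))) \<le> real m * (ln (real m) + 1 + (\<Sum>k. real (Suc k) powr (-2)))"
    by (intro mult_left_mono) auto
  moreover have "ln (real m) \<le> harm m" using ln_le_harm[of m] m by (smt (verit) ln_mono of_nat_0_less_iff)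
  then have "real m * ln (real m) \<le> real m * harm m" by (intro mult_left_mono) auto
  moreover have "0 \<le> real m * (1 + (\<Sum>k. real (Suc k) powr (-2)))"
    using suminf_nonneg[OF summ] by simp
  ultimately show ?thesis using lower upper by (simp add: distrib_left abs_le_iff)
qed simp

text \<open>
  The distance of the characteristic function of the unnormalised walk at time \<open>m\<close> from that of
  the centred Gaussian law with covariance matrix \<open>(m ln m / d) I\<close>.
\<close>

definition merw_char_error :: "nat \<Rightarrow> 'b::euclidean_space \<Rightarrow> real" where
  "merw_char_error m u = cmod (merw_mean m (\<lambda>K. iexp (u \<bullet> sum_mset K))
     - exp (- ((norm u)\<^sup>2 * (real m * ln (real m)) / (2 * real DIM('b)))))"

text \<open>
  The central limit theorem with a rate, for the unnormalised walk. The bound is uniform in the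
  time, which allows for a random time, and its error is smaller than the exponent
  \<open>|u|\<^sup>2 m ln m\<close> by the factor \<open>ln m\<close> on the relevant scale \<open>|u|\<^sup>2 \<approx> 1 / (m ln m)\<close>.
\<close>

lemma merw_char_bound:
  obtains C where "C \<ge> 0"
    "\<And>m (u :: 'b::euclidean_space). merw_char_error m u \<le> C * ((norm u)\<^sup>2 * real m + norm u ^ 3 * real m powr (3/2))"
proof -
  define c where "c s = (\<Sum>k. real (Suc k) powr s)" for s
  have summ: "summable (\<lambda>k. real (Suc k) powr s)" if "s < -1" for s
    using that summable_real_powr_iff[of s] summable_Suc_iff[of "\<lambda>n. real n powr s"] by simp
  have part: "(\<Sum>k<m. real (Suc k) powr s) \<le> c s" if "s < -1" for s m
    unfolding c_def by (rule sum_le_suminf[OF summ[OF that]]) auto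
  have c0: "c s \<ge> 0" if "s < -1" for s unfolding c_def by (rule suminf_nonneg[OF summ[OF that]]) simp
  define C where "C = 1 + c (-2) + 4 * c (-5/4) + 4 * c (-3/2)"
  have C0: "C \<ge> 0" using c0 by (auto simp: C_def intro!: add_nonneg_nonneg)
  have "merw_char_error m u \<le> C * ((norm u)\<^sup>2 * real m + norm u ^ 3 * real m powr (3/2))" for m and u :: 'b
  proof -
    define n where "n = norm u"
    have n: "n \<ge> 0" by (simp add: n_def)
    define R where "R k = merw_growth m / merw_growth (Suc k)" for k
    define T where "T = (\<Sum>k<m. (R k)\<^sup>2)"
    let ?d = "2 * real DIM('b)"
    have pos: "merw_growth m > 0" by (rule merw_growth_pos)
    have R0: "R k \<ge> 0" for k using merw_growth_pos by (simp add: R_def less_imp_le)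
    have R2: "(R k)\<^sup>2 \<le> 4/3 * (real m / real (Suc k))" if "k < m" for k
    proof -
      have "(R k)\<^sup>2 \<le> (real m - 1/4) / (real (Suc k) - 1/4)"
        using merw_growth_ratio(2)[of "Suc k" m] that by (simp add: R_def Suc_le_eq)
      also have "\<dots> \<le> real m / (3/4 * real (Suc k))" by (intro frac_le) auto
      finally show ?thesis by (simp add: mult.commute)
    qed
    have R3: "R k ^ 3 \<le> 2 * (real m powr (3/2) * real (Suc k) powr (-3/2))" if "k < m" for k
    proof -
      have "R k ^ 3 = ((R k)\<^sup>2) powr (3/2)"
        using R0[of k] by (simp add: powr_powr powr_realpow'[symmetric] flip: powr_numeral)
      also have "\<dots> \<le> (4/3 * (real m / real (Suc k))) powr (3/2)"
        by (intro powr_mono2 R2 that) auto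
      also have "\<dots> = (4/3) powr (3/2) * (real m powr (3/2) * real (Suc k) powr (-3/2))"
      proof -
        have "real (Suc k) powr (-3/2) = 1 / real (Suc k) powr (3/2)"
          using powr_minus_divide[of "real (Suc k)" "3/2"] by simp
        moreover have "(4/3 * (real m / real (Suc k))) powr (3/2) = (4/3) powr (3/2) * (real m powr (3/2) / real (Suc k) powr (3/2))"
          by (simp only: powr_mult powr_divide)
        ultimately show ?thesis by (simp only: times_divide_eq_right mult_1_right)
      qed
      also have "\<dots> \<le> (4/3) powr 2 * (real m powr (3/2) * real (Suc k) powr (-3/2))"
        by (intro mult_right_mono powr_mono) auto
      also have "\<dots> \<le> 2 * (real m powr (3/2) * real (Suc k) powr (-3/2))"
        by (intro mult_right_mono) (auto simp: power2_eq_square)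
      finally show ?thesis .
    qed
    have nk: "norm (merw_growth m *\<^sub>R u) / merw_growth (Suc k) = n * R k" for k
      using pos by (simp add: n_def R_def)
    have tele: "cmod (merw_mean m (\<lambda>K. iexp (u \<bullet> sum_mset K)) - exp (- (n\<^sup>2 * T / ?d)))
        \<le> (\<Sum>k<m. n\<^sup>2 * ((R k)\<^sup>2 * real k powr (-1/4)) + 2 * n ^ 3 * R k ^ 3)"
    proof -
      have 1: "((merw_growth m *\<^sub>R u) \<bullet> sum_mset K) / merw_growth m = u \<bullet> sum_mset K" for K
        using pos by simp
      have 2: "(\<Sum>k<m. (n * R k)\<^sup>2 / ?d) = n\<^sup>2 * T / ?d"
        by (simp only: T_def power_mult_distrib sum_divide_distrib[symmetric] sum_distrib_left[symmetric])
      have 3: "(\<Sum>k<m. (n * R k)\<^sup>2 * real k powr (-1/4) + 2 * (n * R k) ^ 3) = (\<Sum>k<m. n\<^sup>2 * ((R k)\<^sup>2 * real k powr (-1/4)) + 2 * n ^ 3 * R k ^ 3)"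
        by (simp only: power_mult_distrib mult.assoc)
      show ?thesis using merw_char_telescope[of m "merw_growth m *\<^sub>R u"] unfolding nk 1 2 3 .
    qed
    have s1: "(R k)\<^sup>2 * real k powr (-1/4) \<le> 4 * real m * real (Suc k) powr (-5/4)" if "k < m" for k
    proof (cases "k = 0")
      case False
      have "real k powr (-1/4) \<le> (real (Suc k) / 2) powr (-1/4)"
        using False by (intro powr_mono2') auto
      also have "\<dots> = 2 powr (1/4) * real (Suc k) powr (-1/4)"
      proof -
        have "x powr (-1/4) = 1 / x powr (1/4)" for x :: real
          using powr_minus_divide[of x "1/4"] by simp
        moreover have "(real (Suc k) / 2) powr (1/4) = real (Suc k) powr (1/4) / 2 powr (1/4)"
          by (simp only: powr_divide)
        ultimately show ?thesis by simp
      qed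
      also have "\<dots> \<le> 2 powr 1 * real (Suc k) powr (-1/4)" by (intro mult_right_mono powr_mono) auto
      finally have "(R k)\<^sup>2 * real k powr (-1/4) \<le> (4/3 * (real m / real (Suc k))) * (2 * real (Suc k) powr (-1/4))"
        using R2[OF that] by (intro mult_mono) auto
      also have "\<dots> = 8/3 * real m * (real (Suc k) powr (-1/4) / real (Suc k))" by simp
      also have "real (Suc k) powr (-1/4) / real (Suc k) = real (Suc k) powr (-5/4)"
        using powr_diff[of "real (Suc k)" "-1/4" 1] by simp
      also have "8/3 * real m * real (Suc k) powr (-5/4) \<le> 4 * real m * real (Suc k) powr (-5/4)"
        by (intro mult_right_mono) auto
      finally show ?thesis .
    qed simp
    have "(\<Sum>k<m. n\<^sup>2 * ((R k)\<^sup>2 * real k powr (-1/4)) + 2 * n ^ 3 * R k ^ 3)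
      \<le> (\<Sum>k<m. n\<^sup>2 * (4 * real m * real (Suc k) powr (-5/4)) + 2 * n ^ 3 * (2 * (real m powr (3/2) * real (Suc k) powr (-3/2))))"
      using n by (intro sum_mono add_mono mult_left_mono s1 R3) auto
    also have "\<dots> = (4 * n\<^sup>2 * real m) * (\<Sum>k<m. real (Suc k) powr (-5/4)) + (2 * n ^ 3 * (2 * real m powr (3/2))) * (\<Sum>k<m. real (Suc k) powr (-3/2))"
      by (simp only: sum.distrib sum_distrib_left mult.assoc mult.commute mult.left_commute)
    also have "\<dots> \<le> (4 * n\<^sup>2 * real m) * c (-5/4) + (2 * n ^ 3 * (2 * real m powr (3/2))) * c (-3/2)"
      using n by (intro add_mono mult_left_mono part) auto
    finally have E1: "cmod (merw_mean m (\<lambda>K. iexp (u \<bullet> sum_mset K)) - exp (- (n\<^sup>2 * T / ?d)))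
        \<le> (4 * n\<^sup>2 * real m) * c (-5/4) + (2 * n ^ 3 * (2 * real m powr (3/2))) * c (-3/2)"
      by (rule order_trans[OF tele])
    have lnm: "0 \<le> ln (real m)" by (cases "m = 0") auto
    have "\<bar>exp (- (n\<^sup>2 * T / ?d)) - exp (- (n\<^sup>2 * (real m * ln (real m)) / ?d))\<bar> \<le> \<bar>n\<^sup>2 * T / ?d - n\<^sup>2 * (real m * ln (real m)) / ?d\<bar>"
      by (rule exp_minus_lipschitz) (auto simp: T_def lnm intro!: sum_nonneg divide_nonneg_nonneg mult_nonneg_nonneg)
    also have "n\<^sup>2 * T / ?d - n\<^sup>2 * (real m * ln (real m)) / ?d = (n\<^sup>2 / ?d) * (T - real m * ln (real m))"
      by (simp add: algebra_simps diff_divide_distrib)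
    also have "\<bar>\<dots>\<bar> = (n\<^sup>2 / ?d) * \<bar>T - real m * ln (real m)\<bar>" by (simp add: abs_mult)
    also have "\<dots> \<le> n\<^sup>2 * (real m * (1 + c (-2)))"
    proof (rule mult_mono)
      have d: "1 \<le> ?d" using real_DIM_ge_1[where 'a = 'b] by linarith
      have "n\<^sup>2 / ?d \<le> n\<^sup>2 / 1" using d by (intro divide_left_mono) auto
      then show "n\<^sup>2 / ?d \<le> n\<^sup>2" by simp
      show "\<bar>T - real m * ln (real m)\<bar> \<le> real m * (1 + c (-2))"
        using merw_variance_sum[of m] by (simp add: T_def R_def c_def)
    qed auto
    finally have E2: "cmod (complex_of_real (exp (- (n\<^sup>2 * T / ?d))) - complex_of_real (exp (- (n\<^sup>2 * (real m * ln (real m)) / ?d)))) \<le> n\<^sup>2 * (real m * (1 + c (-2)))"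
      by (simp only: of_real_diff[symmetric] norm_of_real)
    have "cmod (merw_mean m (\<lambda>K. iexp (u \<bullet> sum_mset K)) - exp (- (n\<^sup>2 * (real m * ln (real m)) / ?d)))
      \<le> (4 * n\<^sup>2 * real m) * c (-5/4) + (2 * n ^ 3 * (2 * real m powr (3/2))) * c (-3/2) + n\<^sup>2 * (real m * (1 + c (-2)))"
      by (rule norm_diff_triangle_le[OF E1 E2])
    also have "\<dots> = (n\<^sup>2 * real m) * (1 + c (-2) + 4 * c (-5/4)) + (n ^ 3 * real m powr (3/2)) * (4 * c (-3/2))"
      by (simp add: algebra_simps)
    also have "\<dots> \<le> (n\<^sup>2 * real m) * C + (n ^ 3 * real m powr (3/2)) * C"
      using n c0[of "-2"] c0[of "-5/4"] c0[of "-3/2"] by (intro add_mono mult_left_mono) (auto simp: C_def)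
    finally show ?thesis unfolding merw_char_error_def n_def by (simp add: algebra_simps)
  qed
  then show ?thesis using that C0 by blast
qed

section \<open>The number of moves and its moments\<close>

text \<open>
  The law of the number of nonzero steps of the walk with stops up to time \<open>n + 1\<close>: the index is
  shifted because the first step is always nonzero.
\<close>

primrec moves_pmf :: "real \<Rightarrow> nat \<Rightarrow> nat pmf" where
  "moves_pmf \<theta> 0 = return_pmf 1"
| "moves_pmf \<theta> (Suc n) = moves_pmf \<theta> n \<bind>
     (\<lambda>N. map_pmf (\<lambda>moved. if moved then Suc N else N) (bernoulli_pmf (\<theta> * real N / real (Suc n))))"

abbreviation moves_mean :: "real \<Rightarrow> nat \<Rightarrow> (nat \<Rightarrow> 'c::{banach, second_countable_topology}) \<Rightarrow> 'c" where
  "moves_mean \<theta> n \<equiv> measure_pmf.expectation (moves_pmf \<theta> n)"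

lemma finite_set_pmf_moves [simp]: "finite (set_pmf (moves_pmf \<theta> n))"
  by (induction n) auto

lemma integrable_moves [simp]: "integrable (measure_pmf (moves_pmf \<theta> n)) (f :: _ \<Rightarrow> 'c::{banach, second_countable_topology})"
  by (rule integrable_measure_pmf_finite) simp

lemma set_pmf_moves: "N \<in> set_pmf (moves_pmf \<theta> n) \<Longrightarrow> 1 \<le> N \<and> N \<le> Suc n"
  by (induction n arbitrary: N) (auto split: if_splits intro: le_SucI)

lemma expectation_moves_mono:
  fixes f g :: "nat \<Rightarrow> real"
  assumes "\<And>N. 1 \<le> N \<Longrightarrow> N \<le> Suc n \<Longrightarrow> f N \<le> g N"
  shows "moves_mean \<theta> n f \<le> moves_mean \<theta> n g"
  by (rule integral_mono_AE) (use assms set_pmf_moves in \<open>auto simp: AE_measure_pmf_iff\<close>)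

lemma expectation_moves_Suc:
  fixes f :: "nat \<Rightarrow> real"
  assumes "0 \<le> \<theta>" "\<theta> \<le> 1"
  shows "moves_mean \<theta> (Suc n) f =
    moves_mean \<theta> n (\<lambda>N. f N + \<theta> * real N / real (Suc n) * (f (Suc N) - f N))"
proof -
  have "moves_mean \<theta> (Suc n) f =
    moves_mean \<theta> n (\<lambda>N. measure_pmf.expectation 
      (bernoulli_pmf (\<theta> * real N / real (Suc n))) (\<lambda>b. f (if b then Suc N else N)))"
    by (simp add: expectation_bind_finite del: of_nat_Suc)
  also have "\<dots> = moves_mean \<theta> n (\<lambda>N. f N + \<theta> * real N / real (Suc n) * (f (Suc N) - f N))"
  proof (intro integral_cong_AE)
    have "measure_pmf.expectation (bernoulli_pmf (\<theta> * real N / real (Suc n))) (\<lambda>b. f (if b then Suc N else N))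
        = f N + \<theta> * real N / real (Suc n) * (f (Suc N) - f N)" if "N \<le> Suc n" for N
    proof -
      have "\<theta> * real N \<le> 1 * real (Suc n)" using assms that by (intro mult_mono) auto
      then have "0 \<le> \<theta> * real N / real (Suc n)" "\<theta> * real N / real (Suc n) \<le> 1" using assms by auto
      moreover have "measure_pmf.expectation (bernoulli_pmf a) (\<lambda>b. f (if b then Suc N else N)) = f N + a * (f (Suc N) - f N)"
        if "0 \<le> a" "a \<le> 1" for a
        using that by (simp add: algebra_simps)
      ultimately show ?thesis by blast
    qed
    then show "AE N in measure_pmf (moves_pmf \<theta> n). measure_pmf.expectation (bernoulli_pmf (\<theta> * real N / real (Suc n))) (\<lambda>b. f (if b then Suc N else N))
        = f N + \<theta> * real N / real (Suc n) * (f (Suc N) - f N)"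
      using set_pmf_moves by (auto simp: AE_measure_pmf_iff)
  qed simp_all
  finally show ?thesis .
qed

lemma pochhammer_increment:
  fixes x :: real
  shows "x * (pochhammer (x + 1) j - pochhammer x j) = real j * pochhammer x j"
  using pochhammer_rec[of x j] pochhammer_rec'[of x j] by (simp add: algebra_simps)

text \<open>
  Rising factorials are eigenfunctions of the transition of the number of moves, because
  \<open>N * (pochhammer (N + 1) j - pochhammer N j) = j * pochhammer N j\<close>.
\<close>

lemma moves_pochhammer_moment:
  assumes "0 \<le> \<theta>" "\<theta> \<le> 1"
  shows "moves_mean \<theta> n (\<lambda>N. pochhammer (real N) j) =
    fact j * (pochhammer (1 + \<theta> * real j) n / fact n)"
proof (induction n)
  case 0
  show ?case by (simp add: pochhammer_fact)
next
  case (Suc n)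
  have "pochhammer (real N) j + \<theta> * real N / real (Suc n) * (pochhammer (real (Suc N)) j - pochhammer (real N) j)
      = (1 + \<theta> * real j / real (Suc n)) * pochhammer (real N) j" for N
  proof -
    have "real N * (pochhammer (real (Suc N)) j - pochhammer (real N) j) = real j * pochhammer (real N) j"
      using pochhammer_increment[of "real N" j] by (simp add: add.commute)
    then have "\<theta> / real (Suc n) * (real N * (pochhammer (real (Suc N)) j - pochhammer (real N) j)) = \<theta> / real (Suc n) * (real j * pochhammer (real N) j)"
      by simp
    then show ?thesis by (simp add: distrib_right del: of_nat_Suc)
  qed
  then have "moves_mean \<theta> (Suc n) (\<lambda>N. pochhammer (real N) j) =
      (1 + \<theta> * real j / real (Suc n)) * (fact j * (pochhammer (1 + \<theta> * real j) n / fact n))"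
    unfolding expectation_moves_Suc[OF assms] using Suc.IH by (simp del: of_nat_Suc)
  also have "\<dots> = fact j * (pochhammer (1 + \<theta> * real j) (Suc n) / fact (Suc n))"
    by (simp add: pochhammer_rec' divide_simps)
  finally show ?case .
qed

text \<open>
  A form of Gauss's product for the Gamma function.
\<close>

lemma pochhammer_over_fact_asymp:
  fixes a :: real
  assumes "a \<ge> 0"
  shows "(\<lambda>n. pochhammer (1 + a) n / fact n / real (Suc n) powr a) \<longlonglongrightarrow> 1 / Gamma (1 + a)"
proof -
  have G: "Gamma (1 + a) > 0" using assms by (intro Gamma_real_pos) auto
  have "(\<lambda>n. Gamma_series' (1 + a) (Suc n)) \<longlonglongrightarrow> Gamma (1 + a)"
    using Gamma_series'_LIMSEQ[of "1 + a"] by (rule LIMSEQ_Suc)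
  moreover have "(\<lambda>n. real (Suc n) / (1 + a + real n)) \<longlonglongrightarrow> 1" 
    by real_asymp
  ultimately have "(\<lambda>n. real (Suc n) / (1 + a + real n) / Gamma_series' (1 + a) (Suc n)) \<longlonglongrightarrow> 1 / Gamma (1 + a)"
    using G by (intro tendsto_divide) auto
  moreover have "real (Suc n) / (1 + a + real n) / Gamma_series' (1 + a) (Suc n) = pochhammer (1 + a) n / fact n / real (Suc n) powr a" for n
  proof -
    have "exp ((1 + a) * ln (real (Suc n))) = real (Suc n) * real (Suc n) powr a"
      by (simp add: powr_def distrib_right exp_add del: of_nat_Suc)
    moreover have "1 + a + real n > 0" using assms by simp
    ultimately show ?thesis
      by (simp add: Gamma_series'_def pochhammer_rec' del: of_nat_Suc)
  qed
  ultimately show ?thesis by simp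
qed

text \<open>
  The same eigenfunction argument for the order \<open>-1/2\<close> in place of \<open>j\<close>. The eigenfunction is the
  product \<open>g\<close> below, which is comparable to \<open>1 / sqrt N\<close>. The lemma excludes that the
  number of moves is much smaller than \<open>n powr \<theta>\<close>.
\<close>

lemma moves_neg_moment:
  assumes "0 \<le> \<theta>" "\<theta> \<le> 1"
  shows "moves_mean \<theta> n (\<lambda>N. 1 / sqrt (real N)) \<le> 2 * real (Suc n) powr (- (\<theta> / 2))"
proof -
  define g where "g N = (\<Prod>j=1..<N. 1 - 1 / (2 * real j))" for N
  have g_Suc: "g (Suc N) = g N * (1 - 1 / (2 * real N))" if "N \<ge> 1" for N
    using that by (simp add: g_def)
  have g0: "g N > 0" for N unfolding g_def by (intro prod_pos) auto
  \<comment> \<open>\<open>(g N)\<^sup>2 * (N - c)\<close> is increasing in \<open>N\<close> for \<open>c = 3/4\<close>; with \<open>c = 0\<close> it would be decreasing.\<close>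
  have g_low: "(g N)\<^sup>2 * (real N - 3/4) \<ge> 1/4" if "N \<ge> 1" for N
    using that
  proof (induction rule: dec_induct)
    case base
    then show ?case by (simp add: g_def)
  next
    case (step N)
    have "real N - 3/4 \<le> (1 - 1 / (2 * real N))\<^sup>2 * (real (Suc N) - 3/4)"
      using step by (simp add: power2_eq_square field_simps)
    then have "(g N)\<^sup>2 * (real N - 3/4) \<le> (g N)\<^sup>2 * ((1 - 1 / (2 * real N))\<^sup>2 * (real (Suc N) - 3/4))"
      by (intro mult_left_mono) auto
    then show ?case unfolding g_Suc[OF step(1)] power_mult_distrib mult.assoc using step(3) by linarith
  qed
  have low: "1 / sqrt (real N) \<le> 2 * g N" if "N \<ge> 1" for N
  proof -
    have "1/4 \<le> (g N)\<^sup>2 * (real N - 3/4)" by (rule g_low[OF that])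
    also have "\<dots> \<le> (g N)\<^sup>2 * real N" by (intro mult_left_mono) auto
    also have "\<dots> = (g N * sqrt (real N))\<^sup>2" by (simp add: power_mult_distrib)
    finally have "(1/2)\<^sup>2 \<le> (g N * sqrt (real N))\<^sup>2" by (simp add: power2_eq_square)
    then have "1/2 \<le> g N * sqrt (real N)" by (rule power2_le_imp_le) (simp add: less_imp_le[OF g0])
    then show ?thesis using that by (simp add: field_simps)
  qed
  have "moves_mean \<theta> n g \<le> real (Suc n) powr (- (\<theta> / 2))"
  proof (induction n)
    case (Suc n)
    have "moves_mean \<theta> (Suc n) g =
        moves_mean \<theta> n (\<lambda>N. (1 - \<theta> / (2 * real (Suc n))) * g N)"
      unfolding expectation_moves_Suc[OF assms]
    proof (rule integral_cong_AE)
      have "g N + \<theta> * real N / real (Suc n) * (g (Suc N) - g N) = (1 - \<theta> / (2 * real (Suc n))) * g N" if "N \<ge> 1" for N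
        using that by (simp add: g_Suc field_simps)
      then show "AE N in measure_pmf (moves_pmf \<theta> n). g N + \<theta> * real N / real (Suc n) * (g (Suc N) - g N) = (1 - \<theta> / (2 * real (Suc n))) * g N"
        using set_pmf_moves by (auto simp: AE_measure_pmf_iff)
    qed simp_all
    also have "\<dots> = (1 - \<theta> / (2 * real (Suc n))) * moves_mean \<theta> n g" by simp
    also have "\<dots> \<le> (real (Suc (Suc n)) / real (Suc n)) powr (- (\<theta> / 2)) * real (Suc n) powr (- (\<theta> / 2))"
    proof (rule mult_mono)
      define x where "x = real (Suc (Suc n)) / real (Suc n)"
      have x: "x > 0" "x = 1 + 1 / real (Suc n)" by (auto simp: x_def field_simps)
      have "ln x \<le> 1 / real (Suc n)" using ln_le_minus_one[OF x(1)] x(2) by simp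
      then have "\<theta> / 2 * ln x \<le> \<theta> / 2 * (1 / real (Suc n))" using assms by (intro mult_left_mono) auto
      then have "1 - \<theta> / (2 * real (Suc n)) \<le> 1 + (- (\<theta> / 2) * ln x)" by simp
      also have "\<dots> \<le> exp (- (\<theta> / 2) * ln x)" by (rule exp_ge_add_one_self)
      also have "\<dots> = x powr (- (\<theta> / 2))" using x by (simp add: powr_def)
      finally show "1 - \<theta> / (2 * real (Suc n)) \<le> x powr (- (\<theta> / 2))" .
      show "0 \<le> moves_mean \<theta> n g"
        using g0 by (intro integral_nonneg_AE) (simp add: less_imp_le)
    qed (use Suc.IH in auto)
    also have "\<dots> = real (Suc (Suc n)) powr (- (\<theta> / 2))"
      by (simp only: powr_mult[symmetric]) simp
    finally show ?case .
  qed (simp add: g_def)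
  moreover have "moves_mean \<theta> n (\<lambda>N. 1 / sqrt (real N)) \<le> moves_mean \<theta> n (\<lambda>N. 2 * g N)"
    by (rule expectation_moves_mono) (rule low)
  ultimately show ?thesis by simp
qed

lemma power_shift_bound:
  fixes x h :: real
  assumes "0 \<le> x" "0 \<le> h" "h \<le> 1"
  shows "(x + h) ^ j - x ^ j \<le> real j * h * (1 + x) ^ j"
proof (induction j)
  case (Suc j)
  have "(x + h) ^ Suc j - x ^ Suc j = (x + h) * ((x + h) ^ j - x ^ j) + h * x ^ j" by (simp add: algebra_simps)
  also have "\<dots> \<le> (1 + x) * (real j * h * (1 + x) ^ j) + h * (1 + x) ^ Suc j"
  proof (rule add_mono)
    show "(x + h) * ((x + h) ^ j - x ^ j) \<le> (1 + x) * (real j * h * (1 + x) ^ j)"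
      using assms Suc.IH by (intro mult_mono) (auto simp: power_mono)
    have "x ^ j \<le> (1 + x) ^ j" using assms by (intro power_mono) auto
    also have "\<dots> \<le> (1 + x) ^ Suc j" using assms by (intro power_increasing) auto
    finally show "h * x ^ j \<le> h * (1 + x) ^ Suc j" using assms by (intro mult_left_mono) auto
  qed
  also have "\<dots> = real (Suc j) * h * (1 + x) ^ Suc j" by (simp add: algebra_simps)
  finally show ?case .
qed simp

lemma one_plus_power_bound:
  fixes x :: real
  assumes "0 \<le> x"
  shows "(1 + x) ^ j \<le> 2 ^ j * (1 + x ^ j)"
proof (cases "x \<le> 1")
  case True
  then have "(1 + x) ^ j \<le> 2 ^ j" using assms by (intro power_mono) auto
  also have "\<dots> \<le> 2 ^ j * (1 + x ^ j)" using assms by simp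
  finally show ?thesis .
next
  case False
  then have "(1 + x) ^ j \<le> (2 * x) ^ j" by (intro power_mono) auto
  also have "\<dots> \<le> 2 ^ j * (1 + x ^ j)" by (simp add: power_mult_distrib)
  finally show ?thesis .
qed

lemma moves_pochhammer_moment_limit:
  assumes "0 \<le> \<theta>" "\<theta> \<le> 1"
  shows "(\<lambda>n. moves_mean \<theta> n (\<lambda>N. pochhammer (real N) j / (real (Suc n) powr \<theta>) ^ j))
    \<longlonglongrightarrow> fact j / Gamma (1 + real j * \<theta>)"
proof -
  have "moves_mean \<theta> n (\<lambda>N. pochhammer (real N) j / (real (Suc n) powr \<theta>) ^ j) =
      fact j * (pochhammer (1 + \<theta> * real j) n / fact n / real (Suc n) powr (\<theta> * real j))" for n
    by (simp add: moves_pochhammer_moment[OF assms] powr_powr[symmetric] powr_realpow del: of_nat_Suc)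
  then show ?thesis
    using tendsto_mult_left[OF pochhammer_over_fact_asymp[of "\<theta> * real j"], of "fact j"] assms
    by (simp add: mult.commute)
qed

lemma pochhammer_bounds:
  fixes x y :: real
  assumes "0 \<le> x" "y > 0"
  shows "(x / y) ^ j \<le> pochhammer x j / y ^ j" "pochhammer x j / y ^ j \<le> (x / y + real j / y) ^ j"
proof -
  have "x ^ j = (\<Prod>i\<in>{0..<j}. x)" by simp
  also have "\<dots> \<le> pochhammer x j"
    unfolding pochhammer_prod using assms by (intro prod_mono) auto
  finally have "x ^ j \<le> pochhammer x j" .
  then show "(x / y) ^ j \<le> pochhammer x j / y ^ j"
    using assms by (simp add: power_divide divide_right_mono)
  have "pochhammer x j \<le> (\<Prod>i\<in>{0..<j}. x + real j)"
    unfolding pochhammer_prod using assms by (intro prod_mono) auto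
  then have "pochhammer x j / y ^ j \<le> (x + real j) ^ j / y ^ j"
    using assms by (intro divide_right_mono) auto
  then show "pochhammer x j / y ^ j \<le> (x / y + real j / y) ^ j"
    by (simp add: power_divide[symmetric] add_divide_distrib)
qed

text \<open>
  Ordinary moments have the same limits as rising factorial ones, since after rescaling the
  shifts inside the rising factorial are of order \<open>n powr (- \<theta>)\<close>.
\<close>

lemma moves_moment_limit:
  assumes "0 < \<theta>" "\<theta> \<le> 1"
  shows "(\<lambda>n. moves_mean \<theta> n (\<lambda>N. (real N / real (Suc n) powr \<theta>) ^ j))
    \<longlonglongrightarrow> fact j / Gamma (1 + real j * \<theta>)"
proof -
  let ?E = "\<lambda>n. moves_mean \<theta> n"
  let ?y = "\<lambda>n. real (Suc n) powr \<theta>"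
  define P where "P n = ?E n (\<lambda>N. pochhammer (real N) j / (?y n) ^ j)" for n
  define L where "L n = ?E n (\<lambda>N. (real N / ?y n) ^ j)" for n
  define h where "h n = real j / ?y n" for n
  have P: "P \<longlonglongrightarrow> fact j / Gamma (1 + real j * \<theta>)"
    using moves_pochhammer_moment_limit[of \<theta> j] assms unfolding P_def by simp
  have h: "h \<longlonglongrightarrow> 0" unfolding h_def using assms by real_asymp
  have LP: "L n \<le> P n" for n unfolding L_def P_def
    by (rule expectation_moves_mono) (rule pochhammer_bounds, auto)
  have PL: "P n - L n \<le> real j * h n * (2 ^ j * (1 + P n))" if "h n \<le> 1" for n
  proof -
    have h0: "0 \<le> h n" by (simp add: h_def)
    have "P n - L n = ?E n (\<lambda>N. pochhammer (real N) j / (?y n) ^ j - (real N / ?y n) ^ j)"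
      unfolding P_def L_def by (rule Bochner_Integration.integral_diff[symmetric]) simp_all
    also have "\<dots> \<le> ?E n (\<lambda>N. real j * h n * (2 ^ j * (1 + (real N / ?y n) ^ j)))"
    proof (rule expectation_moves_mono)
      fix N
      define x where "x = real N / ?y n"
      have x: "x \<ge> 0" by (simp add: x_def)
      have "pochhammer (real N) j / (?y n) ^ j - x ^ j \<le> (x + h n) ^ j - x ^ j"
        using pochhammer_bounds(2)[of "real N" "?y n" j] by (simp add: x_def h_def)
      also have "\<dots> \<le> real j * h n * (1 + x) ^ j" by (rule power_shift_bound[OF x h0 that])
      also have "\<dots> \<le> real j * h n * (2 ^ j * (1 + x ^ j))"
        using h0 by (intro mult_left_mono one_plus_power_bound x) auto
      finally show "pochhammer (real N) j / (?y n) ^ j - (real N / ?y n) ^ j \<le> real j * h n * (2 ^ j * (1 + (real N / ?y n) ^ j))"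
        unfolding x_def .
    qed
    also have "\<dots> = real j * h n * (2 ^ j * (1 + L n))" unfolding L_def by simp
    also have "\<dots> \<le> real j * h n * (2 ^ j * (1 + P n))"
      using h0 LP by (intro mult_left_mono add_mono) auto
    finally show ?thesis .
  qed
  have "(\<lambda>n. P n - L n) \<longlonglongrightarrow> 0"
  proof (rule tendsto_sandwich)
    show "\<forall>\<^sub>F n in sequentially. 0 \<le> P n - L n" using LP by simp
    have "\<forall>\<^sub>F n in sequentially. h n < 1" using h by (rule order_tendstoD) simp
    then show "\<forall>\<^sub>F n in sequentially. P n - L n \<le> real j * h n * (2 ^ j * (1 + P n))"
      by eventually_elim (rule PL, simp)
    have "(\<lambda>n. real j * h n * (2 ^ j * (1 + P n))) \<longlonglongrightarrow> real j * 0 * (2 ^ j * (1 + fact j / Gamma (1 + real j * \<theta>)))"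
      by (intro tendsto_intros h P)
    then show "(\<lambda>n. real j * h n * (2 ^ j * (1 + P n))) \<longlonglongrightarrow> 0" by simp
  qed simp
  from tendsto_diff[OF P this] show ?thesis unfolding L_def by simp
qed

section \<open>The Mittag-Leffler limit\<close>

text \<open>
  Restrict Euler's integral to \<open>t \<ge> T\<close>.
\<close>

lemma Gamma_lower_bound:
  fixes a T :: real
  assumes "a \<ge> 0" "T > 0"
  shows "T powr a * exp (- T) \<le> Gamma (1 + a)"
proof -
  have "((\<lambda>t. T powr a * exp (- t)) has_integral T powr a * exp (- T)) {T..}"
    using has_integral_mult_right[OF has_integral_exp_minus_to_infinity[of 1 T], of "T powr a"] by simp
  then have "((\<lambda>t. if t \<in> {T..} then T powr a * exp (- t) else 0) has_integral T powr a * exp (- T)) {0..}"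
    using assms by (subst has_integral_restrict) auto
  moreover have "((\<lambda>t. t powr a / exp t) has_integral Gamma (1 + a)) {0..}"
    using Gamma_integral_real[of "1 + a"] assms by simp
  ultimately show ?thesis
  proof (rule has_integral_le)
    fix t :: real assume "t \<in> {0..}"
    show "(if t \<in> {T..} then T powr a * exp (- t) else 0) \<le> t powr a / exp t"
      using assms by (auto simp: exp_minus divide_inverse intro!: powr_mono2)
  qed
qed

text \<open>
  The Gamma function beats every geometric growth: choose \<open>T\<close> in the lower bound above so large
  that \<open>T powr \<theta>\<close> exceeds \<open>2 * \<bar>t\<bar>\<close>.
\<close>

lemma summable_mittag_leffler:
  fixes t :: real
  assumes "\<theta> > 0"
  shows "summable (\<lambda>j. \<bar>t\<bar> ^ j / Gamma (1 + real j * \<theta>))"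
proof (rule summable_comparison_test)
  \<comment> \<open>Chosen such that \<open>T powr (j * \<theta>) = b ^ j\<close> and \<open>\<bar>t\<bar> / b \<le> 1/2\<close>.\<close>
  define b where "b = 2 * \<bar>t\<bar> + 1"
  define T where "T = b powr (1 / \<theta>)"
  have b: "b > 0" by (simp add: b_def add_nonneg_pos)
  have T: "T > 0" using b by (simp add: T_def)
  have "norm (\<bar>t\<bar> ^ j / Gamma (1 + real j * \<theta>)) \<le> exp T * (1/2) ^ j" for j
  proof -
    have G: "Gamma (1 + real j * \<theta>) > 0" using assms by (intro Gamma_real_pos add_pos_nonneg) auto
    have "T powr (real j * \<theta>) = b ^ j"
      using assms b by (simp add: T_def powr_powr powr_realpow)
    then have "b ^ j * exp (- T) \<le> Gamma (1 + real j * \<theta>)"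
      using Gamma_lower_bound[of "real j * \<theta>" T] assms T by simp
    then have "\<bar>t\<bar> ^ j / Gamma (1 + real j * \<theta>) \<le> \<bar>t\<bar> ^ j / (b ^ j * exp (- T))"
      using b by (intro frac_le) auto
    also have "\<dots> = exp T * (\<bar>t\<bar> / b) ^ j" by (simp add: power_divide exp_minus field_simps)
    also have "\<dots> \<le> exp T * (1/2) ^ j"
      using b by (intro mult_left_mono power_mono) (auto simp: b_def field_simps)
    finally show ?thesis using G by simp
  qed
  then show "\<exists>N. \<forall>j\<ge>N. norm (\<bar>t\<bar> ^ j / Gamma (1 + real j * \<theta>)) \<le> exp T * (1/2) ^ j" by blast
  show "summable (\<lambda>j. exp T * (1/2) ^ j)" by (intro summable_mult summable_geometric) auto
qed

definition scaled_moves :: "real \<Rightarrow> nat \<Rightarrow> real measure" where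
  "scaled_moves \<theta> n = distr (measure_pmf (moves_pmf \<theta> n)) borel (\<lambda>N. real N / real (Suc n) powr \<theta>)"

lemma real_distribution_scaled_moves: "real_distribution (scaled_moves \<theta> n)"
  unfolding scaled_moves_def by (rule prob_space.real_distribution_distr[OF measure_pmf.prob_space_axioms]) simp

lemma integral_scaled_moves:
  fixes f :: "real \<Rightarrow> real"
  assumes "continuous_on UNIV f"
  shows "integral\<^sup>L (scaled_moves \<theta> n) f = moves_mean \<theta> n (\<lambda>N. f (real N / real (Suc n) powr \<theta>))"
  unfolding scaled_moves_def
  by (subst integral_distr) (use borel_measurable_continuous_onI[OF assms] in auto)

lemma measure_scaled_moves:
  assumes "A \<in> sets borel"
  shows "measure (scaled_moves \<theta> n) A = measure (measure_pmf (moves_pmf \<theta> n)) {N. real N / real (Suc n) powr \<theta> \<in> A}"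
  unfolding scaled_moves_def using assms by (subst measure_distr) (auto simp: vimage_def)

text \<open>
  The first moments are bounded.
\<close>

lemma tight_scaled_moves:
  assumes "0 < \<theta>" "\<theta> \<le> 1"
  shows "tight (scaled_moves \<theta>)"
  unfolding tight_def
proof (intro conjI allI impI)
  let ?x = "\<lambda>n N. real N / real (Suc n) powr \<theta>"
  let ?m = "\<lambda>n. moves_mean \<theta> n (?x n)"
  show "real_distribution (scaled_moves \<theta> n)" for n by (rule real_distribution_scaled_moves)
  have "convergent ?m" using moves_moment_limit[OF assms, of 1] by (auto simp: convergent_def)
  then obtain C where C: "\<And>n. \<bar>?m n\<bar> \<le> C"
    using convergent_imp_Bseq[of ?m] unfolding Bseq_def by auto
  have C0: "C \<ge> 0" using C[of 0] by linarith
  fix \<epsilon> :: real assume \<epsilon>: "\<epsilon> > 0"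
  define R where "R = (C + 1) / \<epsilon>"
  have R: "R > 0" using C0 \<epsilon> by (simp add: R_def)
  have "measure (scaled_moves \<theta> n) {-1<..R} > 1 - \<epsilon>" for n
  proof -
    interpret real_distribution "scaled_moves \<theta> n" by (rule real_distribution_scaled_moves)
    have "measure (measure_pmf (moves_pmf \<theta> n)) {N. ?x n N \<ge> R} \<le> ?m n / R"
      using integral_Markov_inequality_measure[of "measure_pmf (moves_pmf \<theta> n)" "?x n" UNIV R] R by simp
    also have "\<dots> \<le> C / R" using C[of n] R by (intro divide_right_mono) auto
    also have "\<dots> < \<epsilon>" using C0 \<epsilon> by (simp add: R_def field_simps)
    finally have *: "measure (scaled_moves \<theta> n) {R..} < \<epsilon>"
      by (simp add: measure_scaled_moves)
    have "measure (scaled_moves \<theta> n) {..-1} = 0"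
    proof -
      have "{N. ?x n N \<in> {..-1}} = {}"
        by (auto simp: not_le intro: less_le_trans[of "-1" 0])
      then show ?thesis by (simp add: measure_scaled_moves del: of_nat_Suc)
    qed
    moreover have "1 = measure (scaled_moves \<theta> n) ({..-1} \<union> ({-1<..R} \<union> {R..}))"
    proof -
      have "{..-1} \<union> ({-1<..R} \<union> {R..}) = (UNIV :: real set)" using R by auto
      then show ?thesis using prob_space by simp
    qed
    moreover have "\<dots> \<le> measure (scaled_moves \<theta> n) {..-1} + (measure (scaled_moves \<theta> n) {-1<..R} + measure (scaled_moves \<theta> n) {R..})"
      by (intro order_trans[OF measure_Un_le] add_mono order_refl measure_Un_le) auto
    ultimately show ?thesis using * by linarith
  qed
  moreover have "-1 < R" using R by simp
  ultimately show "\<exists>a b. a < b \<and> (\<forall>n. 1 - \<epsilon> < measure (scaled_moves \<theta> n) {a<..b})" by blast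
qed

context
  fixes \<theta> :: real and r :: "nat \<Rightarrow> nat" and \<nu> :: "real measure"
  assumes \<theta>: "0 < \<theta>" "\<theta> \<le> 1" and r: "strict_mono r"
    and \<nu>: "real_distribution \<nu>" and wc: "weak_conv_m (scaled_moves \<theta> \<circ> r) \<nu>"
begin

interpretation real_distribution \<nu> by (rule \<nu>)

lemma subseq_integral_limit:
  fixes f :: "real \<Rightarrow> real"
  assumes "continuous_on UNIV f" "\<And>x. \<bar>f x\<bar> \<le> B"
  shows "(\<lambda>k. moves_mean \<theta> (r k) (\<lambda>N. f (real N / real (Suc (r k)) powr \<theta>))) \<longlonglongrightarrow> integral\<^sup>L \<nu> f"
proof -
  have "(\<lambda>k. integral\<^sup>L ((scaled_moves \<theta> \<circ> r) k) f) \<longlonglongrightarrow> integral\<^sup>L \<nu> f"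
    by (rule weak_conv_imp_integral_bdd_continuous_conv[OF _ \<nu> wc, where B = B])
       (use assms real_distribution_scaled_moves in \<open>auto simp: continuous_on_eq_continuous_at\<close>)
  then show ?thesis by (simp add: integral_scaled_moves[OF assms(1)] del: of_nat_Suc)
qed

lemma integrable_bounded_continuous:
  fixes f :: "real \<Rightarrow> real"
  assumes "continuous_on UNIV f" "\<And>x. \<bar>f x\<bar> \<le> B"
  shows "integrable \<nu> f"
  by (rule integrable_const_bound[of _ B]) (use assms borel_measurable_continuous_onI[OF assms(1)] in auto)

text \<open>
  The moments of order \<open>-1/2\<close> are at most \<open>2\<close> along the sequence, hence also for the truncated
  functions \<open>f k\<close> in the limit; but \<open>f k\<close> equals \<open>sqrt (k + 1)\<close> on the nonpositive half-line.
\<close>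

lemma limit_pos: "AE x in \<nu>. x > 0"
proof -
  define f where "f k x = 1 / sqrt (max x (1 / real (Suc k)))" for k and x :: real
  have bnd: "\<bar>f k x\<bar> \<le> sqrt (real (Suc k))" for k x
  proof -
    have "f k x \<le> 1 / sqrt (1 / real (Suc k))" unfolding f_def by (intro frac_le) auto
    moreover have "f k x \<ge> 0" unfolding f_def by (simp add: le_max_iff_disj)
    ultimately show ?thesis by (simp add: real_sqrt_divide)
  qed
  have cont: "continuous_on UNIV (f k)" for k
    unfolding f_def by (intro continuous_intros) (auto simp: max_def)
  have le2: "integral\<^sup>L \<nu> (f k) \<le> 2" for k
  proof (rule LIMSEQ_le_const2[OF subseq_integral_limit[OF cont bnd]], intro exI allI impI)
    fix n
    have "moves_mean \<theta> (r n) (\<lambda>N. f k (real N / real (Suc (r n)) powr \<theta>))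
      \<le> moves_mean \<theta> (r n) (\<lambda>N. real (Suc (r n)) powr (\<theta> / 2) * (1 / sqrt (real N)))"
    proof (rule expectation_moves_mono)
      fix N :: nat assume "1 \<le> N"
      then have x: "real N / real (Suc (r n)) powr \<theta> > 0" by simp
      then have "f k (real N / real (Suc (r n)) powr \<theta>) \<le> 1 / sqrt (real N / real (Suc (r n)) powr \<theta>)"
        unfolding f_def by (intro frac_le) auto
      also have "\<dots> = real (Suc (r n)) powr (\<theta> / 2) * (1 / sqrt (real N))"
        by (simp add: real_sqrt_divide powr_half_sqrt[symmetric] powr_powr)
      finally show "f k (real N / real (Suc (r n)) powr \<theta>) \<le> real (Suc (r n)) powr (\<theta> / 2) * (1 / sqrt (real N))" .
    qed
    also have "\<dots> = real (Suc (r n)) powr (\<theta> / 2) * moves_mean \<theta> (r n) (\<lambda>N. 1 / sqrt (real N))"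
      by (rule integral_mult_right_zero)
    also have "\<dots> \<le> real (Suc (r n)) powr (\<theta> / 2) * (2 * real (Suc (r n)) powr (- (\<theta> / 2)))"
      using \<theta> by (intro mult_left_mono moves_neg_moment) auto
    also have "\<dots> = 2" by (simp add: powr_minus field_simps del: of_nat_Suc)
    finally show "moves_mean \<theta> (r n) (\<lambda>N. f k (real N / real (Suc (r n)) powr \<theta>)) \<le> 2" .
  qed
  have "measure \<nu> {..0} \<le> 2 / sqrt (real (Suc k))" for k
  proof -
    have "sqrt (real (Suc k)) * measure \<nu> {..0} = (\<integral>x. sqrt (real (Suc k)) * indicator {..0} x \<partial>\<nu>)" by simp
    also have "\<dots> \<le> integral\<^sup>L \<nu> (f k)"
    proof (rule integral_mono)
      show "integrable \<nu> (f k)" by (rule integrable_bounded_continuous[OF cont bnd])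
      fix x :: real
      show "sqrt (real (Suc k)) * indicator {..0} x \<le> f k x"
      proof (cases "x \<le> 0")
        case True
        then have "max x (1 / real (Suc k)) = 1 / real (Suc k)" by (intro max_absorb2) (simp add: order.trans[of x 0])
        then show ?thesis using True by (simp add: f_def real_sqrt_divide)
      qed (simp add: f_def le_max_iff_disj)
      show "integrable \<nu> (\<lambda>x. sqrt (real (Suc k)) * indicator {..0} x)"
        by (intro integrable_mult_right integrable_real_indicator) (auto simp: less_top[symmetric])
    qed
    finally show ?thesis using le2[of k] by (simp add: field_simps)
  qed
  moreover have "(\<lambda>k. 2 / sqrt (real (Suc k))) \<longlonglongrightarrow> 0" by real_asymp
  ultimately have "measure \<nu> {..0} \<le> 0" by (intro LIMSEQ_le_const) auto
  then have "measure \<nu> {..0} = 0" by (simp add: measure_le_0_iff)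
  then have "AE x in \<nu>. x \<notin> {..0}" by (subst (asm) prob_eq_0) auto
  then show ?thesis by eventually_elim auto
qed

text \<open>
  Moments pass to the weak limit because the moments of twice the order are bounded: truncating
  the power at height \<open>k + 1\<close> loses at most \<open>C / (k + 1)\<close>.
\<close>

lemma limit_moments:
  "integrable \<nu> (\<lambda>x. \<bar>x\<bar> ^ j)" "(\<integral>x. \<bar>x\<bar> ^ j \<partial>\<nu>) = fact j / Gamma (1 + real j * \<theta>)"
proof -
  let ?E = "\<lambda>n. moves_mean \<theta> (r n)"
  let ?x = "\<lambda>n N. real N / real (Suc (r n)) powr \<theta>"
  define M where "M = fact j / Gamma (1 + real j * \<theta>)"
  define f where "f k x = min (\<bar>x\<bar> ^ j) (real (Suc k))" for k and x :: real
  have cont: "continuous_on UNIV (f k)" for k unfolding f_def by (intro continuous_intros)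
  have bnd: "\<bar>f k x\<bar> \<le> real (Suc k)" for k x unfolding f_def by (auto simp: abs_le_iff min_def)
  have lim: "(\<lambda>n. ?E n (\<lambda>N. (?x n N) ^ i)) \<longlonglongrightarrow> fact i / Gamma (1 + real i * \<theta>)" for i
    using LIMSEQ_subseq_LIMSEQ[OF moves_moment_limit[OF \<theta>, of i] r] by (simp add: comp_def)
  have "convergent (\<lambda>n. ?E n (\<lambda>N. (?x n N) ^ (2 * j)))" using lim by (auto simp: convergent_def)
  then obtain C where C: "\<And>n. \<bar>?E n (\<lambda>N. (?x n N) ^ (2 * j))\<bar> \<le> C"
    using convergent_imp_Bseq[of "\<lambda>n. ?E n (\<lambda>N. (?x n N) ^ (2 * j))"] unfolding Bseq_def by auto
  have up: "integral\<^sup>L \<nu> (f k) \<le> M" for k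
    unfolding M_def
    by (rule LIMSEQ_le[OF subseq_integral_limit[OF cont bnd] lim])
       (auto simp: f_def intro!: expectation_moves_mono)
  have low: "M - C / real (Suc k) \<le> integral\<^sup>L \<nu> (f k)" for k
  proof (rule LIMSEQ_le[OF tendsto_diff[OF lim[of j, folded M_def] tendsto_const] subseq_integral_limit[OF cont bnd]], intro exI allI impI)
    fix n
    have "?E n (\<lambda>N. (?x n N) ^ j) \<le> ?E n (\<lambda>N. f k (?x n N) + (?x n N) ^ (2 * j) / real (Suc k))"
    proof (rule expectation_moves_mono)
      fix N
      define y where "y = (?x n N) ^ j"
      have y: "y \<ge> 0" "\<bar>?x n N\<bar> ^ j = y" "(?x n N) ^ (2 * j) = y * y"
        by (auto simp: y_def mult_2 power_add)
      show "(?x n N) ^ j \<le> f k (?x n N) + (?x n N) ^ (2 * j) / real (Suc k)"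
      proof (cases "y \<le> real (Suc k)")
        case True
        then show ?thesis unfolding f_def y using y(1) by (simp add: y_def[symmetric] del: of_nat_Suc)
      next
        case False
        then have "y * real (Suc k) \<le> y * y" using y(1) by (intro mult_left_mono) auto
        then have "y \<le> y * y / real (Suc k)" by (simp add: pos_le_divide_eq del: of_nat_Suc)
        then show ?thesis unfolding f_def y using False by (simp add: y_def[symmetric] min_def del: of_nat_Suc)
      qed
    qed
    also have "\<dots> = ?E n (\<lambda>N. f k (?x n N)) + ?E n (\<lambda>N. (?x n N) ^ (2 * j)) / real (Suc k)"
      by (simp del: of_nat_Suc)
    also have "\<dots> \<le> ?E n (\<lambda>N. f k (?x n N)) + C / real (Suc k)"
      using C[of n] by (intro add_left_mono divide_right_mono) auto
    finally show "?E n (\<lambda>N. (?x n N) ^ j) - C / real (Suc k) \<le> ?E n (\<lambda>N. f k (?x n N))" by simp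
  qed
  have conv: "(\<lambda>k. integral\<^sup>L \<nu> (f k)) \<longlonglongrightarrow> M"
  proof (rule tendsto_sandwich)
    show "(\<lambda>k. M - C / real (Suc k)) \<longlonglongrightarrow> M" by real_asymp
  qed (use up low in auto)
  have "has_bochner_integral \<nu> (\<lambda>x. \<bar>x\<bar> ^ j) M"
  proof (rule has_bochner_integral_monotone_convergence[where f = f])
    show "integrable \<nu> (f k)" for k by (rule integrable_bounded_continuous[OF cont bnd])
    show "AE x in \<nu>. mono (\<lambda>k. f k x)" by (auto simp: f_def mono_def min_def)
    have "(\<lambda>k. f k x) \<longlonglongrightarrow> \<bar>x\<bar> ^ j" for x
    proof (rule tendsto_eventually)
      obtain k0 :: nat where "\<bar>x\<bar> ^ j \<le> real k0" using real_arch_simple by auto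
      then have "f k x = \<bar>x\<bar> ^ j" if "k \<ge> k0" for k using that by (auto simp: f_def min_def)
      then show "\<forall>\<^sub>F k in sequentially. f k x = \<bar>x\<bar> ^ j" unfolding eventually_sequentially by auto
    qed
    then show "AE x in \<nu>. (\<lambda>k. f k x) \<longlonglongrightarrow> \<bar>x\<bar> ^ j" by simp
  qed (use conv in auto)
  then show "integrable \<nu> (\<lambda>x. \<bar>x\<bar> ^ j)" "(\<integral>x. \<bar>x\<bar> ^ j \<partial>\<nu>) = fact j / Gamma (1 + real j * \<theta>)"
    unfolding M_def has_bochner_integral_iff by auto
qed

text \<open>
  The moment \<open>j! / Gamma (1 + j \<theta>)\<close> is exactly what makes the exponential series integrate to
  the Mittag-Leffler series.
\<close>

lemma limit_mittag_leffler: "mittag_leffler_distributed \<nu> \<theta> (\<lambda>x. x)"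
  unfolding mittag_leffler_distributed_def
proof (intro conjI allI)
  show "(\<lambda>x. x) \<in> borel_measurable \<nu>" by simp
  show "AE x in \<nu>. x > 0" by (rule limit_pos)
  fix t :: real
  define f where "f j x = (t * x) ^ j /\<^sub>R fact j" for j and x :: real
  have f_meas: "f j \<in> borel_measurable \<nu>" for j unfolding f_def by measurable
  have nf: "norm (f j x) = (\<bar>t\<bar> ^ j / fact j) * \<bar>x\<bar> ^ j" for j x
    by (simp add: f_def abs_mult power_mult_distrib power_abs[symmetric] divide_inverse)
  have G: "Gamma (1 + real j * \<theta>) > 0" for j using \<theta> by (intro Gamma_real_pos add_pos_nonneg) auto
  have int: "integrable \<nu> (f j)" for j
    by (rule Bochner_Integration.integrable_bound[where f = "\<lambda>x. (\<bar>t\<bar> ^ j / fact j) * \<bar>x\<bar> ^ j"])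
       (use limit_moments(1)[of j] nf f_meas in \<open>auto\<close>)
  have norm_int: "(\<integral>x. norm (f j x) \<partial>\<nu>) = \<bar>t\<bar> ^ j / Gamma (1 + real j * \<theta>)" for j
    unfolding nf by (simp add: limit_moments(2))
  have s1: "AE x in \<nu>. summable (\<lambda>j. norm (f j x))"
    unfolding f_def using summable_norm_exp[of "t * _"] by (intro AE_I2) (simp only: real_norm_def)
  have s2: "summable (\<lambda>j. \<integral>x. norm (f j x) \<partial>\<nu>)"
    unfolding norm_int by (rule summable_mittag_leffler[OF \<theta>(1)])
  have ex: "(\<lambda>x. \<Sum>j. f j x) = (\<lambda>x. exp (t * x))" by (simp add: f_def exp_def)
  show "integrable \<nu> (\<lambda>x. exp (t * x))"
    using integrable_suminf[OF int s1 s2] unfolding ex .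
  have "(\<integral>x. f j x \<partial>\<nu>) = t ^ j / Gamma (1 + real j * \<theta>)" for j
  proof -
    have "(\<integral>x. f j x \<partial>\<nu>) = (\<integral>x. (t ^ j / fact j) * \<bar>x\<bar> ^ j \<partial>\<nu>)"
    proof (rule integral_cong_AE)
      show "AE x in \<nu>. f j x = (t ^ j / fact j) * \<bar>x\<bar> ^ j"
        using limit_pos by eventually_elim (simp add: f_def power_mult_distrib divide_inverse)
    qed (use f_meas in simp_all)
    then show ?thesis by (simp add: limit_moments(2))
  qed
  then show "(\<lambda>j. t ^ j / Gamma (1 + real j * \<theta>)) sums (\<integral>x. exp (t * x) \<partial>\<nu>)"
    using sums_integral[OF int s1 s2] unfolding ex by simp
qed

text \<open>
  The Laplace transform of the limit is given by the Mittag-Leffler series, hence it is the same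
  for all limits of subsequences.
\<close>

lemma subseq_laplace_limit:
  assumes "s \<ge> 0"
  shows "(\<lambda>k. moves_mean \<theta> (r k) (\<lambda>N. exp (- s * (real N / real (Suc (r k)) powr \<theta>)))) 
    \<longlonglongrightarrow> (\<Sum>j. (- s) ^ j / Gamma (1 + real j * \<theta>))"
proof -
  define f where "f x = exp (- s * max x 0)" for x
  have "(\<lambda>k. moves_mean \<theta> (r k) (\<lambda>N. f (real N / real (Suc (r k)) powr \<theta>))) \<longlonglongrightarrow> integral\<^sup>L \<nu> f"
    by (rule subseq_integral_limit[where B = 1]) (use assms in \<open>auto simp: f_def intro!: continuous_intros\<close>)
  also have "integral\<^sup>L \<nu> f = (\<integral>x. exp (- s * x) \<partial>\<nu>)"
  proof (rule integral_cong_AE)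
    show "AE x in \<nu>. f x = exp (- s * x)" using limit_pos by eventually_elim (simp add: f_def)
  qed (unfold f_def, measurable)
  also have "\<dots> = (\<Sum>j. (- s) ^ j / Gamma (1 + real j * \<theta>))"
    using limit_mittag_leffler unfolding mittag_leffler_distributed_def by (blast dest: sums_unique)
  finally show ?thesis by (simp add: f_def del: of_nat_Suc)
qed

end

text \<open>
  One limit law is taken from an arbitrary convergent subsequence. The convergence of the Laplace
  transforms along the whole sequence follows since every subsequence has a further subsequence with
  the right limit; this is all that is needed later, and it avoids the uniqueness theorem for
  Laplace transforms.
\<close>

theorem moves_mittag_leffler_limit:
  assumes \<theta>: "0 < \<theta>" "\<theta> \<le> 1"
  obtains \<nu> where "real_distribution \<nu>" "mittag_leffler_distributed \<nu> \<theta> (\<lambda>x. x)"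
    "\<And>s. s \<ge> 0 \<Longrightarrow> (\<lambda>n. moves_mean \<theta> n (\<lambda>N. exp (- s * (real N / real (Suc n) powr \<theta>))))
      \<longlonglongrightarrow> (\<integral>x. exp (- s * x) \<partial>\<nu>)"
proof -
  have sub: "\<exists>r \<nu>. strict_mono (r :: nat \<Rightarrow> nat) \<and> real_distribution \<nu> \<and> weak_conv_m (scaled_moves \<theta> \<circ> (s \<circ> r)) \<nu>"
    if "strict_mono s" for s
    using tight_imp_convergent_subsubsequence[OF tight_scaled_moves[OF \<theta>] that] by (simp add: comp_assoc)
  obtain r \<nu> where r: "strict_mono r" "real_distribution \<nu>" "weak_conv_m (scaled_moves \<theta> \<circ> r) \<nu>"
    using sub[of id] by (auto simp: strict_mono_def)
  have ml: "mittag_leffler_distributed \<nu> \<theta> (\<lambda>x. x)" by (rule limit_mittag_leffler[OF \<theta> r])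
  have "(\<lambda>n. moves_mean \<theta> n (\<lambda>N. exp (- s * (real N / real (Suc n) powr \<theta>))))
      \<longlonglongrightarrow> (\<integral>x. exp (- s * x) \<partial>\<nu>)" (is "?a \<longlonglongrightarrow> ?L") if s: "s \<ge> 0" for s
  proof (rule ccontr)
    assume "\<not> ?a \<longlonglongrightarrow> ?L"
    then obtain \<epsilon> where "\<epsilon> > 0" and "infinite {n. \<not> dist (?a n) ?L < \<epsilon>}"
      by (auto simp: tendsto_iff not_eventually INFM_iff_infinite cofinite_eq_sequentially[symmetric])
    then obtain q :: "nat \<Rightarrow> nat" where q: "\<And>n. \<not> dist (?a (q n)) ?L < \<epsilon>" and "strict_mono q"
      using enumerate_in_set enumerate_mono by (fastforce simp: strict_mono_def)
    then obtain r' \<nu>' where r': "strict_mono r'" "real_distribution \<nu>'" "weak_conv_m (scaled_moves \<theta> \<circ> (q \<circ> r')) \<nu>'"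
      using sub by blast
    have "strict_mono (q \<circ> r')" using \<open>strict_mono q\<close> r'(1) by (rule strict_mono_o)
    from subseq_laplace_limit[OF \<theta> this r'(2,3) s]
    have "(\<lambda>n. ?a (q (r' n))) \<longlonglongrightarrow> (\<Sum>j. (- s) ^ j / Gamma (1 + real j * \<theta>))" by simp
    also have "(\<Sum>j. (- s) ^ j / Gamma (1 + real j * \<theta>)) = ?L"
      using ml unfolding mittag_leffler_distributed_def by (metis sums_unique)
    finally show False using q \<open>\<epsilon> > 0\<close> by (auto dest: tendstoD)
  qed
  with r(2) ml show ?thesis using that by blast
qed

section \<open>The step matrices act simply transitively on the directions\<close>

lemma mat_power_Suc_apply: "mat_power B (Suc k) *v x = B *v (mat_power B k *v x)"
  by (simp add: mat_power_def matrix_vector_mul_assoc)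

lemma mat_power_0: "mat_power B 0 = mat 1"
  by (simp add: mat_power_def)

lemma Basis_eq_labels:
  assumes "bij_betw c {1..CARD('d)} (UNIV :: 'd::finite set)"
  shows "(Basis :: (real^'d) set) = (\<lambda>j. axis (c j) 1) ` {1..CARD('d)}"
proof -
  have "(UNIV :: 'd set) = c ` {1..CARD('d)}" using assms by (simp add: bij_betw_def)
  then have "(Basis :: (real^'d) set) = (\<lambda>a. axis a 1) ` (c ` {1..CARD('d)})"
    by (simp only: flip: \<open>UNIV = _\<close>) (auto simp: Basis_vec_def)
  then show ?thesis by (simp only: image_image)
qed

text \<open>
  The label of \<open>J\<^sup>i e\<^sub>j\<close>: the label \<open>j\<close> moved back cyclically by \<open>i < d\<close> places within \<open>{1..d}\<close>.
\<close>

definition label_back :: "nat \<Rightarrow> nat \<Rightarrow> nat \<Rightarrow> nat" where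
  "label_back d i j = (if i < j then j - i else j + d - i)"

lemma label_back_bij:
  assumes "j \<in> {1..d}"
  shows "bij_betw (\<lambda>i. label_back d i j) {..<d} {1..d}"
proof (rule bij_betw_imageI)
  show inj: "inj_on (\<lambda>i. label_back d i j) {..<d}"
    by (rule inj_onI) (simp add: label_back_def split: if_splits)
  have "(\<lambda>i. label_back d i j) ` {..<d} \<subseteq> {1..d}"
  proof (rule image_subsetI)
    fix i assume "i \<in> {..<d}"
    then show "label_back d i j \<in> {1..d}" unfolding label_back_def atLeastAtMost_iff using assms by (split if_split) (intro conjI impI; simp)
  qed
  moreover have "card ((\<lambda>i. label_back d i j) ` {..<d}) = card {1..d}"
    using card_image[OF inj] by simp
  ultimately show "(\<lambda>i. label_back d i j) ` {..<d} = {1..d}" by (intro card_subset_eq) auto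
qed

lemma cyclic_perm_matrix_axis:
  fixes c :: "nat \<Rightarrow> 'd::finite"
  assumes c: "bij_betw c {1..CARD('d)} UNIV" and j: "j \<in> {1..CARD('d)}"
  shows "cyclic_perm_matrix c *v axis (c j) 1 = axis (c (if j = 1 then CARD('d) else j - 1)) 1"
proof -
  have inj: "c x = c y \<longleftrightarrow> x = y" if "x \<in> {1..CARD('d)}" "y \<in> {1..CARD('d)}" for x y
    by (rule inj_on_eq_iff[OF bij_betw_imp_inj_on[OF c] that])
  have "(cyclic_perm_matrix c *v axis (c j) 1) $ a = axis (c (if j = 1 then CARD('d) else j - 1)) 1 $ a" for a
  proof -
    obtain k where k: "k \<in> {1..CARD('d)}" "a = c k"
      using bij_betw_imp_surj_on[OF c] by blast
    have "(cyclic_perm_matrix c *v axis (c j) 1) $ a = cyclic_perm_matrix c $ a $ c j"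
      by (simp add: matrix_vector_mult_basis column_def)
    also have "\<dots> = (if (\<exists>i\<in>{1..<CARD('d)}. k = i \<and> j = i + 1) \<or> (k = CARD('d) \<and> j = 1) then 1 else 0)"
    proof -
      have "(\<exists>i\<in>{1..<CARD('d)}. c k = c i \<and> c j = c (i + 1)) \<longleftrightarrow> (\<exists>i\<in>{1..<CARD('d)}. k = i \<and> j = i + 1)"
        by (intro bex_cong refl conj_cong) (use inj k j in auto)
      moreover have "(c k = c (CARD('d)) \<and> c j = c 1) \<longleftrightarrow> (k = CARD('d) \<and> j = 1)"
        using inj[of k "CARD('d)"] inj[of j 1] k j by auto
      ultimately show ?thesis by (simp add: cyclic_perm_matrix_def k)
    qed
    also have "\<dots> = (if k = (if j = 1 then CARD('d) else j - 1) then 1 else 0)"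
    proof -
      have "(\<exists>i\<in>{1..<CARD('d)}. k = i \<and> j = i + 1) \<longleftrightarrow> 1 \<le> k \<and> k < CARD('d) \<and> j = k + 1" by auto
      moreover have "((1 \<le> k \<and> k < CARD('d) \<and> j = k + 1) \<or> (k = CARD('d) \<and> j = 1)) \<longleftrightarrow> k = (if j = 1 then CARD('d) else j - 1)"
        using j k(1) by (cases "j = 1") (simp_all, presburger)
      ultimately show ?thesis by presburger
    qed
    also have "\<dots> = axis (c (if j = 1 then CARD('d) else j - 1)) 1 $ a"
    proof -
      have "(if j = 1 then CARD('d) else j - 1) \<in> {1..CARD('d)}" using j by (cases "j = 1") (simp_all, linarith)
      from inj[OF k(1) this] show ?thesis unfolding k(2) axis_def by simp
    qed
    finally show ?thesis .
  qed
  then show ?thesis by (simp add: vec_eq_iff)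
qed

lemma mat_power_cyclic_axis:
  fixes c :: "nat \<Rightarrow> 'd::finite"
  assumes c: "bij_betw c {1..CARD('d)} UNIV" and j: "j \<in> {1..CARD('d)}" and "i < CARD('d)"
  shows "mat_power (cyclic_perm_matrix c) i *v axis (c j) 1 = axis (c (label_back (CARD('d)) i j)) 1"
  using assms(3)
proof (induction i)
  case 0
  then show ?case using j by (simp add: mat_power_0 label_back_def)
next
  case (Suc i)
  define k where "k = label_back (CARD('d)) i j"
  have k: "k \<in> {1..CARD('d)}" using j Suc.prems by (auto simp: k_def label_back_def)
  have "(if k = 1 then CARD('d) else k - 1) = label_back (CARD('d)) (Suc i) j"
    using j Suc.prems by (auto simp: k_def label_back_def)
  then show ?case
    using Suc cyclic_perm_matrix_axis[OF c k] by (simp add: mat_power_Suc_apply k_def)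
qed

lemma uminus_matrix_vector: "(- A) *v x = - (A *v (x :: real^'d))"
  by (simp add: matrix_vector_mult_def vec_eq_iff sum_negf)

lemma matrix_vector_uminus: "A *v (- x) = - (A *v (x :: real^'d))"
  by (simp add: matrix_vector_mult_def vec_eq_iff sum_negf)

definition signed_rotation :: "(nat \<Rightarrow> 'd::finite) \<Rightarrow> nat \<times> bool \<Rightarrow> real^'d^'d" where
  "signed_rotation c = (\<lambda>(i, neg). if neg then - mat_power (cyclic_perm_matrix c) i else mat_power (cyclic_perm_matrix c) i)"

lemma directions_labels:
  assumes "bij_betw c {1..CARD('d)} (UNIV :: 'd::finite set)" "v \<in> (directions :: (real^'d) set)"
  obtains j where "j \<in> {1..CARD('d)}" "v = axis (c j) 1 \<or> v = - axis (c j) 1"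
  using assms by (auto simp: directions_def Basis_eq_labels)

text \<open>
  Whatever the remembered direction, a uniformly chosen matrix \<open>\<plusminus>J\<^sup>i\<close> turns it into a uniform
  direction. This is where the fresh directions of \<open>merw_step\<close> come from.
\<close>

lemma bij_betw_signed_rotation:
  fixes c :: "nat \<Rightarrow> 'd::finite"
  assumes c: "bij_betw c {1..CARD('d)} UNIV" and v: "v \<in> directions"
  shows "bij_betw (\<lambda>\<iota>. signed_rotation c \<iota> *v v) ({..<CARD('d)} \<times> UNIV) directions"
proof -
  obtain j where j: "j \<in> {1..CARD('d)}" "v = axis (c j) 1 \<or> v = - axis (c j) 1"
    using directions_labels[OF c v] .
  define s where "s = (v = - axis (c j) 1)"
  define e where "e k = (axis (c k) 1 :: real^'d)" for k
  have e: "e k \<in> Basis" if "k \<in> {1..CARD('d)}" for k using that by (auto simp: e_def Basis_vec_def)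
  have rot: "signed_rotation c (i, neg) *v v = (if neg \<noteq> s then - e (label_back (CARD('d)) i j) else e (label_back (CARD('d)) i j))"
    if "i < CARD('d)" for i neg
    using j(2) mat_power_cyclic_axis[OF c j(1) that]
    by (auto simp: signed_rotation_def s_def e_def uminus_matrix_vector matrix_vector_uminus)
  have lb: "label_back (CARD('d)) i j \<in> {1..CARD('d)}" if "i < CARD('d)" for i
    using bij_betw_apply[OF label_back_bij[OF j(1)]] that by auto
  have "inj_on (\<lambda>\<iota>. signed_rotation c \<iota> *v v) ({..<CARD('d)} \<times> UNIV)"
  proof (rule inj_onI)
    fix \<iota> \<iota>' assume \<iota>: "\<iota> \<in> {..<CARD('d)} \<times> UNIV" "\<iota>' \<in> {..<CARD('d)} \<times> UNIV" and eq: "signed_rotation c \<iota> *v v = signed_rotation c \<iota>' *v v"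
    obtain i n i' n' where [simp]: "\<iota> = (i, n)" "\<iota>' = (i', n')" by (metis prod.exhaust)
    have i: "i < CARD('d)" "i' < CARD('d)" using \<iota> by auto
    let ?k = "label_back (CARD('d)) i j" and ?k' = "label_back (CARD('d)) i' j"
    have "e a \<noteq> - e b" if "a \<in> {1..CARD('d)}" "b \<in> {1..CARD('d)}" for a b
      using e[OF that(1)] e[OF that(2)] Basis_inter_uminus_Basis[where 'b = "real^'d"] by auto
    from this[OF lb[OF i(1)] lb[OF i(2)]] this[OF lb[OF i(2)] lb[OF i(1)]]
    have "e ?k \<noteq> - e ?k'" "- e ?k \<noteq> e ?k'" by (blast, metis)
    then have "n = n'" "e ?k = e ?k'" using eq by (auto simp: rot i split: if_splits)
    then have "c ?k = c ?k'" by (simp add: e_def axis_eq_axis)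
    then have "?k = ?k'" using inj_on_eq_iff[OF bij_betw_imp_inj_on[OF c] lb[OF i(1)] lb[OF i(2)]] by blast
    then have "i = i'" using inj_onD[OF bij_betw_imp_inj_on[OF label_back_bij[OF j(1)]]] i by blast
    with \<open>n = n'\<close> show "\<iota> = \<iota>'" by simp
  qed
  moreover have "(\<lambda>\<iota>. signed_rotation c \<iota> *v v) ` ({..<CARD('d)} \<times> UNIV) \<subseteq> directions"
    using rot e lb by (auto simp: directions_def)
  moreover have "card (({..<CARD('d)} \<times> UNIV) :: (nat \<times> bool) set) = card (directions :: (real^'d) set)"
    by (simp add: card_cartesian_product card_directions)
  ultimately show ?thesis
    by (metis (no_types, lifting) bij_betw_def card_image card_subset_eq finite_directions)
qed

text \<open>
  All these matrices are distinct, because they already differ on a single direction. Hence the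
  prescribed probabilities add up to one and the random matrix takes no further values.
\<close>

lemma inj_signed_rotation:
  fixes c :: "nat \<Rightarrow> 'd::finite"
  assumes c: "bij_betw c {1..CARD('d)} UNIV"
  shows "inj_on (signed_rotation c) ({..<CARD('d)} \<times> UNIV)" "0 \<notin> signed_rotation c ` ({..<CARD('d)} \<times> UNIV)"
proof -
  obtain v :: "real^'d" where v: "v \<in> directions" using directions_nonempty by blast
  have b: "bij_betw (\<lambda>\<iota>. signed_rotation c \<iota> *v v) ({..<CARD('d)} \<times> UNIV) directions"
    by (rule bij_betw_signed_rotation[OF c v])
  show "inj_on (signed_rotation c) ({..<CARD('d)} \<times> UNIV)"
    using bij_betw_imp_inj_on[OF b] unfolding inj_on_def by metis
  have False if "0 = signed_rotation c \<iota>" "\<iota> \<in> {..<CARD('d)} \<times> UNIV" for \<iota>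
  proof -
    have "signed_rotation c \<iota> *v v \<in> directions" using b that(2) by (rule bij_betw_apply)
    then have "norm (signed_rotation c \<iota> *v v) = 1" by (rule norm_directions)
    then show False by (simp add: that(1)[symmetric])
  qed
  then show "0 \<notin> signed_rotation c ` ({..<CARD('d)} \<times> UNIV)" by auto
qed

section \<open>The walk with stops as a time change of the walk without stops\<close>

context prob_space begin

lemma expectation_sum_indicators:
  fixes y :: "'i \<Rightarrow> 'c::{banach, second_countable_topology}"
  assumes "finite I" "\<And>i. i \<in> I \<Longrightarrow> E i \<in> events" "Y \<in> borel_measurable M"
    and "AE \<omega> in M. Y \<omega> = (\<Sum>i\<in>I. indicator (E i) \<omega> *\<^sub>R y i)"
  shows "expectation Y = (\<Sum>i\<in>I. prob (E i) *\<^sub>R y i)"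
proof -
  have int: "integrable M (\<lambda>\<omega>. indicator (E i) \<omega> *\<^sub>R y i)" if "i \<in> I" for i
    using assms(2)[OF that] by (intro integrable_scaleR_left integrable_real_indicator) (auto simp: less_top[symmetric])
  have "expectation Y = (\<integral>\<omega>. (\<Sum>i\<in>I. indicator (E i) \<omega> *\<^sub>R y i) \<partial>M)"
    by (rule integral_cong_AE[OF assms(3) _ assms(4)]) (intro borel_measurable_sum borel_measurable_integrable int)
  also have "\<dots> = (\<Sum>i\<in>I. prob (E i) *\<^sub>R y i)"
  proof -
    have "(\<integral>\<omega>. indicator (E i) \<omega> *\<^sub>R y i \<partial>M) = prob (E i) *\<^sub>R y i" if "i \<in> I" for i
      using assms(2)[OF that] by (subst integral_scaleR_left) (auto intro!: integrable_real_indicator simp: less_top[symmetric])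
    then show ?thesis using int by (subst Bochner_Integration.integral_sum) (auto simp del: scaleR_right_distrib intro!: sum.cong)
  qed
  finally show ?thesis .
qed

lemma AE_in_finite_range:
  assumes "finite S" "\<And>x. x \<in> S \<Longrightarrow> {\<omega>\<in>space M. Y \<omega> = x} \<in> events"
    and "(\<Sum>x\<in>S. prob {\<omega>\<in>space M. Y \<omega> = x}) = 1"
  shows "AE \<omega> in M. Y \<omega> \<in> S"
proof -
  have "prob (\<Union>x\<in>S. {\<omega>\<in>space M. Y \<omega> = x}) = (\<Sum>x\<in>S. prob {\<omega>\<in>space M. Y \<omega> = x})"
    by (rule finite_measure_finite_Union) (use assms in \<open>auto simp: disjoint_family_on_def\<close>)
  then have "AE \<omega> in M. \<omega> \<in> (\<Union>x\<in>S. {\<omega>\<in>space M. Y \<omega> = x})"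
    using assms by (subst prob_eq_1[symmetric]) auto
  then show ?thesis by eventually_elim auto
qed

end

context merws begin

text \<open>
  Almost surely the first \<open>n\<close> steps take finitely many values, so their law is described by the finitely many
  probabilities of the lists \<open>[X 1, \<dots>, X n]\<close>. This avoids conditional expectations.
\<close>

definition history :: "nat \<Rightarrow> 'a \<Rightarrow> (real^'d) list" where
  "history n \<omega> = map (\<lambda>k. X k \<omega>) [1..<Suc n]"

definition histories :: "nat \<Rightarrow> (real^'d) list set" where
  "histories n = {l. set l \<subseteq> insert 0 directions \<and> length l = n}"

definition rotations :: "(real^'d^'d) set" where
  "rotations = insert 0 (signed_rotation c ` ({..<CARD('d)} \<times> UNIV))"

definition rotation_prob :: "real^'d^'d \<Rightarrow> real" where
  "rotation_prob B = (if B = 0 then r else if B = mat 1 then p else q)"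

lemma finite_histories [simp]: "finite (histories n)"
  unfolding histories_def by (rule finite_lists_length_eq) simp

lemma finite_rotations [simp]: "finite rotations"
  by (simp add: rotations_def)

lemma length_history [simp]: "length (history n \<omega>) = n"
  by (simp add: history_def)

lemma history_nth: "k < n \<Longrightarrow> history n \<omega> ! k = X (Suc k) \<omega>"
  by (simp add: history_def del: upt_Suc)

lemma history_Suc: "history (Suc n) \<omega> = history n \<omega> @ [X (Suc n) \<omega>]"
  by (simp add: history_def)

lemma history_eq_iff: "length l = n \<Longrightarrow> history n \<omega> = l \<longleftrightarrow> (\<forall>k\<in>{1..n}. X k \<omega> = l ! (k - 1))"
proof -
  assume l: "length l = n"
  have "history n \<omega> = l \<longleftrightarrow> (\<forall>k<n. X (Suc k) \<omega> = l ! k)"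
    by (auto simp: list_eq_iff_nth_eq l history_nth)
  also have "\<dots> \<longleftrightarrow> (\<forall>k\<in>{1..n}. X k \<omega> = l ! (k - 1))"
    by (auto simp: Ball_def) (metis Suc_le_eq Suc_pred diff_Suc_1 le_add1 plus_1_eq_Suc zero_less_Suc)+
  finally show ?thesis .
qed

lemma signed_rotation_00: "signed_rotation c (0, False) = mat 1"
  by (simp add: signed_rotation_def mat_power_0)

lemma rotation_prob_signed:
  assumes "\<iota> \<in> {..<CARD('d)} \<times> UNIV"
  shows "rotation_prob (signed_rotation c \<iota>) = (if \<iota> = (0, False) then p else q)"
proof -
  have "signed_rotation c \<iota> \<noteq> 0" using inj_signed_rotation(2)[OF labelling] assms by (metis image_eqI)
  moreover have "signed_rotation c \<iota> = mat 1 \<longleftrightarrow> \<iota> = (0, False)"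
    using inj_onD[OF inj_signed_rotation(1)[OF labelling], of \<iota> "(0, False)"] assms signed_rotation_00 by auto
  ultimately show ?thesis by (simp add: rotation_prob_def)
qed

lemma sum_rotations:
  fixes f :: "real^'d^'d \<Rightarrow> real"
  shows "(\<Sum>B\<in>rotations. rotation_prob B * f B) =
    r * f 0 + (p - q) * f (mat 1) + q * (\<Sum>\<iota>\<in>{..<CARD('d)} \<times> UNIV. f (signed_rotation c \<iota>))"
proof -
  let ?I = "{..<CARD('d)} \<times> (UNIV :: bool set)"
  have "(\<Sum>B\<in>rotations. rotation_prob B * f B) = r * f 0 + (\<Sum>B\<in>signed_rotation c ` ?I. rotation_prob B * f B)"
    unfolding rotations_def using inj_signed_rotation(2)[OF labelling]
    by (subst sum.insert) (auto simp: rotation_prob_def)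
  also have "(\<Sum>B\<in>signed_rotation c ` ?I. rotation_prob B * f B) = (\<Sum>\<iota>\<in>?I. rotation_prob (signed_rotation c \<iota>) * f (signed_rotation c \<iota>))"
    by (subst sum.reindex[OF inj_signed_rotation(1)[OF labelling]]) simp
  also have "\<dots> = (\<Sum>\<iota>\<in>?I. (if \<iota> = (0, False) then (p - q) * f (signed_rotation c \<iota>) else 0) + q * f (signed_rotation c \<iota>))"
    by (intro sum.cong refl) (simp add: rotation_prob_signed algebra_simps)
  also have "\<dots> = (p - q) * f (mat 1) + q * (\<Sum>\<iota>\<in>?I. f (signed_rotation c \<iota>))"
    by (simp add: sum.distrib sum_distrib_left sum.delta signed_rotation_00)
  finally show ?thesis by simp
qed

lemma sum_rotation_prob: "(\<Sum>B\<in>rotations. rotation_prob B) = 1"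
  using sum_rotations[of "\<lambda>_. 1"] total by (simp add: card_cartesian_product algebra_simps)

lemma prob_A:
  assumes "n \<ge> 1" "B \<in> rotations"
  shows "prob {\<omega>\<in>space M. A (n + 1) \<omega> = B} = rotation_prob B"
proof (cases "B = 0")
  case True
  then show ?thesis using A_distribution(5)[OF assms(1)] by (simp add: rotation_prob_def)
next
  case False
  then obtain i neg where \<iota>: "B = signed_rotation c (i, neg)" "i < CARD('d)" using assms(2) by (auto simp: rotations_def)
  show ?thesis
  proof (cases "i = 0")
    case True
    then show ?thesis
      using A_distribution(1,2)[OF assms(1)] \<iota> rotation_prob_signed[of "(i, neg)"]
      by (cases neg) (auto simp: signed_rotation_def mat_power_0)
  next
    case False
    then have "i \<in> {1..CARD('d) - 1}" using \<iota> by auto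
    then show ?thesis
      using A_distribution(3,4)[OF assms(1)] \<iota> rotation_prob_signed[of "(i, neg)"] False
      by (cases neg) (auto simp: signed_rotation_def)
  qed
qed

lemma A_event: "n \<ge> 1 \<Longrightarrow> {\<omega>\<in>space M. A (n + 1) \<omega> = B} \<in> events"
  using A_measurable[of n] by measurable

lemma U_event: "n \<ge> 1 \<Longrightarrow> {\<omega>\<in>space M. U (n + 1) \<omega> = k} \<in> events"
  using U_measurable[of n] by measurable

lemma X_event: "n \<ge> 1 \<Longrightarrow> {\<omega>\<in>space M. X n \<omega> = v} \<in> events"
  using X_measurable[of n] by measurable

lemma AE_A: "n \<ge> 1 \<Longrightarrow> AE \<omega> in M. A (n + 1) \<omega> \<in> rotations"
  by (rule AE_in_finite_range) (use A_event prob_A sum_rotation_prob in auto)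

lemma AE_U: "n \<ge> 1 \<Longrightarrow> AE \<omega> in M. U (n + 1) \<omega> \<in> {1..n}"
  by (rule AE_in_finite_range) (use U_event U_uniform in auto)

lemma prob_X1:
  assumes "v \<in> directions"
  shows "prob {\<omega>\<in>space M. X 1 \<omega> = v} = 1 / (2 * real CARD('d))"
  using directions_labels[OF labelling assms] X_first by metis

lemma AE_X1: "AE \<omega> in M. X 1 \<omega> \<in> directions"
  by (rule AE_in_finite_range) (use X_event prob_X1 in \<open>auto simp: card_directions\<close>)

lemma rotation_step:
  assumes "B \<in> rotations" "v \<in> insert 0 directions"
  shows "B *v v \<in> insert 0 directions"
proof -
  have "signed_rotation c \<iota> *v v \<in> directions" if "\<iota> \<in> {..<CARD('d)} \<times> UNIV" "v \<in> directions" for \<iota>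
    by (rule bij_betw_apply[OF bij_betw_signed_rotation[OF labelling that(2)] that(1)])
  then show ?thesis using assms by (auto simp: rotations_def)
qed

lemma AE_history: "AE \<omega> in M. \<forall>k\<in>{1..n}. X k \<omega> \<in> insert 0 directions"
proof (induction n)
  case (Suc n)
  show ?case
  proof (cases "n = 0")
    case True
    show ?thesis using AE_X1 by eventually_elim (simp add: True)
  next
    case False
    then have n: "n \<ge> 1" by simp
    from Suc AE_A[OF n] AE_U[OF n] X_step[OF n] show ?thesis
    proof eventually_elim
      case (elim \<omega>)
      then have "X (n + 1) \<omega> \<in> insert 0 directions" using rotation_step[of "A (n + 1) \<omega>" "X (U (n + 1) \<omega>) \<omega>"] by simp
      then show ?case using elim by (auto simp: le_Suc_eq)
    qed
  qed
qed simp

lemma AE_histories: "AE \<omega> in M. history n \<omega> \<in> histories n"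
  using AE_history[of n]
proof eventually_elim
  case (elim \<omega>)
  then have "set (history n \<omega>) \<subseteq> insert 0 directions" by (auto simp: history_def simp del: upt_Suc)
  then show ?case by (simp add: histories_def)
qed

lemma history_past:
  assumes "n \<ge> 1"
  shows "{\<omega>\<in>space M. history n \<omega> = l} \<in> past_events M X n"
proof -
  interpret past: sigma_algebra "space M" "past_events M X n"
    unfolding past_events_def by (rule sigma_algebra_sigma_sets) auto
  show ?thesis
  proof (cases "length l = n")
    case True
    have "{\<omega>\<in>space M. X k \<omega> = v} \<in> past_events M X n" if "k \<in> {1..n}" for k v
    proof -
      have "{\<omega>\<in>space M. X k \<omega> = v} = X k -` {v} \<inter> space M" by auto
      moreover have "X k -` {v} \<inter> space M \<in> {X k -` B \<inter> space M | B. B \<in> sets borel}"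
        by (intro CollectI exI[of _ "{v}"]) auto
      ultimately show ?thesis unfolding past_events_def
        using that by (intro sigma_sets.Basic UN_I[of k]) auto
    qed
    then show ?thesis unfolding history_eq_iff[OF True]
      by (intro past.sets_Collect_finite_All) auto
  next
    case False
    then have "{\<omega>\<in>space M. history n \<omega> = l} = {}" by auto
    then show ?thesis by (simp only: past.empty_sets)
  qed
qed

lemma history_event: "{\<omega>\<in>space M. history n \<omega> = l} \<in> events"
proof (cases "n = 0")
  case True
  then show ?thesis by (simp add: history_def)
next
  case False
  then have n: "n \<ge> 1" by simp
  show ?thesis using indep_setD_ev2[OF AU_indep_past[OF n]] history_past[OF n] by blast
qed

lemma prob_AU_history:
  assumes n: "n \<ge> 1" and k: "k \<in> {1..n}" and B: "B \<in> rotations"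
  shows "prob {\<omega>\<in>space M. history n \<omega> = l \<and> U (n + 1) \<omega> = k \<and> A (n + 1) \<omega> = B} =
    prob {\<omega>\<in>space M. history n \<omega> = l} * (rotation_prob B / real n)"
proof -
  let ?f = "\<lambda>\<omega>. (A (n + 1) \<omega>, U (n + 1) \<omega>)"
  have "{B} \<times> {k} \<in> sets (borel \<Otimes>\<^sub>M count_space UNIV)" by (intro pair_measureI) auto
  then have AU: "?f -` ({B} \<times> {k}) \<inter> space M \<in> sets (vimage_algebra (space M) ?f (borel \<Otimes>\<^sub>M count_space UNIV))"
    by (rule in_vimage_algebra)
  have "prob {\<omega>\<in>space M. history n \<omega> = l \<and> U (n + 1) \<omega> = k \<and> A (n + 1) \<omega> = B} =
      prob ((?f -` ({B} \<times> {k}) \<inter> space M) \<inter> {\<omega>\<in>space M. history n \<omega> = l})"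
    by (rule arg_cong[where f = prob]) auto
  also have "\<dots> = prob (?f -` ({B} \<times> {k}) \<inter> space M) * prob {\<omega>\<in>space M. history n \<omega> = l}"
    by (rule indep_setD[OF AU_indep_past[OF n] AU history_past[OF n]])
  also have "prob (?f -` ({B} \<times> {k}) \<inter> space M) = prob ((A (n + 1) -` {B} \<inter> space M) \<inter> (U (n + 1) -` {k} \<inter> space M))"
    by (rule arg_cong[where f = prob]) auto
  also have "\<dots> = prob (A (n + 1) -` {B} \<inter> space M) * prob (U (n + 1) -` {k} \<inter> space M)"
    by (rule indep_setD) (use A_indep_U[OF n] in \<open>auto simp: indep_rv_def intro!: in_vimage_algebra\<close>)
  also have "A (n + 1) -` {B} \<inter> space M = {\<omega>\<in>space M. A (n + 1) \<omega> = B}" by auto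
  also have "U (n + 1) -` {k} \<inter> space M = {\<omega>\<in>space M. U (n + 1) \<omega> = k}" by auto
  finally show ?thesis using prob_A[OF n B] U_uniform[OF n k] by simp
qed

definition history_mean :: "nat \<Rightarrow> ((real^'d) list \<Rightarrow> 'c::real_vector) \<Rightarrow> 'c" where
  "history_mean n G = (\<Sum>l\<in>histories n. prob {\<omega>\<in>space M. history n \<omega> = l} *\<^sub>R G l)"

lemma expectation_history:
  fixes G :: "(real^'d) list \<Rightarrow> 'c::{banach, second_countable_topology}"
  assumes "Y \<in> borel_measurable M" "AE \<omega> in M. history n \<omega> \<in> histories n \<longrightarrow> Y \<omega> = G (history n \<omega>)"
  shows "expectation Y = history_mean n G"
  unfolding history_mean_def
proof (rule expectation_sum_indicators[OF _ history_event assms(1)])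
  show "AE \<omega> in M. Y \<omega> = (\<Sum>l\<in>histories n. indicator {\<omega>\<in>space M. history n \<omega> = l} \<omega> *\<^sub>R G l)"
    using assms(2) AE_histories[of n] AE_space
  proof eventually_elim
    case (elim \<omega>)
    have "(\<Sum>l\<in>histories n. indicator {\<omega>\<in>space M. history n \<omega> = l} \<omega> *\<^sub>R G l) =
        (\<Sum>l\<in>histories n. if l = history n \<omega> then G l else 0)"
      using elim by (intro sum.cong) auto
    then show ?case using elim by (simp add: sum.delta)
  qed
qed simp

text \<open>
  The Markov property: the next step is obtained by choosing the index and the matrix
  independently of the history.
\<close>

lemma history_mean_Suc:
  fixes G :: "(real^'d) list \<Rightarrow> real"
  assumes n: "n \<ge> 1"
  shows "history_mean (Suc n) G = history_mean n (\<lambda>l. \<Sum>k\<in>{1..n}. \<Sum>B\<in>rotations. rotation_prob B / real n * G (l @ [B *v (l ! (k - 1))]))"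
proof -
  let ?J = "histories n \<times> {1..n} \<times> rotations"
  let ?E = "\<lambda>(l, k, B). {\<omega>\<in>space M. history n \<omega> = l \<and> U (n + 1) \<omega> = k \<and> A (n + 1) \<omega> = B}"
  let ?y = "\<lambda>(l, k, B). G (l @ [B *v (l ! (k - 1))])"
  define Y where "Y \<omega> = (\<Sum>i\<in>?J. indicator (?E i) \<omega> *\<^sub>R ?y i)" for \<omega>
  have ev: "?E i \<in> events" for i
  proof -
    obtain l k B where i: "i = (l, k, B)" by (metis prod.exhaust)
    have "?E i = {\<omega>\<in>space M. history n \<omega> = l} \<inter> ({\<omega>\<in>space M. U (n + 1) \<omega> = k} \<inter> {\<omega>\<in>space M. A (n + 1) \<omega> = B})"
      unfolding i by auto
    then show ?thesis using history_event A_event[OF n] U_event[OF n] by auto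
  qed
  have Ym: "Y \<in> borel_measurable M"
    unfolding Y_def using ev by (intro borel_measurable_sum borel_measurable_scaleR borel_measurable_indicator) auto
  have "expectation Y = (\<Sum>i\<in>?J. prob (?E i) *\<^sub>R ?y i)"
    by (rule expectation_sum_indicators) (use ev Ym in \<open>auto simp: Y_def\<close>)
  also have "\<dots> = (\<Sum>(l, k, B)\<in>?J. prob {\<omega>\<in>space M. history n \<omega> = l} * (rotation_prob B / real n) * G (l @ [B *v (l ! (k - 1))]))"
    by (intro sum.cong refl) (auto simp: prob_AU_history[OF n, simplified])
  also have "\<dots> = history_mean n (\<lambda>l. \<Sum>k\<in>{1..n}. \<Sum>B\<in>rotations. rotation_prob B / real n * G (l @ [B *v (l ! (k - 1))]))"
    unfolding history_mean_def
    by (simp only: sum.cartesian_product[symmetric] real_scaleR_def sum_distrib_left mult.assoc)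
  also have "expectation Y = history_mean (Suc n) G"
  proof (rule expectation_history[OF Ym])
    show "AE \<omega> in M. history (Suc n) \<omega> \<in> histories (Suc n) \<longrightarrow> Y \<omega> = G (history (Suc n) \<omega>)"
      using AE_histories[of n] AE_A[OF n] AE_U[OF n] X_step[OF n] AE_space
    proof eventually_elim
      case (elim \<omega>)
      let ?i = "(history n \<omega>, U (n + 1) \<omega>, A (n + 1) \<omega>)"
      have "Y \<omega> = (\<Sum>i\<in>?J. if i = ?i then ?y i else 0)"
        unfolding Y_def using elim by (intro sum.cong refl) (auto simp: indicator_def)
      also have "\<dots> = ?y ?i" using elim by (subst sum.delta) auto
      also have "\<dots> = G (history (Suc n) \<omega>)"
      proof -
        have "history n \<omega> ! (U (n + 1) \<omega> - 1) = X (U (n + 1) \<omega>) \<omega>"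
          using elim history_nth[of "U (n + 1) \<omega> - 1" n \<omega>] by auto
        then show ?thesis using elim by (simp add: history_Suc)
      qed
      finally show ?case by simp
    qed
  qed
  finally show ?thesis by simp
qed

definition moved :: "(real^'d) list \<Rightarrow> (real^'d) multiset" where
  "moved l = filter_mset (\<lambda>v. v \<noteq> 0) (mset l)"

lemma sum_list_split_moved:
  fixes f :: "real^'d \<Rightarrow> real"
  shows "(\<Sum>v\<leftarrow>l. f v) = (real (length l) - real (size (moved l))) * f 0 + (\<Sum>v\<in>#moved l. f v)"
  by (induction l) (auto simp: moved_def algebra_simps)

lemma moved_directions: "l \<in> histories n \<Longrightarrow> set_mset (moved l) \<subseteq> directions"
  by (auto simp: moved_def histories_def)

lemma moved_snoc: "moved (l @ [v]) = (if v = 0 then moved l else add_mset v (moved l))"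
  by (simp add: moved_def)

lemma zero_notin_directions: "0 \<notin> (directions :: (real^'d) set)"
  using norm_directions by fastforce

text \<open>
  The computation at the heart of the proof. Averaging over the remembered index and over the
  matrix turns the step of the walk with stops into a move of probability \<open>\<theta> N / n\<close>, distributed
  like \<open>merw_step\<close>. This is where the critical value of \<open>p\<close> enters.
\<close>

lemma history_step_moved:
  fixes g :: "(real^'d) multiset \<Rightarrow> real"
  assumes crit: "p = critical_p (CARD('d)) r" and n: "n \<ge> 1" and l: "l \<in> histories n" and ne: "moved l \<noteq> {#}"
  defines "\<theta> \<equiv> 1 - r" and "K \<equiv> moved l"
  shows "(\<Sum>k\<in>{1..n}. \<Sum>B\<in>rotations. rotation_prob B / real n * g (moved (l @ [B *v (l ! (k - 1))]))) =
    g K + \<theta> * real (size K) / real n * (step_mean K (\<lambda>v. g (add_mset v K)) - g K)"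
proof -
  define h where "h x = g (if x = 0 then K else add_mset x K)" for x
  \<comment> \<open>The mean of \<open>h\<close> over the matrix, when the remembered step is \<open>v\<close>.\<close>
  define \<Phi> where "\<Phi> v = (\<Sum>B\<in>rotations. rotation_prob B * h (B *v v))" for v
  define S where "S = (\<Sum>u\<in>directions. g (add_mset u K))"
  let ?d = "real CARD('d)"
  have d: "?d > 0" by simp
  have pc: "p = (2 * ?d + 1) / (4 * ?d) * \<theta>" using crit by (simp add: critical_p_def \<theta>_def)
  have "(2 * ?d - 1) * q = \<theta> - p" using total by (simp add: \<theta>_def)
  also have "\<theta> - p = (2 * ?d - 1) * (\<theta> / (4 * ?d))" using d unfolding pc by (simp add: field_simps)
  finally have qd: "(2 * ?d - 1) * q = (2 * ?d - 1) * (\<theta> / (4 * ?d))" .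
  have qc: "q = \<theta> / (4 * ?d)"
  proof -
    have "?d \<ge> 1" by (simp add: Suc_le_eq)
    then have "2 * ?d - 1 \<noteq> 0" by linarith
    then show ?thesis using qd by (simp only: mult_cancel_left) simp
  qed
  have pq: "p - q = \<theta> / 2" unfolding pc qc using d by (simp add: field_simps)
  have \<Phi>0: "\<Phi> 0 = g K" unfolding \<Phi>_def by (simp add: h_def sum_distrib_right[symmetric] sum_rotation_prob)
  have \<Phi>v: "\<Phi> v = r * g K + \<theta> / 2 * g (add_mset v K) + \<theta> / (4 * ?d) * S" if v: "v \<in> directions" for v
  proof -
    have v0: "v \<noteq> 0" using v zero_notin_directions by auto
    have "(\<Sum>\<iota>\<in>{..<CARD('d)} \<times> UNIV. h (signed_rotation c \<iota> *v v)) = (\<Sum>u\<in>directions. h u)"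
      by (rule sum.reindex_bij_betw[OF bij_betw_signed_rotation[OF labelling v]])
    also have "\<dots> = S" unfolding S_def h_def using zero_notin_directions by (intro sum.cong) auto
    finally have "\<Phi> v = r * h 0 + (p - q) * h v + q * S"
      unfolding \<Phi>_def by (subst sum_rotations) simp
    then have "\<Phi> v = r * h 0 + \<theta> / 2 * h v + \<theta> / (4 * ?d) * S" unfolding pq unfolding qc .
    then show ?thesis using v0 by (simp add: h_def)
  qed
  have len: "length l = n" using l by (simp add: histories_def)
  have "(\<Sum>k\<in>{1..n}. \<Sum>B\<in>rotations. rotation_prob B / real n * g (moved (l @ [B *v (l ! (k - 1))]))) =
      (\<Sum>k\<in>{1..n}. \<Phi> (l ! (k - 1))) / real n"
    unfolding \<Phi>_def sum_divide_distrib by (intro sum.cong refl) (simp add: moved_snoc h_def K_def)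
  also have "(\<Sum>k\<in>{1..n}. \<Phi> (l ! (k - 1))) = (\<Sum>k<n. \<Phi> (l ! k))"
    by (rule sum.reindex_bij_witness[of _ Suc "\<lambda>k. k - 1"]) auto
  also have "\<dots> = (\<Sum>v\<leftarrow>l. \<Phi> v)" using len by (simp add: sum_list_sum_nth atLeast0LessThan)
  also have "\<dots> = (real n - real (size K)) * g K + (\<Sum>v\<in>#K. \<Phi> v)"
    unfolding K_def by (simp add: sum_list_split_moved len \<Phi>0 K_def)
  also have "(\<Sum>v\<in>#K. \<Phi> v) = real (size K) * (r * g K + \<theta> / (4 * ?d) * S) + \<theta> / 2 * (\<Sum>v\<in>#K. g (add_mset v K))"
  proof -
    have "(\<Sum>v\<in>#K. \<Phi> v) = (\<Sum>v\<in>#K. (r * g K + \<theta> / (4 * ?d) * S) + \<theta> / 2 * g (add_mset v K))"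
      by (rule arg_cong[where f = sum_mset], rule image_mset_cong)
         (use \<Phi>v moved_directions[OF l] in \<open>auto simp: K_def\<close>)
    then show ?thesis by (simp add: sum_mset.distrib sum_mset_distrib_left)
  qed
  also have "((real n - real (size K)) * g K + (real (size K) * (r * g K + \<theta> / (4 * ?d) * S) + \<theta> / 2 * (\<Sum>v\<in>#K. g (add_mset v K)))) / real n
    = g K + \<theta> * real (size K) / real n * ((1 / 2 * (S / (2 * ?d)) + 1 / 2 * ((\<Sum>v\<in>#K. g (add_mset v K)) / real (size K))) - g K)"
  proof -
    have s: "real (size K) > 0" using ne by (simp add: K_def nonempty_has_size)
    have rr: "r = 1 - \<theta>" by (simp add: \<theta>_def)
    show ?thesis using n s d unfolding rr by (simp add: field_simps)
  qed
  also have "1 / 2 * (S / (2 * ?d)) + 1 / 2 * ((\<Sum>v\<in>#K. g (add_mset v K)) / real (size K)) = step_mean K (\<lambda>v. g (add_mset v K))"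
  proof -
    have "K \<noteq> {#}" using ne by (simp add: K_def)
    then show ?thesis
      by (simp only: expectation_merw_step_nonempty not_False_eq_True S_def real_scaleR_def divide_inverse DIM_cart DIM_real mult_1_right mult_1_left mult.commute)
  qed
  finally show ?thesis .
qed

text \<open>
  The number of moves and the sequence of moves decouple: the moves are made according to the
  walk without stops, observed at an independent random time. The induction step applies the
  hypothesis to the function that results from averaging over the last step.
\<close>

theorem law_of_moved:
  fixes g :: "(real^'d) multiset \<Rightarrow> real"
  assumes crit: "p = critical_p (CARD('d)) r"
  shows "history_mean (Suc n) (\<lambda>l. g (moved l)) =
    moves_mean (1 - r) n (\<lambda>N. merw_mean N g)"
proof (induction n arbitrary: g)
  case 0
  have "history_mean 1 (\<lambda>l. g (moved l)) = (\<Sum>v\<in>directions. prob {\<omega>\<in>space M. X 1 \<omega> = v} *\<^sub>R g {#v#})"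
  proof -
    let ?Y = "\<lambda>\<omega>. \<Sum>v\<in>directions. indicator {\<omega>\<in>space M. X 1 \<omega> = v} \<omega> *\<^sub>R g {#v#}"
    have Ym: "?Y \<in> borel_measurable M"
      using X_event[of 1] by (intro borel_measurable_sum borel_measurable_scaleR borel_measurable_indicator) auto
    have "expectation ?Y = history_mean 1 (\<lambda>l. g (moved l))"
    proof (rule expectation_history[OF Ym])
      show "AE \<omega> in M. history 1 \<omega> \<in> histories 1 \<longrightarrow> ?Y \<omega> = g (moved (history 1 \<omega>))"
        using AE_X1 AE_space
      proof eventually_elim
        case (elim \<omega>)
        have "?Y \<omega> = (\<Sum>v\<in>directions. if v = X 1 \<omega> then g {#v#} else 0)"
          using elim by (intro sum.cong refl) (auto simp: indicator_def)
        also have "\<dots> = g {#X 1 \<omega>#}" using elim by (simp add: sum.delta)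
        also have "{#X 1 \<omega>#} = moved (history 1 \<omega>)"
          using elim zero_notin_directions by (auto simp: history_def moved_def)
        finally show ?case by simp
      qed
    qed
    moreover have "expectation ?Y = (\<Sum>v\<in>directions. prob {\<omega>\<in>space M. X 1 \<omega> = v} *\<^sub>R g {#v#})"
      by (rule expectation_sum_indicators) (use X_event[of 1] Ym in auto)
    ultimately show ?thesis by simp
  qed
  also have "\<dots> = (\<Sum>v\<in>directions. g {#v#}) / (2 * real CARD('d))"
    by (simp add: prob_X1[simplified] sum_divide_distrib)
  also have "\<dots> = merw_mean (Suc 0) g"
    unfolding expectation_merw_Suc
    by (simp add: merw_step_def integral_pmf_of_set card_directions)
  finally show ?case by simp
next
  case (Suc n)
  define \<theta> where "\<theta> = 1 - r"
  define g' where "g' K = g K + \<theta> * real (size K) / real (Suc n) *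
      (step_mean K (\<lambda>v. g (add_mset v K)) - g K)" for K
  have \<theta>: "0 \<le> \<theta>" "\<theta> \<le> 1" using r_range by (auto simp: \<theta>_def)
  have "history_mean (Suc (Suc n)) (\<lambda>l. g (moved l)) = history_mean (Suc n) (\<lambda>l. g' (moved l))"
  proof -
    have "prob {\<omega>\<in>space M. history (Suc n) \<omega> = l} *\<^sub>R (\<Sum>k\<in>{1..Suc n}. \<Sum>B\<in>rotations. rotation_prob B / real (Suc n) * g (moved (l @ [B *v (l ! (k - 1))])))
        = prob {\<omega>\<in>space M. history (Suc n) \<omega> = l} *\<^sub>R g' (moved l)" if l: "l \<in> histories (Suc n)" for l
    \<comment> \<open>The first step is a move, so histories without a move have probability zero.\<close>
    proof (cases "moved l = {#}")
      case True
      have "AE \<omega> in M. history (Suc n) \<omega> \<noteq> l"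
        using AE_X1
      proof eventually_elim
        case (elim \<omega>)
        then have "X 1 \<omega> \<in># moved (history (Suc n) \<omega>)"
          using zero_notin_directions by (auto simp: moved_def history_def simp del: upt_Suc)
        then show ?case using True by auto
      qed
      then have "prob {\<omega>\<in>space M. history (Suc n) \<omega> = l} = 0"
        by (subst prob_Collect_eq_0[OF history_event]) 
      then show ?thesis by simp
    next
      case False
      then show ?thesis using history_step_moved[OF crit _ l False, of g] by (simp add: g'_def \<theta>_def)
    qed
    then have "history_mean (Suc n) (\<lambda>l. \<Sum>k\<in>{1..Suc n}. \<Sum>B\<in>rotations. rotation_prob B / real (Suc n) * g (moved (l @ [B *v (l ! (k - 1))])))
        = history_mean (Suc n) (\<lambda>l. g' (moved l))"
      unfolding history_mean_def by (rule sum.cong[OF refl])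
    moreover have "1 \<le> Suc n" by simp
    ultimately show ?thesis by (simp only: history_mean_Suc[of "Suc n"])
  qed
  also have "\<dots> = moves_mean \<theta> n (\<lambda>N. merw_mean N g')"
    unfolding \<theta>_def by (rule Suc.IH)
  also have "\<dots> = moves_mean \<theta> n (\<lambda>N. merw_mean N g
      + \<theta> * real N / real (Suc n) * (merw_mean (Suc N) g - merw_mean N g))"
  proof (intro arg_cong[where f = "moves_mean \<theta> n"] ext)
    fix N
    have "merw_mean N g' = merw_mean N (\<lambda>K. g K + \<theta> * real N / real (Suc n) *
      (step_mean K (\<lambda>v. g (add_mset v K)) - g K))"
      by (rule integral_cong_AE) (use set_pmf_merw in \<open>auto simp: AE_measure_pmf_iff g'_def\<close>)
    then show "merw_mean N g' = merw_mean N g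
      + \<theta> * real N / real (Suc n) * (merw_mean (Suc N) g - merw_mean N g)"
      unfolding expectation_merw_Suc by (simp del: of_nat_Suc)
  qed
  also have "\<dots> = moves_mean \<theta> (Suc n) (\<lambda>N. merw_mean N g)"
    by (rule expectation_moves_Suc[OF \<theta>, symmetric])
  finally show ?case unfolding \<theta>_def .
qed

end

section \<open>The two limit theorems\<close>

text \<open>
  The central limit theorem for the walk without stops at deterministic times.
\<close>

lemma merw_weak_limit:
  fixes f :: "real^'d \<Rightarrow> real"
  assumes "continuous_on UNIV f" "bounded (range f)"
  shows "(\<lambda>m. merw_mean m (\<lambda>K. f (sum_mset K /\<^sub>R sqrt (real m * ln (real m)))))
    \<longlonglongrightarrow> integral\<^sup>L (gaussian_measure 0 ((1 / real CARD('d)) *\<^sub>R mat 1)) f"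
proof -
  let ?\<gamma> = "gaussian_measure 0 ((1 / real CARD('d)) *\<^sub>R mat 1 :: real^'d^'d)"
  let ?b = "\<lambda>m. sqrt (real m * ln (real m))"
  define \<mu> where "\<mu> m = distr (measure_pmf (merw_pmf m)) borel (\<lambda>K :: (real^'d) multiset. sum_mset K /\<^sub>R ?b m)" for m
  have meas: "(\<lambda>K :: (real^'d) multiset. sum_mset K /\<^sub>R ?b m) \<in> measurable (measure_pmf (merw_pmf m)) borel" for m by simp
  have "weakly_converges \<mu> ?\<gamma>"
  proof (rule weakly_converges_if_char_tendsto)
    show "prob_space (\<mu> m)" for m unfolding \<mu>_def by (rule measure_pmf.prob_space_distr[OF meas])
    show "sets (\<mu> m) = sets borel" for m by (simp add: \<mu>_def)
    show "prob_space ?\<gamma>" by (rule prob_space_gaussian_measure) simp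
    show "sets ?\<gamma> = sets borel" by simp
    fix u :: "real^'d"
    obtain C where C: "C \<ge> 0" "\<And>m (u :: real^'d). merw_char_error m u \<le> C * ((norm u)\<^sup>2 * real m + norm u ^ 3 * real m powr (3/2))"
      using merw_char_bound by blast
    have char: "(\<integral>x. iexp (u \<bullet> x) \<partial>\<mu> m) = merw_mean m (\<lambda>K. iexp ((u /\<^sub>R ?b m) \<bullet> sum_mset K))" for m
      unfolding \<mu>_def by (subst integral_distr) auto
    have target: "(\<integral>x. iexp (u \<bullet> x) \<partial>?\<gamma>) = exp (- ((norm u)\<^sup>2 / (2 * real DIM(real^'d))))"
      by (subst char_gaussian_measure) auto
    have bound: "cmod ((\<integral>x. iexp (u \<bullet> x) \<partial>\<mu> m) - (\<integral>x. iexp (u \<bullet> x) \<partial>?\<gamma>)) 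
      \<le> C * ((norm u)\<^sup>2 / ln (real m) + norm u ^ 3 / ln (real m) powr (3/2))" if m: "m \<ge> 2" for m
    proof -
      have pos: "real m > 0" "ln (real m) > 0" using m by auto
      then have b: "?b m > 0" "(?b m)\<^sup>2 = real m * ln (real m)" by auto
      have n: "norm (u /\<^sub>R ?b m) = norm u / ?b m" using b by (simp add: divide_inverse)
      have e1: "(norm u / ?b m)\<^sup>2 * (real m * ln (real m)) = (norm u)\<^sup>2"
        unfolding power_divide b(2) using pos by simp
      have e2: "(norm u / ?b m)\<^sup>2 * real m = (norm u)\<^sup>2 / ln (real m)"
        unfolding power_divide b(2) using pos by simp
      have e3: "(norm u / ?b m) ^ 3 * real m powr (3/2) = norm u ^ 3 / ln (real m) powr (3/2)"
      proof -
        have "?b m ^ 3 = (real m * ln (real m)) powr (3/2)"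
          using b pos by (simp add: powr_half_sqrt[symmetric] powr_powr powr_numeral[symmetric] del: powr_numeral)
        also have "\<dots> = real m powr (3/2) * ln (real m) powr (3/2)" by (rule powr_mult)
        finally show ?thesis using pos by (simp add: power_divide)
      qed
      show ?thesis using C(2)[of m "u /\<^sub>R ?b m"] unfolding merw_char_error_def char target n e1 e2 e3 .
    qed
    have "(\<lambda>m. C * ((norm u)\<^sup>2 / ln (real m) + norm u ^ 3 / ln (real m) powr (3/2))) \<longlonglongrightarrow> C * (0 + 0)"
      by (intro tendsto_intros) real_asymp+
    then have "(\<lambda>m. C * ((norm u)\<^sup>2 / ln (real m) + norm u ^ 3 / ln (real m) powr (3/2))) \<longlonglongrightarrow> 0" by simp
    then have "(\<lambda>m. (\<integral>x. iexp (u \<bullet> x) \<partial>\<mu> m) - (\<integral>x. iexp (u \<bullet> x) \<partial>?\<gamma>)) \<longlonglongrightarrow> 0"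
      by (rule Lim_null_comparison[rotated]) (rule eventually_sequentiallyI[of 2], rule bound)
    then show "(\<lambda>m. \<integral>x. iexp (u \<bullet> x) \<partial>\<mu> m) \<longlonglongrightarrow> (\<integral>x. iexp (u \<bullet> x) \<partial>?\<gamma>)"
      by (simp add: LIM_zero_iff)
  qed
  then have "(\<lambda>m. integral\<^sup>L (\<mu> m) f) \<longlonglongrightarrow> integral\<^sup>L ?\<gamma> f"
    using assms unfolding weakly_converges_def by blast
  then show ?thesis
    unfolding \<mu>_def by (subst (asm) integral_distr) (use borel_measurable_continuous_onI[OF assms(1)] in auto)
qed

text \<open>
  The number of moves tends to infinity in probability. The error for small numbers of moves is
  dominated by a multiple of \<open>1 / sqrt m\<close>, whose mean tends to zero.
\<close>

lemma moves_averages_tendsto: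
  fixes a :: "nat \<Rightarrow> real"
  assumes \<theta>: "0 < \<theta>" "\<theta> \<le> 1" and a: "a \<longlonglongrightarrow> L" "\<And>m. \<bar>a m\<bar> \<le> B"
  shows "(\<lambda>n. moves_mean \<theta> n a) \<longlonglongrightarrow> L"
proof (rule LIMSEQ_I)
  fix e :: real assume e: "e > 0"
  have B: "B \<ge> 0" using a(2)[of 0] by linarith
  have LB: "\<bar>L\<bar> \<le> B" by (rule LIMSEQ_le_const2[OF tendsto_rabs[OF a(1)]]) (use a(2) in auto)
  from LIMSEQ_D[OF a(1), of "e/2"] e obtain m0 where m0: "\<And>m. m \<ge> m0 \<Longrightarrow> \<bar>a m - L\<bar> < e/2" by auto
  \<comment> \<open>For \<open>m < m0\<close> the bound \<open>2 * B\<close> is at most \<open>c / sqrt m\<close>.\<close>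
  define c where "c = 2 * B * sqrt (real m0)"
  have c: "c \<ge> 0" using B by (simp add: c_def)
  have pt: "\<bar>a m - L\<bar> \<le> e/2 + c * (1 / sqrt (real m))" if m: "m \<ge> 1" for m
  proof (cases "m \<ge> m0")
    case True
    then show ?thesis using m0[OF True] c by (smt (verit) divide_nonneg_nonneg mult_nonneg_nonneg real_sqrt_ge_zero of_nat_0_le_iff)
  next
    case False
    then have "sqrt (real m) \<le> sqrt (real m0)" by simp
    then have "1 \<le> sqrt (real m0) / sqrt (real m)" using m by (simp add: pos_le_divide_eq)
    then have "2 * B * 1 \<le> 2 * B * (sqrt (real m0) / sqrt (real m))" using B by (intro mult_left_mono) auto
    then show ?thesis using a(2)[of m] LB e by (simp add: c_def)
  qed
  have est: "\<bar>moves_mean \<theta> n a - L\<bar> \<le> e/2 + c * (2 * real (Suc n) powr (- (\<theta> / 2)))" for n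
  proof -
    have "\<bar>moves_mean \<theta> n a - L\<bar> = \<bar>moves_mean \<theta> n (\<lambda>m. a m - L)\<bar>" by simp
    also have "\<dots> \<le> moves_mean \<theta> n (\<lambda>m. \<bar>a m - L\<bar>)" by (rule integral_abs_bound)
    also have "\<dots> \<le> moves_mean \<theta> n (\<lambda>m. e/2 + c * (1 / sqrt (real m)))"
      by (rule expectation_moves_mono) (rule pt)
    also have "\<dots> = e/2 + c * moves_mean \<theta> n (\<lambda>m. 1 / sqrt (real m))" 
      by (subst Bochner_Integration.integral_add) (simp_all only: integrable_moves integral_mult_right_zero, simp)
    also have "\<dots> \<le> e/2 + c * (2 * real (Suc n) powr (- (\<theta> / 2)))"
      using c \<theta> by (intro add_left_mono mult_left_mono moves_neg_moment) auto
    finally show ?thesis .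
  qed
  have "(\<lambda>n. c * (2 * real (Suc n) powr (- (\<theta> / 2)))) \<longlonglongrightarrow> c * (2 * 0)"
    by (intro tendsto_intros) (use \<theta> in real_asymp)
  then have "(\<lambda>n. c * (2 * real (Suc n) powr (- (\<theta> / 2)))) \<longlonglongrightarrow> 0" by simp
  from LIMSEQ_D[OF this, of "e/2"] e obtain n0 where n0: "\<And>n. n \<ge> n0 \<Longrightarrow> \<bar>c * (2 * real (Suc n) powr (- (\<theta> / 2)))\<bar> < e/2"
    by (auto simp del: of_nat_Suc)
  have "norm (moves_mean \<theta> n a - L) < e" if "n \<ge> n0" for n
    using est[of n] n0[OF that] by (simp only: real_norm_def)
  then show "\<exists>n0. \<forall>n\<ge>n0. norm (moves_mean \<theta> n a - L) < e" by blast
qed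

lemma elementary_bounds:
  fixes x :: real
  assumes "x > 0"
  shows "x \<le> 1 + x\<^sup>2" "x powr (3/2) \<le> 1 + x\<^sup>2" "\<bar>x * ln x\<bar> \<le> 1 + x\<^sup>2"
proof -
  have sq: "x powr 2 = x\<^sup>2" using assms by simp
  show "x \<le> 1 + x\<^sup>2"
  proof -
    have "0 \<le> (x - 1)\<^sup>2" by simp
    then show ?thesis using assms by (simp add: power2_diff)
  qed
  show "x powr (3/2) \<le> 1 + x\<^sup>2"
  proof (cases "x \<le> 1")
    case True
    then have "x powr (3/2) \<le> 1" using assms by (intro powr_le1) auto
    then show ?thesis by (smt (verit) zero_le_power2)
  next
    case False
    then have "x powr (3/2) \<le> x powr 2" by (intro powr_mono) auto
    then show ?thesis using sq by simp
  qed
  have "ln x \<le> x" using ln_le_minus_one[OF assms] by linarith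
  then have u: "x * ln x \<le> x * x" using assms by (intro mult_left_mono) auto
  have "- ln x \<le> 1 / x" using ln_le_minus_one[of "1 / x"] assms by (simp add: ln_div)
  then have "x * (- ln x) \<le> x * (1 / x)" using assms by (intro mult_left_mono) auto
  then have "- (x * ln x) \<le> 1" using assms by simp
  then show "\<bar>x * ln x\<bar> \<le> 1 + x\<^sup>2" using u unfolding power2_eq_square abs_le_iff
    by (smt (verit) zero_le_square)
qed

text \<open>
  The general bound at the scale of the second limit theorem, in terms of \<open>x = m / y\<close>. Here \<open>y\<close>
  stands for \<open>n powr \<theta>\<close> and \<open>l\<close> for \<open>ln n\<close>, so that \<open>ln m = ln x + \<theta> l\<close>. All errors are at most
  quadratic in \<open>x\<close> and carry a factor \<open>1 / l\<close>.
\<close>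

lemma merw_char_at_move_scale:
  fixes u :: "'b::euclidean_space"
  assumes C: "C \<ge> 0" "\<And>m (u :: 'b). merw_char_error m u \<le> C * ((norm u)\<^sup>2 * real m + norm u ^ 3 * real m powr (3/2))"
    and m: "m \<ge> 1" and y: "y > 0" and l: "l \<ge> 1" and ly: "ln y = \<theta> * l" and \<theta>: "\<theta> \<ge> 0"
  shows "cmod (merw_mean m (\<lambda>K. iexp ((u /\<^sub>R sqrt (y * l)) \<bullet> sum_mset K))
      - exp (- ((norm u)\<^sup>2 * \<theta> / (2 * real DIM('b)) * (real m / y))))
    \<le> (C * ((norm u)\<^sup>2 + norm u ^ 3) + (norm u)\<^sup>2) * (1 + (real m / y)\<^sup>2) / l"
proof -
  define x where "x = real m / y"
  define n where "n = norm u"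
  let ?d = "2 * real DIM('b)"
  have x: "x > 0" using m y by (simp add: x_def)
  have n: "n \<ge> 0" by (simp add: n_def)
  define b where "b = sqrt (y * l)"
  have b: "b > 0" "b\<^sup>2 = y * l" using y l by (auto simp: b_def)
  have nb: "norm (u /\<^sub>R b) = n / b" using b by (simp add: divide_inverse n_def)
  have lnm: "ln (real m) = ln x + \<theta> * l"
    using m y by (simp add: x_def ln_div ly)
  have e1: "(n / b)\<^sup>2 * (real m * ln (real m)) = n\<^sup>2 * (x * \<theta> + x * ln x / l)"
    unfolding power_divide b(2) lnm using y l by (simp add: x_def field_simps)
  have e2: "(n / b)\<^sup>2 * real m = n\<^sup>2 * (x / l)"
    unfolding power_divide b(2) using y l by (simp add: x_def)
  have e3: "(n / b) ^ 3 * real m powr (3/2) \<le> n ^ 3 * (x powr (3/2) / l)"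
  proof -
    have "b ^ 3 = (y * l) powr (3/2)"
      using b y l by (simp add: b_def powr_half_sqrt[symmetric] powr_powr powr_numeral[symmetric] del: powr_numeral)
    also have "\<dots> = y powr (3/2) * l powr (3/2)" by (rule powr_mult)
    finally have "(n / b) ^ 3 * real m powr (3/2) = n ^ 3 * (x powr (3/2) / l powr (3/2))"
      using y l by (simp add: power_divide x_def powr_divide)
    also have "\<dots> \<le> n ^ 3 * (x powr (3/2) / l powr 1)"
      using n l by (intro mult_left_mono divide_left_mono powr_mono mult_pos_pos) auto
    finally show ?thesis using l by simp
  qed
  have lnm0: "0 \<le> ln (real m)" using m by simp
  have A: "cmod (merw_mean m (\<lambda>K. iexp ((u /\<^sub>R b) \<bullet> sum_mset K))
      - exp (- (n\<^sup>2 * (x * \<theta> + x * ln x / l) / ?d))) \<le> C * (n\<^sup>2 * (x / l) + n ^ 3 * (x powr (3/2) / l))"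
  proof -
    have "C * (n\<^sup>2 * (x / l) + (n / b) ^ 3 * real m powr (3/2)) \<le> C * (n\<^sup>2 * (x / l) + n ^ 3 * (x powr (3/2) / l))"
      using C(1) e3 by (intro mult_left_mono add_left_mono)
    then show ?thesis using C(2)[of m "u /\<^sub>R b"] unfolding merw_char_error_def nb e1 e2 by linarith
  qed
  have "\<bar>exp (- (n\<^sup>2 * (x * \<theta> + x * ln x / l) / ?d)) - exp (- (n\<^sup>2 * \<theta> / ?d * x))\<bar>
      \<le> \<bar>n\<^sup>2 * (x * \<theta> + x * ln x / l) / ?d - n\<^sup>2 * \<theta> / ?d * x\<bar>"
  proof (rule exp_minus_lipschitz)
    show "0 \<le> n\<^sup>2 * (x * \<theta> + x * ln x / l) / ?d" unfolding e1[symmetric] using lnm0 by simp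
    show "0 \<le> n\<^sup>2 * \<theta> / ?d * x" using x \<theta> by simp
  qed
  also have "n\<^sup>2 * (x * \<theta> + x * ln x / l) / ?d - n\<^sup>2 * \<theta> / ?d * x = n\<^sup>2 / ?d * ((x * ln x) / l)"
    by (simp add: algebra_simps add_divide_distrib)
  also have "\<bar>\<dots>\<bar> = n\<^sup>2 / ?d * (\<bar>x * ln x\<bar> / l)" using l by (simp add: abs_mult)
  also have "\<dots> \<le> n\<^sup>2 * (\<bar>x * ln x\<bar> / l)"
  proof (rule mult_right_mono)
    have d: "1 \<le> ?d" using real_DIM_ge_1[where 'a = 'b] by linarith
    have "n\<^sup>2 / ?d \<le> n\<^sup>2 / 1" using d by (intro divide_left_mono) auto
    then show "n\<^sup>2 / ?d \<le> n\<^sup>2" by simp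
  qed (use l in auto)
  finally have "\<bar>exp (- (n\<^sup>2 * (x * \<theta> + x * ln x / l) / ?d)) - exp (- (n\<^sup>2 * \<theta> / ?d * x))\<bar> \<le> n\<^sup>2 * (\<bar>x * ln x\<bar> / l)" .
  then have "cmod (complex_of_real (exp (- (n\<^sup>2 * (x * \<theta> + x * ln x / l) / ?d))) - complex_of_real (exp (- (n\<^sup>2 * \<theta> / ?d * x)))) \<le> n\<^sup>2 * (\<bar>x * ln x\<bar> / l)"
    by (simp only: of_real_diff[symmetric] norm_of_real)
  from norm_diff_triangle_le[OF A this]
  have "cmod (merw_mean m (\<lambda>K. iexp ((u /\<^sub>R b) \<bullet> sum_mset K)) - exp (- (n\<^sup>2 * \<theta> / ?d * x)))
    \<le> C * (n\<^sup>2 * (x / l) + n ^ 3 * (x powr (3/2) / l)) + n\<^sup>2 * (\<bar>x * ln x\<bar> / l)" .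
  also have "\<dots> \<le> C * (n\<^sup>2 * ((1 + x\<^sup>2) / l) + n ^ 3 * ((1 + x\<^sup>2) / l)) + n\<^sup>2 * ((1 + x\<^sup>2) / l)"
    using elementary_bounds[OF x] n l C(1) by (intro add_mono mult_left_mono divide_right_mono) auto
  also have "\<dots> = (C * (n\<^sup>2 + n ^ 3) + n\<^sup>2) * (1 + x\<^sup>2) / l" by (simp add: algebra_simps add_divide_distrib)
  finally show ?thesis unfolding n_def x_def b_def .
qed

context merws begin

lemma history_mean_complex:
  fixes G :: "(real^'d) multiset \<Rightarrow> complex"
  assumes crit: "p = critical_p (CARD('d)) r"
  shows "history_mean (Suc n) (\<lambda>l. G (moved l)) =
    moves_mean (1 - r) n (\<lambda>N. merw_mean N G)"
proof (rule complex_eqI)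
  have "Re (history_mean (Suc n) (\<lambda>l. G (moved l))) = history_mean (Suc n) (\<lambda>l. Re (G (moved l)))"
    by (simp add: history_mean_def)
  then show "Re (history_mean (Suc n) (\<lambda>l. G (moved l))) =
    Re (moves_mean (1 - r) n (\<lambda>N. merw_mean N G))"
    using law_of_moved[OF crit, of n "\<lambda>K. Re (G K)"] by simp
  have "Im (history_mean (Suc n) (\<lambda>l. G (moved l))) = history_mean (Suc n) (\<lambda>l. Im (G (moved l)))"
    by (simp add: history_mean_def)
  then show "Im (history_mean (Suc n) (\<lambda>l. G (moved l))) =
    Im (moves_mean (1 - r) n (\<lambda>N. merw_mean N G))"
    using law_of_moved[OF crit, of n "\<lambda>K. Im (G K)"] by simp
qed

lemma walk_eq_moved: "walk X n \<omega> = sum_mset (moved (history n \<omega>))"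
proof -
  have "sum_mset (moved l) = sum_list l" for l by (induction l) (auto simp: moved_def)
  moreover have "walk X n \<omega> = sum_list (history n \<omega>)"
    by (induction n) (auto simp: history_Suc, simp add: history_def)
  ultimately show ?thesis by simp
qed

lemma sigma_sq_eq_moved:
  assumes "history n \<omega> \<in> histories n"
  shows "sigma_sq X n \<omega> = real (size (moved (history n \<omega>)))"
proof -
  have "real (size (moved l)) = (\<Sum>v\<leftarrow>l. (norm v)\<^sup>2)" if "set l \<subseteq> insert 0 directions" for l
    using that by (induction l) (auto simp: moved_def norm_directions)
  moreover have "sigma_sq X n \<omega> = (\<Sum>v\<leftarrow>history n \<omega>. (norm v)\<^sup>2)"
    by (induction n) (simp_all add: history_Suc sigma_sq_def, simp add: history_def)
  ultimately show ?thesis using assms by (simp add: histories_def)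
qed

lemma walk_measurable [measurable]: "walk X n \<in> borel_measurable M"
proof (induction n)
  case (Suc n)
  have "walk X (Suc n) = (\<lambda>\<omega>. walk X n \<omega> + X (Suc n) \<omega>)" by (rule ext) simp
  then show ?case using Suc X_measurable[of "Suc n"] by simp
qed (simp add: walk_def)

lemma sigma_sq_measurable [measurable]: "sigma_sq X n \<in> borel_measurable M"
proof -
  have "sigma_sq X n = (\<lambda>\<omega>. \<Sum>k=1..n. (norm (X k \<omega>))\<^sup>2)" by (rule ext) (simp add: sigma_sq_def)
  moreover have "\<dots> \<in> borel_measurable M" using X_measurable by (intro borel_measurable_sum) auto
  ultimately show ?thesis by simp
qed

lemma self_normalised_limit:
  assumes crit: "p = critical_p (CARD('d)) r"
  shows "weakly_converges
    (\<lambda>n. distr M borel (\<lambda>\<omega>. walk X n \<omega> /\<^sub>R sqrt (sigma_sq X n \<omega> * ln (sigma_sq X n \<omega>))))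
    (gaussian_measure 0 ((1 / real CARD('d)) *\<^sub>R mat 1))"
  unfolding weakly_converges_def
proof (intro allI impI)
  fix f :: "real^'d \<Rightarrow> real"
  assume f: "continuous_on UNIV f" "bounded (range f)"
  let ?L = "integral\<^sup>L (gaussian_measure 0 ((1 / real CARD('d)) *\<^sub>R mat 1)) f"
  let ?Y = "\<lambda>n \<omega>. walk X n \<omega> /\<^sub>R sqrt (sigma_sq X n \<omega> * ln (sigma_sq X n \<omega>))"
  define F where "F K = f (sum_mset K /\<^sub>R sqrt (real (size K) * ln (real (size K))))" for K
  define a where "a m = merw_mean m (\<lambda>K. f (sum_mset K /\<^sub>R sqrt (real m * ln (real m))))" for m
  obtain B where B: "\<And>x. \<bar>f x\<bar> \<le> B" using f(2) unfolding bounded_iff by auto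
  have fm: "f \<in> borel_measurable borel" by (rule borel_measurable_continuous_onI[OF f(1)])
  have Ym: "?Y n \<in> borel_measurable M" for n by measurable
  have aF: "merw_mean m F = a m" for m
    unfolding a_def F_def by (rule integral_cong_AE) (use set_pmf_merw in \<open>auto simp: AE_measure_pmf_iff\<close>)
  have aB: "\<bar>a m\<bar> \<le> B" for m
  proof -
    have "\<bar>a m\<bar> \<le> merw_mean m (\<lambda>K. \<bar>f (sum_mset K /\<^sub>R sqrt (real m * ln (real m)))\<bar>)"
      unfolding a_def by (rule integral_abs_bound)
    also have "\<dots> \<le> merw_mean m (\<lambda>K :: (real^'d) multiset. B)" by (rule integral_mono) (use B in auto)
    finally show ?thesis by simp
  qed
  have "integral\<^sup>L (distr M borel (?Y (Suc n))) f = moves_mean (1 - r) n a" for n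
  proof -
    have "integral\<^sup>L (distr M borel (?Y (Suc n))) f = expectation (\<lambda>\<omega>. f (?Y (Suc n) \<omega>))"
      by (rule integral_distr[OF Ym fm])
    also have "\<dots> = history_mean (Suc n) (\<lambda>l. F (moved l))"
      by (rule expectation_history)
         (use measurable_compose[OF Ym fm] in \<open>auto simp: F_def walk_eq_moved sigma_sq_eq_moved simp del: walk.simps\<close>)
    also have "\<dots> = moves_mean (1 - r) n (\<lambda>m. merw_mean m F)"
      by (rule law_of_moved[OF crit])
    finally show ?thesis by (simp add: aF)
  qed
  moreover have "(\<lambda>n. moves_mean (1 - r) n a) \<longlonglongrightarrow> ?L"
    by (rule moves_averages_tendsto[OF _ _ _ aB]) (use r_range merw_weak_limit[OF f] in \<open>auto simp: a_def\<close>)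
  ultimately have "(\<lambda>n. integral\<^sup>L (distr M borel (?Y (Suc n))) f) \<longlonglongrightarrow> ?L" by (simp only:)
  then show "(\<lambda>n. integral\<^sup>L (distr M borel (?Y n)) f) \<longlonglongrightarrow> ?L" by (rule LIMSEQ_imp_Suc)
qed

text \<open>
  The errors of the preceding bound average out since the second moments of the rescaled number
  of moves are bounded. What remains is a Laplace transform of that number.
\<close>

lemma walk_char_limit:
  assumes crit: "p = critical_p (CARD('d)) r"
    and \<nu>: "\<And>s. s \<ge> 0 \<Longrightarrow> (\<lambda>n. moves_mean (1 - r) n (\<lambda>N. exp (- s * (real N / real (Suc n) powr (1 - r)))))
      \<longlonglongrightarrow> (\<integral>x. exp (- s * x) \<partial>\<nu>)"
  shows "(\<lambda>n. expectation (\<lambda>\<omega>. iexp (u \<bullet> (walk X n \<omega> /\<^sub>R sqrt (real n powr (1 - r) * ln (real n))))))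
    \<longlonglongrightarrow> complex_of_real (\<integral>x. exp (- ((norm u)\<^sup>2 * (1 - r) / (2 * real CARD('d))) * x) \<partial>\<nu>)"
proof -
  define \<theta> where "\<theta> = 1 - r"
  have \<theta>: "0 < \<theta>" "\<theta> \<le> 1" using r_range by (auto simp: \<theta>_def)
  let ?E = "\<lambda>n. moves_mean \<theta> n"
  let ?y = "\<lambda>n. real (Suc n) powr \<theta>"
  let ?l = "\<lambda>n. ln (real (Suc n))"
  define s where "s = (norm u)\<^sup>2 * \<theta> / (2 * real CARD('d))"
  have s: "s \<ge> 0" using \<theta> by (simp add: s_def)
  obtain C where C: "C \<ge> 0" "\<And>m (u :: real^'d). merw_char_error m u \<le> C * ((norm u)\<^sup>2 * real m + norm u ^ 3 * real m powr (3/2))"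
    using merw_char_bound by blast
  define c where "c = C * ((norm u)\<^sup>2 + norm u ^ 3) + (norm u)\<^sup>2"
  define \<phi> where "\<phi> n m = merw_mean m (\<lambda>K. iexp ((u /\<^sub>R sqrt (?y n * ?l n)) \<bullet> sum_mset K))" for n m
  have law: "expectation (\<lambda>\<omega>. iexp (u \<bullet> (walk X (Suc n) \<omega> /\<^sub>R sqrt (?y n * ?l n)))) = ?E n (\<phi> n)" for n
  proof -
    have "(\<lambda>\<omega>. iexp (u \<bullet> (walk X (Suc n) \<omega> /\<^sub>R sqrt (?y n * ?l n)))) \<in> borel_measurable M" by measurable
    then have "expectation (\<lambda>\<omega>. iexp (u \<bullet> (walk X (Suc n) \<omega> /\<^sub>R sqrt (?y n * ?l n)))) =
        history_mean (Suc n) (\<lambda>l. iexp ((u /\<^sub>R sqrt (?y n * ?l n)) \<bullet> sum_mset (moved l)))"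
      by (rule expectation_history) (simp add: walk_eq_moved del: walk.simps of_nat_Suc)
    then show ?thesis unfolding \<phi>_def \<theta>_def using history_mean_complex[OF crit] by simp
  qed
  have bound: "cmod (?E n (\<phi> n) - complex_of_real (?E n (\<lambda>m. exp (- s * (real m / ?y n))))) \<le> c * ?E n (\<lambda>m. 1 + (real m / ?y n)\<^sup>2) / ?l n"
    if n: "n \<ge> 2" for n
  proof -
    have l: "?l n \<ge> 1"
    proof -
      have "exp 1 \<le> real (Suc n)" using exp_le n by simp
      then show ?thesis by (metis exp_gt_zero ln_exp ln_mono)
    qed
    have "?E n (\<phi> n) - complex_of_real (?E n (\<lambda>m. exp (- s * (real m / ?y n)))) = ?E n (\<lambda>m. \<phi> n m - complex_of_real (exp (- s * (real m / ?y n))))"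
      by (simp only: Bochner_Integration.integral_diff[OF integrable_moves integrable_moves] integral_complex_of_real)
    also have "cmod \<dots> \<le> ?E n (\<lambda>m. cmod (\<phi> n m - complex_of_real (exp (- s * (real m / ?y n)))))" by (rule integral_norm_bound)
    also have "\<dots> \<le> ?E n (\<lambda>m. c * (1 + (real m / ?y n)\<^sup>2) / ?l n)"
    proof (rule expectation_moves_mono)
      fix m :: nat assume m: "1 \<le> m"
      have "cmod (\<phi> n m - exp (- ((norm u)\<^sup>2 * \<theta> / (2 * real DIM(real^'d)) * (real m / ?y n)))) \<le> c * (1 + (real m / ?y n)\<^sup>2) / ?l n"
        unfolding \<phi>_def c_def
        by (rule merw_char_at_move_scale[OF C m _ l _ less_imp_le[OF \<theta>(1)]]) (auto simp: ln_powr)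
      then show "cmod (\<phi> n m - complex_of_real (exp (- s * (real m / ?y n)))) \<le> c * (1 + (real m / ?y n)\<^sup>2) / ?l n"
        by (simp add: s_def del: of_nat_Suc)
    qed
    also have "\<dots> = c * ?E n (\<lambda>m. 1 + (real m / ?y n)\<^sup>2) / ?l n"
      by (simp only: integral_mult_right_zero integral_divide_zero)
    finally show ?thesis .
  qed
  have "(\<lambda>n. c * ?E n (\<lambda>m. 1 + (real m / ?y n)\<^sup>2) / ?l n) \<longlonglongrightarrow> 0"
  proof -
    have "(\<lambda>n. c * (1 + ?E n (\<lambda>m. (real m / ?y n)\<^sup>2)) * (1 / ?l n)) \<longlonglongrightarrow> c * (1 + fact 2 / Gamma (1 + real 2 * \<theta>)) * 0"
    proof (intro tendsto_mult tendsto_const tendsto_add moves_moment_limit \<theta>)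
      show "(\<lambda>n. 1 / ?l n) \<longlonglongrightarrow> 0" by real_asymp
    qed
    moreover have "?E n (\<lambda>m. 1 + (real m / ?y n)\<^sup>2) = 1 + ?E n (\<lambda>m. (real m / ?y n)\<^sup>2)" for n by (simp del: of_nat_Suc)
    ultimately show ?thesis by simp
  qed
  then have "(\<lambda>n. ?E n (\<phi> n) - complex_of_real (?E n (\<lambda>m. exp (- s * (real m / ?y n))))) \<longlonglongrightarrow> 0"
    by (rule Lim_null_comparison[rotated]) (rule eventually_sequentiallyI[of 2], rule bound)
  moreover have "(\<lambda>n. complex_of_real (?E n (\<lambda>m. exp (- s * (real m / ?y n))))) \<longlonglongrightarrow> complex_of_real (\<integral>x. exp (- s * x) \<partial>\<nu>)"
    using \<nu>[OF s] unfolding \<theta>_def by (intro tendsto_of_real)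
  ultimately have "(\<lambda>n. ?E n (\<phi> n)) \<longlonglongrightarrow> complex_of_real (\<integral>x. exp (- s * x) \<partial>\<nu>)"
    using tendsto_add by fastforce
  then have "(\<lambda>n. expectation (\<lambda>\<omega>. iexp (u \<bullet> (walk X (Suc n) \<omega> /\<^sub>R sqrt (real (Suc n) powr (1 - r) * ln (real (Suc n))))))) \<longlonglongrightarrow> complex_of_real (\<integral>x. exp (- s * x) \<partial>\<nu>)"
    unfolding law[symmetric] unfolding \<theta>_def .
  then show ?thesis unfolding s_def \<theta>_def by (rule LIMSEQ_imp_Suc)
qed

end


lemma mixture_law:
  assumes \<nu>: "real_distribution \<nu>" and \<gamma>: "prob_space \<gamma>" "sets \<gamma> = sets (borel :: (real^'d) measure)"
  shows "prob_space (\<nu> \<Otimes>\<^sub>M \<gamma>)"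
    and "distr (\<nu> \<Otimes>\<^sub>M \<gamma>) borel fst = \<nu>" "distr (\<nu> \<Otimes>\<^sub>M \<gamma>) borel snd = \<gamma>"
    and "indep_rv (\<nu> \<Otimes>\<^sub>M \<gamma>) borel fst borel snd"
proof -
  interpret \<nu>: real_distribution \<nu> by fact
  interpret \<gamma>: prob_space \<gamma> by fact
  interpret P: pair_prob_space \<nu> \<gamma> ..
  have sp: "space \<nu> = UNIV" "space \<gamma> = UNIV" using sets_eq_imp_space_eq[OF \<gamma>(2)] by auto
  show "prob_space (\<nu> \<Otimes>\<^sub>M \<gamma>)" by (rule P.prob_space_axioms)
  have f: "fst \<in> measurable (\<nu> \<Otimes>\<^sub>M \<gamma>) borel" using measurable_fst[of \<nu> \<gamma>] by (simp cong: measurable_cong_sets)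
  have s: "snd \<in> measurable (\<nu> \<Otimes>\<^sub>M \<gamma>) borel" using measurable_snd[of \<nu> \<gamma>] \<gamma>(2) by (simp cong: measurable_cong_sets)
  have fst_eq: "fst -` A \<inter> space (\<nu> \<Otimes>\<^sub>M \<gamma>) = A \<times> UNIV" for A by (auto simp: space_pair_measure sp)
  have snd_eq: "snd -` B \<inter> space (\<nu> \<Otimes>\<^sub>M \<gamma>) = UNIV \<times> B" for B by (auto simp: space_pair_measure sp)
  have times: "emeasure (\<nu> \<Otimes>\<^sub>M \<gamma>) (A \<times> B) = emeasure \<nu> A * emeasure \<gamma> B" if "A \<in> sets borel" "B \<in> sets borel" for A B
    by (rule \<gamma>.emeasure_pair_measure_Times) (use that \<gamma>(2) in auto)
  have one: "emeasure \<nu> UNIV = 1" "emeasure \<gamma> UNIV = 1" using \<nu>.emeasure_space_1 \<gamma>.emeasure_space_1 sp by auto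
  show "distr (\<nu> \<Otimes>\<^sub>M \<gamma>) borel fst = \<nu>"
  proof (rule measure_eqI)
    fix A assume "A \<in> sets (distr (\<nu> \<Otimes>\<^sub>M \<gamma>) borel fst)"
    then have A: "A \<in> sets borel" by simp
    then show "emeasure (distr (\<nu> \<Otimes>\<^sub>M \<gamma>) borel fst) A = emeasure \<nu> A"
      by (subst emeasure_distr[OF f A]) (simp only: fst_eq times[OF A] one space_borel sets.top, simp add: times[OF A] one)
  qed simp
  show "distr (\<nu> \<Otimes>\<^sub>M \<gamma>) borel snd = \<gamma>"
  proof (rule measure_eqI)
    fix B assume "B \<in> sets (distr (\<nu> \<Otimes>\<^sub>M \<gamma>) borel snd)"
    then have B: "B \<in> sets borel" by simp
    then show "emeasure (distr (\<nu> \<Otimes>\<^sub>M \<gamma>) borel snd) B = emeasure \<gamma> B"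
      by (subst emeasure_distr[OF s B]) (simp only: snd_eq, simp add: times one)
  qed (simp add: \<gamma>(2))
  show "indep_rv (\<nu> \<Otimes>\<^sub>M \<gamma>) borel fst borel snd"
    unfolding indep_rv_def
  proof (intro conjI f s)
    let ?S = "space (\<nu> \<Otimes>\<^sub>M \<gamma>)"
    have vf: "\<exists>A'\<in>sets borel. A = fst -` A' \<inter> ?S" if "A \<in> sets (vimage_algebra ?S fst borel)" for A
      using that by (subst (asm) sets_vimage_algebra2) auto
    have vs: "\<exists>B'\<in>sets borel. B = snd -` B' \<inter> ?S" if "B \<in> sets (vimage_algebra ?S snd borel)" for B :: "(real \<times> (real^'d)) set"
      using that by (subst (asm) sets_vimage_algebra2) auto
    show "P.indep_set (sets (vimage_algebra ?S fst borel)) (sets (vimage_algebra ?S snd borel))"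
    proof (rule P.indep_setI)
      show "sets (vimage_algebra ?S fst borel) \<subseteq> P.events" using vf measurable_sets[OF f] by blast
      show "sets (vimage_algebra ?S snd borel) \<subseteq> P.events" using vs measurable_sets[OF s] by blast
      fix A B assume "A \<in> sets (vimage_algebra ?S fst borel)" "B \<in> sets (vimage_algebra ?S snd borel)"
      then obtain A' B' where A': "A' \<in> sets borel" "A = A' \<times> UNIV" and B': "B' \<in> sets borel" "B = UNIV \<times> B'"
        using vf vs by (metis fst_eq snd_eq)
      have "A \<inter> B = A' \<times> B'" using A' B' by auto
      moreover have "emeasure (\<nu> \<Otimes>\<^sub>M \<gamma>) (A' \<times> B') = emeasure (\<nu> \<Otimes>\<^sub>M \<gamma>) (A' \<times> UNIV) * emeasure (\<nu> \<Otimes>\<^sub>M \<gamma>) (UNIV \<times> B')"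
        using A' B' by (simp add: times one)
      ultimately show "P.prob (A \<inter> B) = P.prob A * P.prob B"
        using A' B' by (simp add: measure_def enn2real_mult)
    qed
  qed
qed

lemma gaussian_mixture_char:
  fixes u :: "real^'d"
  assumes \<nu>: "real_distribution \<nu>" "AE x in \<nu>. x > 0" and v: "v > 0" and \<theta>: "\<theta> > 0"
  defines "\<gamma> \<equiv> gaussian_measure 0 (v *\<^sub>R mat 1 :: real^'d^'d)"
  shows "(\<integral>z. iexp (u \<bullet> (sqrt (\<theta> * fst z) *\<^sub>R snd z)) \<partial>(\<nu> \<Otimes>\<^sub>M \<gamma>)) = (\<integral>x. exp (- ((norm u)\<^sup>2 * \<theta> * v / 2) * x) \<partial>\<nu>)"
proof -
  interpret \<nu>: real_distribution \<nu> by fact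
  interpret \<gamma>: prob_space \<gamma> unfolding \<gamma>_def by (rule prob_space_gaussian_measure[OF v])
  interpret P: pair_prob_space \<nu> \<gamma> ..
  have sets\<gamma>: "sets \<gamma> = sets borel" by (simp add: \<gamma>_def)
  let ?f = "\<lambda>z. iexp (u \<bullet> (sqrt (\<theta> * fst z) *\<^sub>R snd z))"
  have [measurable_cong]: "sets \<nu> = sets borel" "sets \<gamma> = sets borel" using sets\<gamma> by auto
  have "?f \<in> borel_measurable (\<nu> \<Otimes>\<^sub>M \<gamma>)" by measurable
  then have "integrable (\<nu> \<Otimes>\<^sub>M \<gamma>) ?f" by (intro P.integrable_const_bound[of _ 1]) auto
  then have "(\<integral>z. ?f z \<partial>(\<nu> \<Otimes>\<^sub>M \<gamma>)) = (\<integral>x. \<integral>w. ?f (x, w) \<partial>\<gamma> \<partial>\<nu>)"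
    by (rule P.integral_fst'[symmetric])
  also have "\<dots> = (\<integral>x. complex_of_real (exp (- ((norm u)\<^sup>2 * \<theta> * v / 2) * max x 0)) \<partial>\<nu>)"
  proof (rule integral_cong_AE)
    show "(\<lambda>x. \<integral>w. ?f (x, w) \<partial>\<gamma>) \<in> borel_measurable \<nu>" by measurable
    show "AE x in \<nu>. (\<integral>w. ?f (x, w) \<partial>\<gamma>) = complex_of_real (exp (- ((norm u)\<^sup>2 * \<theta> * v / 2) * max x 0))"
      using \<nu>(2)
    proof eventually_elim
      case (elim x)
      have "(\<integral>w. ?f (x, w) \<partial>\<gamma>) = (\<integral>w. iexp ((sqrt (\<theta> * x) *\<^sub>R u) \<bullet> w) \<partial>\<gamma>)" by simp
      also have "\<dots> = exp (- v * (norm (sqrt (\<theta> * x) *\<^sub>R u))\<^sup>2 / 2)"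
        unfolding \<gamma>_def by (rule char_gaussian_measure[OF v])
      also have "- v * (norm (sqrt (\<theta> * x) *\<^sub>R u))\<^sup>2 / 2 = - ((norm u)\<^sup>2 * \<theta> * v / 2) * max x 0"
        using elim \<theta> by (simp add: power_mult_distrib max_def)
      finally show ?case .
    qed
  qed measurable
  also have "\<dots> = complex_of_real (\<integral>x. exp (- ((norm u)\<^sup>2 * \<theta> * v / 2) * max x 0) \<partial>\<nu>)"
    by (rule integral_complex_of_real)
  also have "(\<integral>x. exp (- ((norm u)\<^sup>2 * \<theta> * v / 2) * max x 0) \<partial>\<nu>) = (\<integral>x. exp (- ((norm u)\<^sup>2 * \<theta> * v / 2) * x) \<partial>\<nu>)"
  proof (rule integral_cong_AE)
    show "AE x in \<nu>. exp (- ((norm u)\<^sup>2 * \<theta> * v / 2) * max x 0) = exp (- ((norm u)\<^sup>2 * \<theta> * v / 2) * x)"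
      using \<nu>(2) by eventually_elim simp
  qed measurable
  finally show ?thesis .
qed

lemma mittag_leffler_distributed_distr:
  assumes "mittag_leffler_distributed (distr M borel Y) \<alpha> (\<lambda>x. x)" "Y \<in> borel_measurable M"
  shows "mittag_leffler_distributed M \<alpha> Y"
proof -
  have "(\<integral>x. exp (t * x) \<partial>distr M borel Y) = (\<integral>\<omega>. exp (t * Y \<omega>) \<partial>M)" for t :: real
    by (rule integral_distr[OF assms(2)]) simp
  moreover have "integrable (distr M borel Y) (\<lambda>x. exp (t * x)) \<longleftrightarrow> integrable M (\<lambda>\<omega>. exp (t * Y \<omega>))" for t :: real
    by (rule integrable_distr_eq[OF assms(2)]) simp
  moreover have "(AE x in distr M borel Y. x > 0) \<longleftrightarrow> (AE \<omega> in M. Y \<omega> > 0)"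
    by (rule AE_distr_iff[OF assms(2)]) simp
  ultimately show ?thesis using assms unfolding mittag_leffler_distributed_def by simp
qed

theorem theorem3p6:
  fixes M :: "'a measure"
    and c :: "nat \<Rightarrow> 'd::finite"
    and p q r :: real
    and X :: "nat \<Rightarrow> 'a \<Rightarrow> real^'d"
    and A :: "nat \<Rightarrow> 'a \<Rightarrow> real^'d^'d"
    and U :: "nat \<Rightarrow> 'a \<Rightarrow> nat"
  assumes "merws M c p q r X A U"
    and "p = critical_p (CARD('d)) r"
  shows "weakly_converges
           (\<lambda>n. distr M borel (\<lambda>\<omega>. walk X n \<omega> /\<^sub>R sqrt (sigma_sq X n \<omega> * ln (sigma_sq X n \<omega>))))
           (gaussian_measure 0 ((1 / real CARD('d)) *\<^sub>R mat 1))
         \<and> (\<exists>(N :: (real \<times> (real^'d)) measure) \<Sigma>' Z.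
           prob_space N \<and>
           mittag_leffler_distributed N (1 - r) \<Sigma>' \<and>
           Z \<in> borel_measurable N \<and>
           distr N borel Z = gaussian_measure 0 ((1 / real CARD('d)) *\<^sub>R mat 1) \<and>
           indep_rv N borel \<Sigma>' borel Z \<and>
           weakly_converges
             (\<lambda>n. distr M borel (\<lambda>\<omega>. walk X n \<omega> /\<^sub>R sqrt (real n powr (1 - r) * ln (real n))))
             (distr N borel (\<lambda>\<eta>. sqrt ((1 - r) * \<Sigma>' \<eta>) *\<^sub>R Z \<eta>)))"
proof -
  interpret merws M c p q r X A U by fact
  have \<theta>: "0 < 1 - r" "1 - r \<le> 1" using r_range by auto
  obtain \<nu> where \<nu>: "real_distribution \<nu>" "mittag_leffler_distributed \<nu> (1 - r) (\<lambda>x. x)"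
    and laplace: "\<And>s. s \<ge> 0 \<Longrightarrow> (\<lambda>n. moves_mean (1 - r) n (\<lambda>N. exp (- s * (real N / real (Suc n) powr (1 - r)))))
      \<longlonglongrightarrow> (\<integral>x. exp (- s * x) \<partial>\<nu>)"
    using moves_mittag_leffler_limit[OF \<theta>] by blast
  define \<gamma> where "\<gamma> = gaussian_measure 0 ((1 / real CARD('d)) *\<^sub>R mat 1 :: real^'d^'d)"
  have v: "1 / real CARD('d) > 0" by simp
  have \<gamma>: "prob_space \<gamma>" "sets \<gamma> = sets borel" unfolding \<gamma>_def by (rule prob_space_gaussian_measure[OF v]) simp
  define N where "N = \<nu> \<Otimes>\<^sub>M \<gamma>"
  note mix = mixture_law[OF \<nu>(1) \<gamma>, folded N_def]
  have fst: "fst \<in> borel_measurable N" and snd: "snd \<in> borel_measurable N" using mix(4) unfolding indep_rv_def by auto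
  let ?W = "\<lambda>n \<omega>. walk X n \<omega> /\<^sub>R sqrt (real n powr (1 - r) * ln (real n))"
  let ?T = "\<lambda>\<eta>. sqrt ((1 - r) * fst \<eta>) *\<^sub>R snd \<eta>"
  have Wm: "?W n \<in> borel_measurable M" for n by measurable
  have Tm: "?T \<in> borel_measurable N" using fst snd by measurable
  have "weakly_converges (\<lambda>n. distr M borel (?W n)) (distr N borel ?T)"
  proof (rule weakly_converges_if_char_tendsto)
    show "prob_space (distr M borel (?W n))" for n by (rule prob_space_distr[OF Wm])
    show "prob_space (distr N borel ?T)" by (rule prob_space.prob_space_distr[OF mix(1) Tm])
    fix u :: "real^'d"
    have "(\<integral>x. iexp (u \<bullet> x) \<partial>distr M borel (?W n)) = expectation (\<lambda>\<omega>. iexp (u \<bullet> ?W n \<omega>))" for n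
      by (rule integral_distr[OF Wm]) simp
    moreover have "(\<integral>x. iexp (u \<bullet> x) \<partial>distr N borel ?T) = (\<integral>\<eta>. iexp (u \<bullet> ?T \<eta>) \<partial>N)"
      by (rule integral_distr[OF Tm]) simp
    moreover have "(\<integral>\<eta>. iexp (u \<bullet> ?T \<eta>) \<partial>N) = complex_of_real (\<integral>x. exp (- ((norm u)\<^sup>2 * (1 - r) * (1 / real CARD('d)) / 2) * x) \<partial>\<nu>)"
      unfolding N_def \<gamma>_def by (rule gaussian_mixture_char) (use \<nu> v \<theta> in \<open>auto simp: mittag_leffler_distributed_def\<close>)
    moreover have "(norm u)\<^sup>2 * (1 - r) * (1 / real CARD('d)) / 2 = (norm u)\<^sup>2 * (1 - r) / (2 * real CARD('d))" by simp
    ultimately show "(\<lambda>n. \<integral>x. iexp (u \<bullet> x) \<partial>distr M borel (?W n)) \<longlonglongrightarrow> (\<integral>x. iexp (u \<bullet> x) \<partial>distr N borel ?T)"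
      using walk_char_limit[OF assms(2) laplace, of u] by (simp only:)
  qed simp_all
  moreover have "mittag_leffler_distributed N (1 - r) fst"
    by (rule mittag_leffler_distributed_distr[OF _ fst]) (simp add: mix(2) \<nu>(2))
  ultimately show ?thesis
    using self_normalised_limit[OF assms(2)] mix(1,3,4) snd unfolding \<gamma>_def by blast
qed

end
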